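(* The structure $\mathrm{QSet}$, whose objects are quantum sets, whose 1-morphisms are quantum functions, and whose 2-morphisms are intertwiners of quantum functions, is a dagger 2-category, where the dagger of a 2-morphism is the Hilbert space adjoint of its underlying linear map.
   Context: All Hilbert spaces are finite-dimensional and complex; coherence isomorphisms of $\otimes$ are suppressed. A quantum set is a special symmetric dagger Frobenius algebra: a Hilbert space $A$ with linear maps $m_A:A\otimes A\to A$, $u_A:\mathbb{C}\to A$ forming an associative unital algebra such that, writing $\Delta_A=m_A^\dagger$, $\epsilon_A=u_A^\dagger$, one has $(m_A\otimes \mathrm{id})(\mathrm{id}\otimes\Delta_A)=\Delta_A m_A=(\mathrm{id}\otimes m_A)(\Delta_A\otimes\mathrm{id})$ (Frobenius), $m_A\Delta_A=\mathrm{id}_A$ (special), and $\epsilon_A m_A\sigma=\epsilon_A m_A$ with $\sigma$ the swap map (symmetric). A quantum function $(H,P):A\to B$ between quantum sets is a Hilbert space $H$ and a linear map $P:H\otimes A\to B\otimes H$ such that (i) $(\Delta_B\otimes\mathrm{id}_H)P=(\mathrm{id}_B\otimes P)(P\otimes \mathrm{id}_A)(\mathrm{id}_H\otimes\Delta_A)$; (ii) $(\epsilon_B\otimes\mathrm{id}_H)P=\mathrm{id}_H\otimes\epsilon_A$; (iii) $P^\dagger=(\epsilon_Bm_B\otimes\mathrm{id}_H\otimes\mathrm{id}_A)(\mathrm{id}_B\otimes P\otimes\mathrm{id}_A)(\mathrm{id}_B\otimes\mathrm{id}_H\otimes\Delta_Au_A)$. An intertwiner $(H,P)\to(H',P')$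 of quantum functions $A\to B$ is a linear map $f:H\to H'$ with $(\mathrm{id}_B\otimes f)P=P'(f\otimes\mathrm{id}_A)$. The composite of $(H,P):A\to B$ and $(H',Q):B\to C$ is $(H'\otimes H,\,Q\circ P)$ with $Q\circ P=(Q\otimes\mathrm{id}_H)(\mathrm{id}_{H'}\otimes P)$; the identity on $A$ is $(\mathbb{C},\mathrm{id}_A)$. Vertical and horizontal composition of 2-morphisms are composition and tensor product of linear maps. A dagger 2-category is a 2-category with, for each 2-morphism $\alpha:f\to g$, a 2-morphism $\alpha^\dagger:g\to f$, involutive, contravariant for vertical composition, compatible with horizontal composition, and such that associators and unitors (if not identities) are unitary. (If a strict version of the monoidal category of Hilbert spaces is used, $\mathrm{QSet}$ is strict.) *)

theory Defs
  imports Complex_Main "HOL-Library.FuncSet" "HOL-Algebra.Module"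
begin

no_notation mult (infixl \<open>\<otimes>\<index>\<close> 70)

section \<open>Finite-dimensional complex Hilbert spaces\<close>

definition complex_field :: "complex ring" where
  "complex_field =
     \<lparr>carrier = UNIV, monoid.mult = (*), one = 1, ring.zero = 0, add = (+)\<rparr>"

text \<open>As in the library's modules, the ring operations \<open>mult\<close> and \<open>one\<close> inherited from the
  record type \<open>module\<close> play no role.\<close>

record 'u hilb = "(complex, 'u) module" +
  iprod :: "'u \<Rightarrow> 'u \<Rightarrow> complex"

definition vspan :: "'u hilb \<Rightarrow> 'u set \<Rightarrow> 'u set" where
  "vspan H S = \<Inter> {W. submodule W complex_field H \<and> S \<subseteq> W}"

text \<open>The inner product is antilinear in its first argument.\<close>

locale fd_hilbert_space = module complex_field H for H :: "'u hilb" (structure) +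
  assumes iprod_add: "\<lbrakk>x \<in> carrier H; y \<in> carrier H; z \<in> carrier H\<rbrakk>
      \<Longrightarrow> iprod H x (y \<oplus> z) = iprod H x y + iprod H x z"
    and iprod_smult: "\<lbrakk>x \<in> carrier H; y \<in> carrier H\<rbrakk>
      \<Longrightarrow> iprod H x (c \<odot> y) = c * iprod H x y"
    and iprod_cnj: "\<lbrakk>x \<in> carrier H; y \<in> carrier H\<rbrakk> \<Longrightarrow> iprod H y x = cnj (iprod H x y)"
    and iprod_pos: "\<lbrakk>x \<in> carrier H; x \<noteq> \<zero>\<rbrakk> \<Longrightarrow> 0 < Re (iprod H x x)"
    and finite_dim: "\<exists>S. finite S \<and> S \<subseteq> carrier H \<and> vspan H S = carrier H"

section \<open>Linear maps\<close>

record 'u lmap =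
  source :: "'u hilb"
  target :: "'u hilb"
  app :: "'u \<Rightarrow> 'u"

text \<open>Extensionality of \<open>app\<close> makes equality of linear maps the equality of HOL.\<close>

definition linear_maps :: "'u hilb \<Rightarrow> 'u hilb \<Rightarrow> 'u lmap set" where
  "linear_maps H K = {f. source f = H \<and> target f = K \<and>
     app f \<in> carrier H \<rightarrow>\<^sub>E carrier K \<and>
     (\<forall>x\<in>carrier H. \<forall>y\<in>carrier H. app f (x \<oplus>\<^bsub>H\<^esub> y) = app f x \<oplus>\<^bsub>K\<^esub> app f y) \<and>
     (\<forall>c. \<forall>x\<in>carrier H. app f (c \<odot>\<^bsub>H\<^esub> x) = c \<odot>\<^bsub>K\<^esub> app f x)}"

definition lid :: "'u hilb \<Rightarrow> 'u lmap" where
  "lid H = \<lparr>source = H, target = H, app = (\<lambda>x\<in>carrier H. x)\<rparr>"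

definition lcomp :: "'u lmap \<Rightarrow> 'u lmap \<Rightarrow> 'u lmap" (infixr \<open>\<cdot>\<close> 60) where
  "g \<cdot> f = \<lparr>source = source f, target = target g,
            app = (\<lambda>x\<in>carrier (source f). app g (app f x))\<rparr>"

definition adjoint :: "'u lmap \<Rightarrow> 'u lmap" (\<open>_\<^sup>\<dagger>\<close> [1000] 1000) where
  "f\<^sup>\<dagger> = (THE g. g \<in> linear_maps (target f) (source f) \<and>
     (\<forall>x\<in>carrier (source f). \<forall>y\<in>carrier (target f).
        iprod (source f) (app g y) x = iprod (target f) y (app f x)))"

section \<open>Tensor products of Hilbert spaces\<close>

text \<open>
  A collection \<open>spaces\<close> of finite-dimensional Hilbert spaces together with a choice of a tensor
  product \<open>H \<boxtimes> K\<close> with its pure tensors for any two of them, and of a one-dimensional Hilbert space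
  \<open>scalars\<close> identified with the complex numbers through the unit vector \<open>unit_vec\<close>.  Everything
  below is relative to an arbitrary choice of this kind, so both a strict choice (such as
  the coordinate spaces with the Kronecker product) and one ranging over all
  finite-dimensional Hilbert spaces with carrier in \<open>'u\<close> (see \<open>tensor_model_exists\<close> at the end)
  are covered; the coherence isomorphisms are written out.
\<close>

record 'u tensor_model =
  spaces :: "'u hilb set"
  tprod :: "'u hilb \<Rightarrow> 'u hilb \<Rightarrow> 'u hilb" (infixl \<open>\<boxtimes>\<index>\<close> 75)
  pure :: "'u hilb \<Rightarrow> 'u hilb \<Rightarrow> 'u \<Rightarrow> 'u \<Rightarrow> 'u"
  scalars :: "'u hilb" (\<open>\<I>\<index>\<close>)
  unit_vec :: "'u"

locale hilbert_tensor_model =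
  fixes M :: "'u tensor_model" (structure)
  assumes spaces_hilbert: "H \<in> spaces M \<Longrightarrow> fd_hilbert_space H"
    and scalars_space: "\<I> \<in> spaces M"
    and unit_vec_closed: "unit_vec M \<in> carrier \<I>"
    and unit_vec_norm: "iprod \<I> (unit_vec M) (unit_vec M) = 1"
    and unit_vec_span: "vspan \<I> {unit_vec M} = carrier \<I>"
    and tprod_space: "\<lbrakk>H \<in> spaces M; K \<in> spaces M\<rbrakk> \<Longrightarrow> H \<boxtimes> K \<in> spaces M"
    and pure_closed: "\<lbrakk>H \<in> spaces M; K \<in> spaces M; x \<in> carrier H; y \<in> carrier K\<rbrakk>
      \<Longrightarrow> pure M H K x y \<in> carrier (H \<boxtimes> K)"
    and pure_add_left: "\<lbrakk>H \<in> spaces M; K \<in> spaces M; x \<in> carrier H; x' \<in> carrier H; y \<in> carrier K\<rbrakk>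
      \<Longrightarrow> pure M H K (x \<oplus>\<^bsub>H\<^esub> x') y = pure M H K x y \<oplus>\<^bsub>H \<boxtimes> K\<^esub> pure M H K x' y"
    and pure_add_right: "\<lbrakk>H \<in> spaces M; K \<in> spaces M; x \<in> carrier H; y \<in> carrier K; y' \<in> carrier K\<rbrakk>
      \<Longrightarrow> pure M H K x (y \<oplus>\<^bsub>K\<^esub> y') = pure M H K x y \<oplus>\<^bsub>H \<boxtimes> K\<^esub> pure M H K x y'"
    and pure_smult_left: "\<lbrakk>H \<in> spaces M; K \<in> spaces M; x \<in> carrier H; y \<in> carrier K\<rbrakk>
      \<Longrightarrow> pure M H K (c \<odot>\<^bsub>H\<^esub> x) y = c \<odot>\<^bsub>H \<boxtimes> K\<^esub> pure M H K x y"
    and pure_smult_right: "\<lbrakk>H \<in> spaces M; K \<in> spaces M; x \<in> carrier H; y \<in> carrier K\<rbrakk>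
      \<Longrightarrow> pure M H K x (c \<odot>\<^bsub>K\<^esub> y) = c \<odot>\<^bsub>H \<boxtimes> K\<^esub> pure M H K x y"
    and pure_iprod: "\<lbrakk>H \<in> spaces M; K \<in> spaces M; x \<in> carrier H; x' \<in> carrier H;
        y \<in> carrier K; y' \<in> carrier K\<rbrakk>
      \<Longrightarrow> iprod (H \<boxtimes> K) (pure M H K x y) (pure M H K x' y') = iprod H x x' * iprod K y y'"
    and pure_span: "\<lbrakk>H \<in> spaces M; K \<in> spaces M\<rbrakk>
      \<Longrightarrow> vspan (H \<boxtimes> K) {pure M H K x y | x y. x \<in> carrier H \<and> y \<in> carrier K} = carrier (H \<boxtimes> K)"

context
  fixes M :: "'u tensor_model" (structure)
begin

definition tmap :: "'u lmap \<Rightarrow> 'u lmap \<Rightarrow> 'u lmap" (infixl \<open>\<otimes>\<close> 70) where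
  "f \<otimes> g = (THE h. h \<in> linear_maps (source f \<boxtimes> source g) (target f \<boxtimes> target g) \<and>
     (\<forall>x\<in>carrier (source f). \<forall>y\<in>carrier (source g).
        app h (pure M (source f) (source g) x y)
          = pure M (target f) (target g) (app f x) (app g y)))"

definition assoc :: "'u hilb \<Rightarrow> 'u hilb \<Rightarrow> 'u hilb \<Rightarrow> 'u lmap" where
  "assoc H K L = (THE f. f \<in> linear_maps (H \<boxtimes> K \<boxtimes> L) (H \<boxtimes> (K \<boxtimes> L)) \<and>
     (\<forall>x\<in>carrier H. \<forall>y\<in>carrier K. \<forall>z\<in>carrier L.
        app f (pure M (H \<boxtimes> K) L (pure M H K x y) z)
          = pure M H (K \<boxtimes> L) x (pure M K L y z)))"

definition assoc_inv :: "'u hilb \<Rightarrow> 'u hilb \<Rightarrow> 'u hilb \<Rightarrow> 'u lmap" where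
  "assoc_inv H K L = (THE f. f \<in> linear_maps (H \<boxtimes> (K \<boxtimes> L)) (H \<boxtimes> K \<boxtimes> L) \<and>
     (\<forall>x\<in>carrier H. \<forall>y\<in>carrier K. \<forall>z\<in>carrier L.
        app f (pure M H (K \<boxtimes> L) x (pure M K L y z))
          = pure M (H \<boxtimes> K) L (pure M H K x y) z))"

definition lunit :: "'u hilb \<Rightarrow> 'u lmap" where
  "lunit H = (THE f. f \<in> linear_maps (\<I> \<boxtimes> H) H \<and>
     (\<forall>x\<in>carrier H. app f (pure M \<I> H (unit_vec M) x) = x))"

definition runit :: "'u hilb \<Rightarrow> 'u lmap" where
  "runit H = (THE f. f \<in> linear_maps (H \<boxtimes> \<I>) H \<and>
     (\<forall>x\<in>carrier H. app f (pure M H \<I> x (unit_vec M)) = x))"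

definition runit_inv :: "'u hilb \<Rightarrow> 'u lmap" where
  "runit_inv H = \<lparr>source = H, target = H \<boxtimes> \<I>,
     app = (\<lambda>x\<in>carrier H. pure M H \<I> x (unit_vec M))\<rparr>"

definition swap :: "'u hilb \<Rightarrow> 'u hilb \<Rightarrow> 'u lmap" where
  "swap H K = (THE f. f \<in> linear_maps (H \<boxtimes> K) (K \<boxtimes> H) \<and>
     (\<forall>x\<in>carrier H. \<forall>y\<in>carrier K. app f (pure M H K x y) = pure M K H y x))"

end

section \<open>Quantum sets, quantum functions and intertwiners\<close>

record 'u qset =
  space :: "'u hilb"
  qmult :: "'u lmap"
  qunit :: "'u lmap"

abbreviation comult :: "'u qset \<Rightarrow> 'u lmap" (\<open>\<Delta>\<close>) where
  "\<Delta> A \<equiv> (qmult A)\<^sup>\<dagger>"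

abbreviation counit :: "'u qset \<Rightarrow> 'u lmap" (\<open>\<epsilon>\<close>) where
  "\<epsilon> A \<equiv> (qunit A)\<^sup>\<dagger>"

text \<open>\<open>qmap\<close> is the map \<open>P : H \<otimes> A \<rightarrow> B \<otimes> H\<close>, where \<open>H\<close> is \<open>qspace\<close>.\<close>

record 'u qfun =
  qdom :: "'u qset"
  qcod :: "'u qset"
  qspace :: "'u hilb"
  qmap :: "'u lmap"

context
  fixes M :: "'u tensor_model" (structure)
begin

notation tmap (infixl \<open>\<otimes>\<index>\<close> 70)

definition quantum_set :: "'u qset \<Rightarrow> bool" where
  "quantum_set A \<longleftrightarrow> (let X = space A; m = qmult A; u = qunit A; i = lid X in
     X \<in> spaces M \<and> m \<in> linear_maps (X \<boxtimes> X) X \<and> u \<in> linear_maps \<I> X \<and>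
     m \<cdot> (m \<otimes> i) = m \<cdot> (i \<otimes> m) \<cdot> assoc M X X X \<and>
     m \<cdot> (u \<otimes> i) = lunit M X \<and>
     m \<cdot> (i \<otimes> u) = runit M X \<and>
     (m \<otimes> i) \<cdot> assoc_inv M X X X \<cdot> (i \<otimes> \<Delta> A) = \<Delta> A \<cdot> m \<and>
     (i \<otimes> m) \<cdot> assoc M X X X \<cdot> (\<Delta> A \<otimes> i) = \<Delta> A \<cdot> m \<and>
     m \<cdot> \<Delta> A = i \<and>
     \<epsilon> A \<cdot> m \<cdot> swap M X X = \<epsilon> A \<cdot> m)"

definition quantum_function :: "'u qfun \<Rightarrow> bool" where
  "quantum_function F \<longleftrightarrow>
    (let A = qdom F; B = qcod F; X = space A; Y = space B; H = qspace F; P = qmap F;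
         iA = lid X; iB = lid Y; iH = lid H in
     quantum_set A \<and> quantum_set B \<and> H \<in> spaces M \<and> P \<in> linear_maps (H \<boxtimes> X) (Y \<boxtimes> H) \<and>
     (\<Delta> B \<otimes> iH) \<cdot> P
       = assoc_inv M Y Y H \<cdot> (iB \<otimes> P) \<cdot> assoc M Y H X \<cdot> (P \<otimes> iA) \<cdot> assoc_inv M H X X \<cdot> (iH \<otimes> \<Delta> A) \<and>
     lunit M H \<cdot> (\<epsilon> B \<otimes> iH) \<cdot> P = runit M H \<cdot> (iH \<otimes> \<epsilon> A) \<and>
     P\<^sup>\<dagger> = (lunit M H \<otimes> iA) \<cdot> ((\<epsilon> B \<cdot> qmult B) \<otimes> iH \<otimes> iA) \<cdot> (assoc_inv M Y Y H \<otimes> iA)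
           \<cdot> (iB \<otimes> P \<otimes> iA)
           \<cdot> (assoc M Y H X \<otimes> iA) \<cdot> assoc_inv M (Y \<boxtimes> H) X X
           \<cdot> (lid (Y \<boxtimes> H) \<otimes> (\<Delta> A \<cdot> qunit A)) \<cdot> runit_inv M (Y \<boxtimes> H))"

definition intertwiners :: "'u qfun \<Rightarrow> 'u qfun \<Rightarrow> 'u lmap set" where
  "intertwiners F G = {f \<in> linear_maps (qspace F) (qspace G).
     (lid (space (qcod F)) \<otimes> f) \<cdot> qmap F = qmap G \<cdot> (f \<otimes> lid (space (qdom F)))}"

definition qid :: "'u qset \<Rightarrow> 'u qfun" where
  "qid A = \<lparr>qdom = A, qcod = A, qspace = \<I>,
            qmap = runit_inv M (space A) \<cdot> lunit M (space A)\<rparr>"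

definition qcomp :: "'u qfun \<Rightarrow> 'u qfun \<Rightarrow> 'u qfun" where
  "qcomp G F =
    (let X = space (qdom F); Y = space (qcod F); Z = space (qcod G);
         H = qspace F; K = qspace G in
     \<lparr>qdom = qdom F, qcod = qcod G, qspace = K \<boxtimes> H,
      qmap = assoc M Z K H \<cdot> (qmap G \<otimes> lid H) \<cdot> assoc_inv M K Y H
             \<cdot> (lid K \<otimes> qmap F) \<cdot> assoc M K H X\<rparr>)"

end

section \<open>Dagger 2-categories\<close>

text \<open>
  \<open>Hom2 C f g\<close> is used for parallel \<open>f\<close> and \<open>g\<close> only.  Composition is written in
  applicative order, and \<open>associator C h g f\<close> goes from \<open>(h \<diamondop> g) \<diamondop> f\<close> to \<open>h \<diamondop> (g \<diamondop> f)\<close>.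
\<close>

record ('o, 'm, 'c) two_cat =
  Ob :: "'o set"
  Hom1 :: "'o \<Rightarrow> 'o \<Rightarrow> 'm set"
  Hom2 :: "'m \<Rightarrow> 'm \<Rightarrow> 'c set"
  id1 :: "'o \<Rightarrow> 'm"
  comp1 :: "'m \<Rightarrow> 'm \<Rightarrow> 'm" (infixl \<open>\<diamondop>\<index>\<close> 75)
  id2 :: "'m \<Rightarrow> 'c"
  vcomp :: "'c \<Rightarrow> 'c \<Rightarrow> 'c" (infixr \<open>\<bullet>\<index>\<close> 65)
  hcomp :: "'c \<Rightarrow> 'c \<Rightarrow> 'c" (infixl \<open>\<star>\<index>\<close> 70)
  associator :: "'m \<Rightarrow> 'm \<Rightarrow> 'm \<Rightarrow> 'c"
  lunitor :: "'m \<Rightarrow> 'c"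
  runitor :: "'m \<Rightarrow> 'c"

definition iso2 :: "('o, 'm, 'c) two_cat \<Rightarrow> 'm \<Rightarrow> 'm \<Rightarrow> 'c \<Rightarrow> bool" where
  "iso2 C f g a \<longleftrightarrow> a \<in> Hom2 C f g \<and>
     (\<exists>b\<in>Hom2 C g f. b \<bullet>\<^bsub>C\<^esub> a = id2 C f \<and> a \<bullet>\<^bsub>C\<^esub> b = id2 C g)"

locale two_category =
  fixes C :: "('o, 'm, 'c) two_cat" (structure)
  assumes id1_closed: "A \<in> Ob C \<Longrightarrow> id1 C A \<in> Hom1 C A A"
    and comp1_closed: "\<lbrakk>A \<in> Ob C; B \<in> Ob C; D \<in> Ob C; f \<in> Hom1 C A B; g \<in> Hom1 C B D\<rbrakk>
      \<Longrightarrow> g \<diamondop> f \<in> Hom1 C A D"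
    and id2_closed: "\<lbrakk>A \<in> Ob C; B \<in> Ob C; f \<in> Hom1 C A B\<rbrakk> \<Longrightarrow> id2 C f \<in> Hom2 C f f"
    and vcomp_closed: "\<lbrakk>A \<in> Ob C; B \<in> Ob C; f \<in> Hom1 C A B; g \<in> Hom1 C A B; h \<in> Hom1 C A B;
        a \<in> Hom2 C f g; b \<in> Hom2 C g h\<rbrakk> \<Longrightarrow> b \<bullet> a \<in> Hom2 C f h"
    and vcomp_assoc: "\<lbrakk>A \<in> Ob C; B \<in> Ob C; f \<in> Hom1 C A B; g \<in> Hom1 C A B; h \<in> Hom1 C A B;
        k \<in> Hom1 C A B; a \<in> Hom2 C f g; b \<in> Hom2 C g h; c \<in> Hom2 C h k\<rbrakk>
      \<Longrightarrow> (c \<bullet> b) \<bullet> a = c \<bullet> (b \<bullet> a)"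
    and vcomp_id_left: "\<lbrakk>A \<in> Ob C; B \<in> Ob C; f \<in> Hom1 C A B; g \<in> Hom1 C A B; a \<in> Hom2 C f g\<rbrakk>
      \<Longrightarrow> id2 C g \<bullet> a = a"
    and vcomp_id_right: "\<lbrakk>A \<in> Ob C; B \<in> Ob C; f \<in> Hom1 C A B; g \<in> Hom1 C A B; a \<in> Hom2 C f g\<rbrakk>
      \<Longrightarrow> a \<bullet> id2 C f = a"
    and hcomp_closed: "\<lbrakk>A \<in> Ob C; B \<in> Ob C; D \<in> Ob C; f \<in> Hom1 C A B; f' \<in> Hom1 C A B;
        g \<in> Hom1 C B D; g' \<in> Hom1 C B D; a \<in> Hom2 C f f'; b \<in> Hom2 C g g'\<rbrakk>
      \<Longrightarrow> b \<star> a \<in> Hom2 C (g \<diamondop> f) (g' \<diamondop> f')"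
    and hcomp_id2: "\<lbrakk>A \<in> Ob C; B \<in> Ob C; D \<in> Ob C; f \<in> Hom1 C A B; g \<in> Hom1 C B D\<rbrakk>
      \<Longrightarrow> id2 C g \<star> id2 C f = id2 C (g \<diamondop> f)"
    and interchange: "\<lbrakk>A \<in> Ob C; B \<in> Ob C; D \<in> Ob C;
        f \<in> Hom1 C A B; f' \<in> Hom1 C A B; f'' \<in> Hom1 C A B;
        g \<in> Hom1 C B D; g' \<in> Hom1 C B D; g'' \<in> Hom1 C B D;
        a \<in> Hom2 C f f'; a' \<in> Hom2 C f' f''; b \<in> Hom2 C g g'; b' \<in> Hom2 C g' g''\<rbrakk>
      \<Longrightarrow> (b' \<bullet> b) \<star> (a' \<bullet> a) = (b' \<star> a') \<bullet> (b \<star> a)"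
    and associator_iso: "\<lbrakk>A \<in> Ob C; B \<in> Ob C; D \<in> Ob C; E \<in> Ob C;
        f \<in> Hom1 C A B; g \<in> Hom1 C B D; h \<in> Hom1 C D E\<rbrakk>
      \<Longrightarrow> iso2 C (h \<diamondop> g \<diamondop> f) (h \<diamondop> (g \<diamondop> f)) (associator C h g f)"
    and associator_natural: "\<lbrakk>A \<in> Ob C; B \<in> Ob C; D \<in> Ob C; E \<in> Ob C;
        f \<in> Hom1 C A B; f' \<in> Hom1 C A B; g \<in> Hom1 C B D; g' \<in> Hom1 C B D;
        h \<in> Hom1 C D E; h' \<in> Hom1 C D E;
        a \<in> Hom2 C f f'; b \<in> Hom2 C g g'; c \<in> Hom2 C h h'\<rbrakk>
      \<Longrightarrow> associator C h' g' f' \<bullet> (c \<star> b \<star> a) = (c \<star> (b \<star> a)) \<bullet> associator C h g f"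
    and lunitor_iso: "\<lbrakk>A \<in> Ob C; B \<in> Ob C; f \<in> Hom1 C A B\<rbrakk>
      \<Longrightarrow> iso2 C (id1 C B \<diamondop> f) f (lunitor C f)"
    and lunitor_natural: "\<lbrakk>A \<in> Ob C; B \<in> Ob C; f \<in> Hom1 C A B; f' \<in> Hom1 C A B; a \<in> Hom2 C f f'\<rbrakk>
      \<Longrightarrow> lunitor C f' \<bullet> (id2 C (id1 C B) \<star> a) = a \<bullet> lunitor C f"
    and runitor_iso: "\<lbrakk>A \<in> Ob C; B \<in> Ob C; f \<in> Hom1 C A B\<rbrakk>
      \<Longrightarrow> iso2 C (f \<diamondop> id1 C A) f (runitor C f)"
    and runitor_natural: "\<lbrakk>A \<in> Ob C; B \<in> Ob C; f \<in> Hom1 C A B; f' \<in> Hom1 C A B; a \<in> Hom2 C f f'\<rbrakk>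
      \<Longrightarrow> runitor C f' \<bullet> (a \<star> id2 C (id1 C A)) = a \<bullet> runitor C f"
    and pentagon: "\<lbrakk>A \<in> Ob C; B \<in> Ob C; D \<in> Ob C; E \<in> Ob C; F \<in> Ob C;
        f \<in> Hom1 C A B; g \<in> Hom1 C B D; h \<in> Hom1 C D E; k \<in> Hom1 C E F\<rbrakk>
      \<Longrightarrow> associator C k h (g \<diamondop> f) \<bullet> associator C (k \<diamondop> h) g f
          = (id2 C k \<star> associator C h g f) \<bullet> associator C k (h \<diamondop> g) f
              \<bullet> (associator C k h g \<star> id2 C f)"
    and triangle: "\<lbrakk>A \<in> Ob C; B \<in> Ob C; D \<in> Ob C; f \<in> Hom1 C A B; g \<in> Hom1 C B D\<rbrakk>
      \<Longrightarrow> (id2 C g \<star> lunitor C f) \<bullet> associator C g (id1 C B) f = runitor C g \<star> id2 C f"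

text \<open>Unitarity of the associators and unitors says that their daggers are inverse to them.\<close>

locale dagger_two_category = two_category C
  for C :: "('o, 'm, 'c) two_cat" (structure) and dag :: "'c \<Rightarrow> 'c" +
  assumes dag_closed: "\<lbrakk>A \<in> Ob C; B \<in> Ob C; f \<in> Hom1 C A B; g \<in> Hom1 C A B; a \<in> Hom2 C f g\<rbrakk>
      \<Longrightarrow> dag a \<in> Hom2 C g f"
    and dag_dag: "\<lbrakk>A \<in> Ob C; B \<in> Ob C; f \<in> Hom1 C A B; g \<in> Hom1 C A B; a \<in> Hom2 C f g\<rbrakk>
      \<Longrightarrow> dag (dag a) = a"
    and dag_id2: "\<lbrakk>A \<in> Ob C; B \<in> Ob C; f \<in> Hom1 C A B\<rbrakk> \<Longrightarrow> dag (id2 C f) = id2 C f"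
    and dag_vcomp: "\<lbrakk>A \<in> Ob C; B \<in> Ob C; f \<in> Hom1 C A B; g \<in> Hom1 C A B; h \<in> Hom1 C A B;
        a \<in> Hom2 C f g; b \<in> Hom2 C g h\<rbrakk> \<Longrightarrow> dag (b \<bullet> a) = dag a \<bullet> dag b"
    and dag_hcomp: "\<lbrakk>A \<in> Ob C; B \<in> Ob C; D \<in> Ob C; f \<in> Hom1 C A B; f' \<in> Hom1 C A B;
        g \<in> Hom1 C B D; g' \<in> Hom1 C B D; a \<in> Hom2 C f f'; b \<in> Hom2 C g g'\<rbrakk>
      \<Longrightarrow> dag (b \<star> a) = dag b \<star> dag a"
    and associator_unitary: "\<lbrakk>A \<in> Ob C; B \<in> Ob C; D \<in> Ob C; E \<in> Ob C;
        f \<in> Hom1 C A B; g \<in> Hom1 C B D; h \<in> Hom1 C D E\<rbrakk>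
      \<Longrightarrow> dag (associator C h g f) \<bullet> associator C h g f = id2 C (h \<diamondop> g \<diamondop> f) \<and>
          associator C h g f \<bullet> dag (associator C h g f) = id2 C (h \<diamondop> (g \<diamondop> f))"
    and lunitor_unitary: "\<lbrakk>A \<in> Ob C; B \<in> Ob C; f \<in> Hom1 C A B\<rbrakk>
      \<Longrightarrow> dag (lunitor C f) \<bullet> lunitor C f = id2 C (id1 C B \<diamondop> f) \<and>
          lunitor C f \<bullet> dag (lunitor C f) = id2 C f"
    and runitor_unitary: "\<lbrakk>A \<in> Ob C; B \<in> Ob C; f \<in> Hom1 C A B\<rbrakk>
      \<Longrightarrow> dag (runitor C f) \<bullet> runitor C f = id2 C (f \<diamondop> id1 C A) \<and>
          runitor C f \<bullet> dag (runitor C f) = id2 C f"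

section \<open>The 2-category of quantum sets\<close>

definition QSet :: "'u tensor_model \<Rightarrow> ('u qset, 'u qfun, 'u lmap) two_cat" where
  "QSet M = \<lparr>
     Ob = {A. quantum_set M A},
     Hom1 = (\<lambda>A B. {F. quantum_function M F \<and> qdom F = A \<and> qcod F = B}),
     Hom2 = intertwiners M,
     id1 = qid M,
     comp1 = qcomp M,
     id2 = (\<lambda>F. lid (qspace F)),
     vcomp = (\<cdot>),
     hcomp = tmap M,
     associator = (\<lambda>G' G F. assoc M (qspace G') (qspace G) (qspace F)),
     lunitor = (\<lambda>F. lunit M (qspace F)),
     runitor = (\<lambda>F. runit M (qspace F))\<rparr>"

section \<open>Existence of tensor models\<close>

text \<open>
  Nothing above depends on this section.  It shows that the notion of tensor model is not
  vacuous: on every type large enough to contain a copy of all sequences of complex numbers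
  (that is, of at least continuum cardinality) there is a tensor model consisting of
  all finite-dimensional Hilbert spaces with carrier in that type.
\<close>

lemma complex_field_simps [simp]:
  "carrier complex_field = UNIV" "monoid.mult complex_field a b = a * b" 
  "\<one>\<^bsub>complex_field\<^esub> = 1" "\<zero>\<^bsub>complex_field\<^esub> = 0" "a \<oplus>\<^bsub>complex_field\<^esub> b = a + b"
  by (simp_all add: complex_field_def)

lemma cring_complex_field: "cring complex_field"
proof (rule cringI)
  show "abelian_group complex_field"
    by (rule abelian_groupI) (auto intro: exI[of _ "- x" for x])
  show "comm_monoid complex_field"
    by (rule comm_monoidI) auto
qed (simp add: algebra_simps)

lemma complex_field_minus: "\<ominus>\<^bsub>complex_field\<^esub> a = - a"
  using abelian_group.minus_equality[of complex_field "- a" a] cring_complex_field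
  by (simp add: cring_def ring_def)

context fd_hilbert_space
begin

lemma iprod_zero_right: "x \<in> carrier H \<Longrightarrow> iprod H x \<zero> = 0"
  using iprod_smult[of x \<zero> 0] smult_l_null[of \<zero>] by simp

lemma iprod_zero_left: "x \<in> carrier H \<Longrightarrow> iprod H \<zero> x = 0"
  using iprod_cnj[of x \<zero>] iprod_zero_right[of x] by simp

lemma smult_in: "x \<in> carrier H \<Longrightarrow> c \<odot> x \<in> carrier H"
  using smult_closed by simp

lemma iprod_add_left: 
  "\<lbrakk>x \<in> carrier H; y \<in> carrier H; z \<in> carrier H\<rbrakk> \<Longrightarrow> iprod H (y \<oplus> z) x = iprod H y x + iprod H z x"
  using iprod_cnj[of x "y \<oplus> z"] iprod_cnj[of x y] iprod_cnj[of x z] by (simp add: iprod_add)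

lemma iprod_smult_left: 
  "\<lbrakk>x \<in> carrier H; y \<in> carrier H\<rbrakk> \<Longrightarrow> iprod H (c \<odot> y) x = cnj c * iprod H y x"
  using iprod_cnj[of x "c \<odot> y"] iprod_cnj[of x y] by (simp add: iprod_smult smult_in)

lemma iprod_self: "x \<in> carrier H \<Longrightarrow> iprod H x x = of_real (Re (iprod H x x))"
  using iprod_cnj[of x x] by (simp add: complex_eq_iff)

definition onsys :: "nat \<Rightarrow> (nat \<Rightarrow> 'u) \<Rightarrow> bool" where
  "onsys n e \<longleftrightarrow> (\<forall>i<n. e i \<in> carrier H) \<and> (\<forall>i<n. \<forall>j<n. iprod H (e i) (e j) = of_bool (i = j))"

definition onbasis :: "nat \<Rightarrow> (nat \<Rightarrow> 'u) \<Rightarrow> bool" where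
  "onbasis n e \<longleftrightarrow> onsys n e \<and> (\<forall>x\<in>carrier H. (\<forall>i<n. iprod H (e i) x = 0) \<longrightarrow> x = \<zero>)"

lemma projection:
  assumes "onsys n e"
  shows "\<exists>p\<in>carrier H. (\<forall>i<n. iprod H (e i) p = c i) \<and>
    (\<forall>x\<in>carrier H. (\<forall>i<n. iprod H (e i) x = 0) \<longrightarrow> iprod H x p = 0)"
proof -
  have "\<exists>p\<in>carrier H. (\<forall>i<n. iprod H (e i) p = (if i < k then c i else 0)) \<and>
    (\<forall>x\<in>carrier H. (\<forall>i<n. iprod H (e i) x = 0) \<longrightarrow> iprod H x p = 0)" if "k \<le> n" for k
    using that
  proof (induction k)
    case 0
    show ?case using assms by (intro bexI[of _ \<zero>]) (auto simp: onsys_def iprod_zero_right)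
  next
    case (Suc k)
    then obtain p where p: "p \<in> carrier H" "\<forall>i<n. iprod H (e i) p = (if i < k then c i else 0)"
      "\<forall>x\<in>carrier H. (\<forall>i<n. iprod H (e i) x = 0) \<longrightarrow> iprod H x p = 0" by auto
    have ek: "e k \<in> carrier H" using assms Suc.prems by (auto simp: onsys_def)
    have on: "iprod H (e i) (e k) = of_bool (i = k)" if "i < n" for i
      using assms Suc.prems that by (auto simp: onsys_def)
    have orth: "iprod H x (e k) = 0" if "x \<in> carrier H" "\<forall>i<n. iprod H (e i) x = 0" for x
      using iprod_cnj[of "e k" x] that ek Suc.prems by auto
    have ei: "e i \<in> carrier H" if "i < n" for i using assms that by (auto simp: onsys_def)
    show ?case
    proof (intro bexI conjI allI impI ballI)
      show "p \<oplus> c k \<odot> e k \<in> carrier H" using p ek smult_in by auto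
      show "iprod H (e i) (p \<oplus> c k \<odot> e k) = (if i < Suc k then c i else 0)" if "i < n" for i
        using p(2) that on[OF that] by (simp add: iprod_add iprod_smult p(1) ek ei smult_in less_Suc_eq)
      show "iprod H x (p \<oplus> c k \<odot> e k) = 0" if "x \<in> carrier H" "\<forall>i<n. iprod H (e i) x = 0" for x
        using p(3) that orth[OF that] by (simp add: iprod_add iprod_smult p(1) ek smult_in)
    qed
  qed
  from this[of n] show ?thesis by auto
qed

lemma onsys_span:
  assumes "finite S" "S \<subseteq> carrier H"
  shows "\<exists>n e. onsys n e \<and> (\<forall>x\<in>carrier H. (\<forall>i<n. iprod H (e i) x = 0) \<longrightarrow> (\<forall>s\<in>S. iprod H x s = 0))"
  using assms
proof (induction S rule: finite_induct)
  case empty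
  show ?case by (rule exI[of _ 0]) (auto simp: onsys_def)
next
  case (insert s S)
  then obtain n e where e: "onsys n e" 
    "\<forall>x\<in>carrier H. (\<forall>i<n. iprod H (e i) x = 0) \<longrightarrow> (\<forall>s\<in>S. iprod H x s = 0)" by auto
  have s: "s \<in> carrier H" using insert by auto
  obtain p where p: "p \<in> carrier H" "\<forall>i<n. iprod H (e i) p = iprod H (e i) s"
    "\<forall>x\<in>carrier H. (\<forall>i<n. iprod H (e i) x = 0) \<longrightarrow> iprod H x p = 0" 
    using projection[OF e(1), of "\<lambda>i. iprod H (e i) s"] by auto
  have ei: "e i \<in> carrier H" if "i < n" for i using e(1) that by (auto simp: onsys_def)
  define q where "q = s \<oplus> (-1) \<odot> p"
  have q: "q \<in> carrier H" unfolding q_def using s p smult_in by auto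
  have qe: "iprod H (e i) q = 0" if "i < n" for i
    using p(2) that by (simp add: q_def iprod_add iprod_smult ei s p(1) smult_in)
  have sq: "iprod H x s = iprod H x q + iprod H x p" if "x \<in> carrier H" for x
    using that by (simp add: q_def iprod_add iprod_smult s p(1) smult_in)
  show ?case
  proof (cases "q = \<zero>")
    case True
    show ?thesis using e p(3) sq True
      by (intro exI[of _ n] exI[of _ e]) (auto simp: iprod_zero_right)
  next
    case False
    define r where "r = Re (iprod H q q)"
    have r: "r > 0" using iprod_pos[OF q False] by (simp add: r_def)
    define c where "c = complex_of_real (1 / sqrt r)"
    define e' where "e' = e(n := c \<odot> q)"
    have e'i: "e' i \<in> carrier H" if "i < Suc n" for i
      using that ei q smult_in by (auto simp: e'_def less_Suc_eq)
    have nn: "iprod H (c \<odot> q) (c \<odot> q) = 1"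
    proof -
      have "iprod H (c \<odot> q) (c \<odot> q) = cnj c * c * iprod H q q"
        by (simp add: iprod_smult iprod_smult_left q smult_in)
      also have "\<dots> = of_real (1 / sqrt r * (1 / sqrt r) * r)"
        by (subst iprod_self[OF q]) (simp only: c_def r_def complex_cnj_complex_of_real of_real_mult)
      also have "1 / sqrt r * (1 / sqrt r) * r = 1" using r by simp
      finally show ?thesis by simp
    qed
    have ne: "iprod H (c \<odot> q) (e i) = 0" "iprod H (e i) (c \<odot> q) = 0" if "i < n" for i
      using qe[OF that] iprod_cnj[of "e i" q] by (simp_all add: iprod_smult iprod_smult_left q smult_in ei[OF that])
    have "onsys (Suc n) e'"
      unfolding onsys_def using e'i e(1) nn ne by (auto simp: e'_def onsys_def less_Suc_eq)
    moreover have "\<forall>x\<in>carrier H. (\<forall>i<Suc n. iprod H (e' i) x = 0) \<longrightarrow> (\<forall>s\<in>insert s S. iprod H x s = 0)"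
    proof (intro ballI impI)
      fix x t assume x: "x \<in> carrier H" "\<forall>i<Suc n. iprod H (e' i) x = 0" and t: "t \<in> insert s S"
      have xe: "\<forall>i<n. iprod H (e i) x = 0" 
      proof (intro allI impI)
        fix i assume "i < n"
        thus "iprod H (e i) x = 0" using x(2)[rule_format, of i] by (simp add: e'_def)
      qed
      have "iprod H (c \<odot> q) x = 0" using x(2) by (auto simp: e'_def)
      hence "iprod H q x = 0" using r by (simp add: iprod_smult_left q x(1) c_def)
      hence "iprod H x q = 0" using iprod_cnj[OF q x(1)] by simp
      hence "iprod H x s = 0" using sq[OF x(1)] p(3) x(1) xe by simp
      thus "iprod H x t = 0" using t e(2) x(1) xe by auto
    qed
    ultimately show ?thesis by blast
  qed
qed

lemma orthogonal_submodule:
  assumes "x \<in> carrier H"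
  shows "submodule {y \<in> carrier H. iprod H x y = 0} complex_field H"
proof -
  have neg: "\<ominus> y = (-1) \<odot> y" if "y \<in> carrier H" for y
    using smult_l_minus[of 1 y] smult_one[of y] that by (simp add: complex_field_minus)
  show ?thesis using assms
    by (intro submoduleI)
       (auto simp: iprod_zero_right iprod_add iprod_smult smult_in neg)
qed

lemma onbasis_exists: "\<exists>n e. onbasis n e"
proof -
  obtain S where S: "finite S" "S \<subseteq> carrier H" "vspan H S = carrier H" using finite_dim by auto
  obtain n e where e: "onsys n e"
    "\<And>x. \<lbrakk>x\<in>carrier H; \<forall>i<n. iprod H (e i) x = 0\<rbrakk> \<Longrightarrow> \<forall>s\<in>S. iprod H x s = 0"
    using onsys_span[OF S(1,2)] by auto
  have "x = \<zero>" if x: "x \<in> carrier H" "\<forall>i<n. iprod H (e i) x = 0" for x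
  proof (rule ccontr)
    assume "x \<noteq> \<zero>"
    have "vspan H S \<subseteq> {y \<in> carrier H. iprod H x y = 0}"
      unfolding vspan_def using orthogonal_submodule[OF x(1)] e(2)[OF x] S(2) by blast
    hence "iprod H x x = 0" using S(3) x(1) by auto
    thus False using iprod_pos[OF x(1) \<open>x \<noteq> \<zero>\<close>] by simp
  qed
  thus ?thesis using e(1) by (auto simp: onbasis_def)
qed

lemma parseval:
  assumes b: "onbasis n e" and x: "x \<in> carrier H" and y: "y \<in> carrier H"
  shows "iprod H x y = (\<Sum>i<n. cnj (iprod H (e i) x) * iprod H (e i) y)"
proof -
  have on: "onsys n e" using b by (simp add: onbasis_def)
  have ei: "e i \<in> carrier H" if "i < n" for i using on that by (auto simp: onsys_def)
  have "k \<le> n \<Longrightarrow> y \<in> carrier H \<Longrightarrow> (\<And>i. k \<le> i \<Longrightarrow> i < n \<Longrightarrow> iprod H (e i) y = 0) \<Longrightarrow>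
    iprod H x y = (\<Sum>i<k. cnj (iprod H (e i) x) * iprod H (e i) y)" for k
  proof (induction k arbitrary: y)
    case 0
    hence "y = \<zero>" using b by (auto simp: onbasis_def)
    thus ?case using iprod_zero_right[OF x] by simp
  next
    case (Suc k)
    define c where "c = iprod H (e k) y"
    define y' where "y' = y \<oplus> (- c) \<odot> e k"
    have ek: "e k \<in> carrier H" using ei Suc.prems by simp
    have y': "y' \<in> carrier H" using Suc.prems ek smult_in by (simp add: y'_def)
    have co: "iprod H z y' = iprod H z y - c * iprod H z (e k)" if "z \<in> carrier H" for z
      using that Suc.prems ek by (simp add: y'_def iprod_add iprod_smult smult_in)
    have oo: "iprod H (e i) (e k) = of_bool (i = k)" if "i < n" for i
      using on that Suc.prems by (simp add: onsys_def)
    have cy: "iprod H (e i) y' = (if i = k then 0 else iprod H (e i) y)" if "i < n" for i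
      using co[OF ei[OF that]] oo[OF that] by (simp add: c_def)
    have "iprod H x y' = (\<Sum>i<k. cnj (iprod H (e i) x) * iprod H (e i) y')"
      using Suc.prems by (intro Suc.IH y') (auto simp: cy)
    also have "\<dots> = (\<Sum>i<k. cnj (iprod H (e i) x) * iprod H (e i) y)"
      using Suc.prems by (intro sum.cong) (auto simp: cy)
    finally show ?case using co[OF x] iprod_cnj[OF ek x] by (simp add: c_def algebra_simps)
  qed
  from this[of n] y show ?thesis by simp
qed

end

subsection \<open>Coordinate spaces\<close>

text \<open>The space of complex vectors of length \<open>d\<close>, with carrier transported along an
  injection \<open>J\<close>.\<close>

definition coord :: "((nat \<Rightarrow> complex) \<Rightarrow> 'u) \<Rightarrow> nat \<Rightarrow> 'u hilb" where
  "coord J d = \<lparr>carrier = J ` {v. \<forall>i\<ge>d. v i = 0},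
     monoid.mult = undefined, one = undefined, ring.zero = J (\<lambda>_. 0),
     add = (\<lambda>x y. J (\<lambda>i. inv_into UNIV J x i + inv_into UNIV J y i)),
     smult = (\<lambda>c x. J (\<lambda>i. c * inv_into UNIV J x i)),
     iprod = (\<lambda>x y. \<Sum>i<d. cnj (inv_into UNIV J x i) * inv_into UNIV J y i)\<rparr>"

lemma coord_simps:
  "carrier (coord J d) = J ` {v. \<forall>i\<ge>d. v i = 0}"
  "\<zero>\<^bsub>coord J d\<^esub> = J (\<lambda>_. 0)"
  "inj J \<Longrightarrow> J v \<oplus>\<^bsub>coord J d\<^esub> J w = J (\<lambda>i. v i + w i)"
  "inj J \<Longrightarrow> c \<odot>\<^bsub>coord J d\<^esub> J v = J (\<lambda>i. c * v i)"
  "inj J \<Longrightarrow> iprod (coord J d) (J v) (J w) = (\<Sum>i<d. cnj (v i) * w i)"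
  by (simp_all add: coord_def)

lemma coord_module:
  assumes J: "inj J"
  shows "module complex_field (coord J d)"
proof (rule moduleI)
  show "abelian_group (coord J d)"
  proof (rule abelian_groupI)
    fix x assume "x \<in> carrier (coord J d)"
    then obtain v where v: "x = J v" "\<forall>i\<ge>d. v i = 0" by (auto simp: coord_simps)
    thus "\<exists>y\<in>carrier (coord J d). y \<oplus>\<^bsub>coord J d\<^esub> x = \<zero>\<^bsub>coord J d\<^esub>"
      using J by (intro bexI[of _ "J (\<lambda>i. - v i)"]) (auto simp: coord_simps)
  qed (use J in \<open>auto simp: coord_simps algebra_simps\<close>)
qed (use J in \<open>auto simp: coord_simps cring_complex_field algebra_simps\<close>)

lemma coord_span:
  assumes J: "inj J" and S: "\<And>k. k < d \<Longrightarrow> J (\<lambda>i. of_bool (i = k)) \<in> S" and SC: "S \<subseteq> carrier (coord J d)"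
  shows "vspan (coord J d) S = carrier (coord J d)"
proof
  interpret module complex_field "coord J d" using coord_module[OF J] .
  show "vspan (coord J d) S \<subseteq> carrier (coord J d)"
    unfolding vspan_def using carrier_is_submodule SC by auto
  show "carrier (coord J d) \<subseteq> vspan (coord J d) S"
    unfolding vspan_def
  proof (intro Inter_greatest subsetI)
    fix W x assume W: "W \<in> {W. submodule W complex_field (coord J d) \<and> S \<subseteq> W}"
      and x: "x \<in> carrier (coord J d)"
    have sm: "submodule W complex_field (coord J d)" and SW: "S \<subseteq> W" using W by auto
    obtain v where v: "x = J v" "\<forall>i\<ge>d. v i = 0" using x by (auto simp: coord_simps)
    have "k \<le> d \<Longrightarrow> J (\<lambda>i. if i < k then v i else 0) \<in> W" for k
    proof (induction k)
      case 0
      have "\<zero>\<^bsub>coord J d\<^esub> \<in> W" using submoduleE(2)[OF sm] submoduleE(1)[OF sm]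
          submodule.axioms(1)[OF sm] by (auto dest: subgroup.one_closed)
      thus ?case by (simp add: coord_simps)
    next
      case (Suc k)
      have "v k \<odot>\<^bsub>coord J d\<^esub> J (\<lambda>i. of_bool (i = k)) \<in> W"
        using submoduleE(4)[OF sm] S[of k] SW Suc.prems by auto
      hence "J (\<lambda>i. if i < k then v i else 0) \<oplus>\<^bsub>coord J d\<^esub> (v k \<odot>\<^bsub>coord J d\<^esub> J (\<lambda>i. of_bool (i = k))) \<in> W"
        using submoduleE(5)[OF sm] Suc by auto
      moreover have "(\<lambda>i. (if i < k then v i else 0) + v k * of_bool (i = k)) = (\<lambda>i. if i < Suc k then v i else 0)"
        by (auto simp: fun_eq_iff less_Suc_eq)
      ultimately show ?case using J by (simp add: coord_simps)
    qed
    from this[of d] have "J (\<lambda>i. if i < d then v i else 0) \<in> W" by simp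
    also have "(\<lambda>i. if i < d then v i else 0) = v" using v(2) by (auto simp: fun_eq_iff)
    finally show "x \<in> W" using v(1) by simp
  qed
qed

lemma coord_hilbert:
  assumes J: "inj J"
  shows "fd_hilbert_space (coord J d)"
proof (intro fd_hilbert_space.intro fd_hilbert_space_axioms.intro coord_module[OF J])
  show "\<exists>S. finite S \<and> S \<subseteq> carrier (coord J d) \<and> vspan (coord J d) S = carrier (coord J d)"
    using J by (intro exI[of _ "(\<lambda>k. J (\<lambda>i. of_bool (i = k))) ` {..<d}"] conjI coord_span)
      (auto simp: coord_simps)
next
  fix x assume x: "x \<in> carrier (coord J d)" "x \<noteq> \<zero>\<^bsub>coord J d\<^esub>"
  then obtain v where v: "x = J v" "\<forall>i\<ge>d. v i = 0" "v \<noteq> (\<lambda>_. 0)" by (auto simp: coord_simps)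
  then obtain k where k: "v k \<noteq> 0" by auto
  hence "k < d" using v(2) by (meson not_le)
  have "0 < (\<Sum>i<d. (cmod (v i))\<^sup>2)"
    using k \<open>k < d\<close> by (intro sum_pos2[of _ k]) auto
  also have "\<dots> = Re (iprod (coord J d) x x)"
    using J by (simp add: v(1) coord_simps cmod_power2) (simp add: power2_eq_square)
  finally show "0 < Re (iprod (coord J d) x x)" .
qed (use J in \<open>auto simp: coord_simps sum.distrib sum_distrib_left algebra_simps\<close>)

subsection \<open>The model of all finite-dimensional Hilbert spaces\<close>

definition chosen_basis :: "'u hilb \<Rightarrow> nat \<times> (nat \<Rightarrow> 'u)" where
  "chosen_basis H = (SOME b. fd_hilbert_space.onbasis H (fst b) (snd b))"

definition full_model :: "((nat \<Rightarrow> complex) \<Rightarrow> 'u) \<Rightarrow> 'u tensor_model" where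
  "full_model J = \<lparr>
     spaces = {H. fd_hilbert_space H},
     tprod = (\<lambda>H K. coord J (fst (chosen_basis H) * fst (chosen_basis K))),
     pure = (\<lambda>H K x y. let (n, e) = chosen_basis H; (m, f) = chosen_basis K in
       J (\<lambda>i. if i < n * m then iprod H (e (i div m)) x * iprod K (f (i mod m)) y else 0)),
     scalars = coord J 1,
     unit_vec = J (\<lambda>i. of_bool (i = 0))\<rparr>"

lemma sum_div_mod:
  "(\<Sum>i<n * m. f (i div m) * g (i mod m)) = (\<Sum>i<n::nat. f i) * (\<Sum>j<m. g j :: complex)"
proof (cases "m = 0")
  case False
  have b: "i * m + j < n * m" if "i < n" "j < m" for i j
  proof -
    have "i * m + j < Suc i * m" using that by simp
    also have "\<dots> \<le> n * m" using that by (intro mult_le_mono1) simp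
    finally show ?thesis .
  qed
  have "(\<Sum>i<n * m. f (i div m) * g (i mod m)) = (\<Sum>(i,j)\<in>{..<n} \<times> {..<m}. f i * g j)"
    using False
    by (intro sum.reindex_bij_witness[of _ "\<lambda>(i,j). i * m + j" "\<lambda>k. (k div m, k mod m)"])
       (auto simp: less_mult_imp_div_less b)
  thus ?thesis by (simp add: sum_product sum.cartesian_product)
qed auto

lemma full_model_pure:
  fixes H K :: "'u hilb" and J :: "(nat \<Rightarrow> complex) \<Rightarrow> 'u"
  defines "p \<equiv> pure (full_model J) H K" and "T \<equiv> tprod (full_model J) H K"
  assumes J: "inj J" and H: "fd_hilbert_space H" and K: "fd_hilbert_space K"
  shows "x \<in> carrier H \<Longrightarrow> y \<in> carrier K \<Longrightarrow> p x y \<in> carrier T"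
    and "\<lbrakk>x \<in> carrier H; x' \<in> carrier H; y \<in> carrier K\<rbrakk> \<Longrightarrow> p (x \<oplus>\<^bsub>H\<^esub> x') y = p x y \<oplus>\<^bsub>T\<^esub> p x' y"
    and "\<lbrakk>x \<in> carrier H; y \<in> carrier K; y' \<in> carrier K\<rbrakk> \<Longrightarrow> p x (y \<oplus>\<^bsub>K\<^esub> y') = p x y \<oplus>\<^bsub>T\<^esub> p x y'"
    and "\<lbrakk>x \<in> carrier H; y \<in> carrier K\<rbrakk> \<Longrightarrow> p (c \<odot>\<^bsub>H\<^esub> x) y = c \<odot>\<^bsub>T\<^esub> p x y"
    and "\<lbrakk>x \<in> carrier H; y \<in> carrier K\<rbrakk> \<Longrightarrow> p x (c \<odot>\<^bsub>K\<^esub> y) = c \<odot>\<^bsub>T\<^esub> p x y"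
    and "\<lbrakk>x \<in> carrier H; x' \<in> carrier H; y \<in> carrier K; y' \<in> carrier K\<rbrakk>
      \<Longrightarrow> iprod T (p x y) (p x' y') = iprod H x x' * iprod K y y'"
    and "vspan T {p x y | x y. x \<in> carrier H \<and> y \<in> carrier K} = carrier T"
proof -
  have basis: "fd_hilbert_space.onbasis H (fst (chosen_basis H)) (snd (chosen_basis H))"
    if "fd_hilbert_space H" for H :: "'u hilb"
    unfolding chosen_basis_def using fd_hilbert_space.onbasis_exists[OF that]
    by (metis (mono_tags, lifting) fst_conv snd_conv someI)
  interpret H: fd_hilbert_space H by fact
  interpret K: fd_hilbert_space K by fact
  obtain n e where e: "chosen_basis H = (n, e)" by force
  obtain m f where f: "chosen_basis K = (m, f)" by force
  have be: "H.onbasis n e" using basis[OF H] e by simp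
  have bf: "K.onbasis m f" using basis[OF K] f by simp
  have ei: "e i \<in> carrier H" if "i < n" for i using be that by (auto simp: H.onbasis_def H.onsys_def)
  have fi: "f i \<in> carrier K" if "i < m" for i using bf that by (auto simp: K.onbasis_def K.onsys_def)
  have dm: "i div m < n" "i mod m < m" if "i < n * m" for i
    using that by (auto simp: less_mult_imp_div_less intro!: mod_less_divisor intro: Nat.gr0I)
  note inn = ei[OF dm(1)] fi[OF dm(2)]
  have T: "T = coord J (n * m)" by (simp add: T_def full_model_def e f)
  have p: "p x y = J (\<lambda>i. if i < n * m then iprod H (e (i div m)) x * iprod K (f (i mod m)) y else 0)" for x y
    by (simp add: p_def full_model_def e f)
  show "p x y \<in> carrier T" if "x \<in> carrier H" "y \<in> carrier K"
    by (auto simp: T p coord_simps)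
  show "p (c \<odot>\<^bsub>H\<^esub> x) y = c \<odot>\<^bsub>T\<^esub> p x y" if "x \<in> carrier H" "y \<in> carrier K"
    using that J inn by (auto simp: coord_simps T p H.iprod_smult fun_eq_iff intro!: arg_cong[of _ _ J])
  show "p x (c \<odot>\<^bsub>K\<^esub> y) = c \<odot>\<^bsub>T\<^esub> p x y" if "x \<in> carrier H" "y \<in> carrier K"
    using that J inn by (auto simp: coord_simps T p K.iprod_smult fun_eq_iff intro!: arg_cong[of _ _ J])
  show "p (x \<oplus>\<^bsub>H\<^esub> x') y = p x y \<oplus>\<^bsub>T\<^esub> p x' y" if "x \<in> carrier H" "x' \<in> carrier H" "y \<in> carrier K"
    using that J inn by (auto simp: coord_simps T p H.iprod_add algebra_simps fun_eq_iff intro!: arg_cong[of _ _ J])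
  show "p x (y \<oplus>\<^bsub>K\<^esub> y') = p x y \<oplus>\<^bsub>T\<^esub> p x y'" if "x \<in> carrier H" "y \<in> carrier K" "y' \<in> carrier K"
    using that J inn by (auto simp: coord_simps T p K.iprod_add algebra_simps fun_eq_iff intro!: arg_cong[of _ _ J])
  show "iprod T (p x y) (p x' y') = iprod H x x' * iprod K y y'"
    if x: "x \<in> carrier H" "x' \<in> carrier H" and y: "y \<in> carrier K" "y' \<in> carrier K"
  proof -
    have "iprod T (p x y) (p x' y') = (\<Sum>i<n * m. (cnj (iprod H (e (i div m)) x) * iprod H (e (i div m)) x') *
        (cnj (iprod K (f (i mod m)) y) * iprod K (f (i mod m)) y'))"
      using J by (simp add: coord_simps T p algebra_simps)
    also have "\<dots> = iprod H x x' * iprod K y y'"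
      by (subst sum_div_mod[where f = "\<lambda>i. cnj (iprod H (e i) x) * iprod H (e i) x'"
             and g = "\<lambda>i. cnj (iprod K (f i) y) * iprod K (f i) y'"])
         (simp add: H.parseval[OF be x] K.parseval[OF bf y])
    finally show ?thesis .
  qed
  show "vspan T {p x y | x y. x \<in> carrier H \<and> y \<in> carrier K} = carrier T"
    unfolding T
  proof (rule coord_span[OF J])
    fix k assume k: "k < n * m"
    have "(\<lambda>i. of_bool (i = k)) = (\<lambda>i. if i < n * m then iprod H (e (i div m)) (e (k div m)) * iprod K (f (i mod m)) (f (k mod m)) else 0)"
    proof
      fix i
      have "(i div m = k div m \<and> i mod m = k mod m) = (i = k)"
        by (metis div_mult_mod_eq)
      thus "of_bool (i = k) = (if i < n * m then iprod H (e (i div m)) (e (k div m)) * iprod K (f (i mod m)) (f (k mod m)) else (0::complex))"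
        using be bf k dm by (auto simp: H.onbasis_def H.onsys_def K.onbasis_def K.onsys_def)
    qed
    thus "J (\<lambda>i. of_bool (i = k)) \<in> {p x y | x y. x \<in> carrier H \<and> y \<in> carrier K}"
      using inn[OF k] by (auto simp: p)
  qed (auto simp: coord_simps p)
qed

lemma full_model:
  assumes J: "inj J"
  shows "hilbert_tensor_model (full_model J)"
proof -
  have s: "H \<in> spaces (full_model J) \<longleftrightarrow> fd_hilbert_space H" for H
    by (simp add: full_model_def)
  have i: "scalars (full_model J) = coord J 1" "unit_vec (full_model J) = J (\<lambda>i. of_bool (i = 0))"
    "tprod (full_model J) H K = coord J (fst (chosen_basis H) * fst (chosen_basis K))" for H K
    by (simp_all add: full_model_def)
  show ?thesis
  proof (rule hilbert_tensor_model.intro, unfold s)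
    show "vspan (scalars (full_model J)) {unit_vec (full_model J)} = carrier (scalars (full_model J))"
      unfolding i using J by (intro coord_span) (auto simp: coord_simps)
  qed (simp_all add: full_model_pure[OF J] i(1,2) coord_hilbert[OF J] i(3)[THEN arg_cong[of _ _ fd_hilbert_space]],
       use J in \<open>auto simp: coord_simps\<close>)
qed

theorem tensor_model_exists:
  assumes "inj (J :: (nat \<Rightarrow> complex) \<Rightarrow> 'u)"
  shows "\<exists>M :: 'u tensor_model. hilbert_tensor_model M \<and> spaces M = {H. fd_hilbert_space H}"
  using full_model[OF assms] by (intro exI[of _ "full_model J"]) (simp add: full_model_def)

end

theory Submission
  imports Defs
begin

text \<open>
  A linear map \<open>P : H \<otimes> A \<rightarrow> B \<otimes> H\<close> is determined by its matrix elements
  \<open>\<langle>y \<otimes> h', P (h \<otimes> a)\<rangle>\<close>.  Inserting resolutions of the identity turns the string diagrams in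
  the axioms of a quantum function into identities between finite sums of matrix elements, in which
  no associators occur, and turns the composite of two quantum functions into a matrix product over a
  frame of the middle algebra.  Stability under composition is then a reordering of sums, where the third
  axiom needs in addition the snake equation for the cup \<open>\<Delta> u\<close> and the cap \<open>\<epsilon> m\<close>.

  The third axiom expresses \<open>P\<^sup>\<dagger>\<close> linearly through the matrix elements of \<open>P\<close> itself, with
  coefficients depending only on \<open>A\<close> and \<open>B\<close>.  Therefore whatever intertwines \<open>P\<close> and \<open>P'\<close> also intertwines
  their adjoints, and taking adjoints once more shows that the adjoint of an intertwiner is an
  intertwiner.  The remaining axioms are equations of linear maps that hold on pure tensors.
\<close>


text \<open>Finite sums of vectors never occur. A vector is known through the values of linear
  functionals on it, and all sums are sums of complex numbers. Resolutions of the identity are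
  accordingly recorded as identities between inner products. Frames are used rather than orthonormal
  bases because they multiply without further checks: frames of two factors give one of the tensor
  product, indexed by pairs, and \<open>unit_vec M\<close> alone is one for \<open>\<I>\<close>.

  \<open>adjoint\<close>, \<open>tmap\<close>, \<open>assoc\<close>, \<open>lunit\<close> and
  \<open>runit\<close> are definite descriptions, so each first needs a witness and its uniqueness.
  Uniqueness comes from the span of the pure tensors; adjoints and tensor maps get their witnesses
  as operators of finite rank assembled from frames.

  Since \<open>iprod\<close> is antilinear on the left, a matrix element is linear in its ket only.
  Expansions in the bra are therefore separate lemmas, obtained by conjugation.

  Each snake equation is one Frobenius equation evaluated at the unit. Composites use
  \<open>snake1\<close>, and the identity 1-morphism uses \<open>snake2\<close>.\<close>

section \<open>Linear functionals and frames on one Hilbert space\<close>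

definition linear_functional :: "'u hilb \<Rightarrow> ('u \<Rightarrow> complex) \<Rightarrow> bool" where
  "linear_functional H \<phi> \<longleftrightarrow>
     (\<forall>x\<in>carrier H. \<forall>y\<in>carrier H. \<phi> (x \<oplus>\<^bsub>H\<^esub> y) = \<phi> x + \<phi> y) \<and>
     (\<forall>c. \<forall>x\<in>carrier H. \<phi> (c \<odot>\<^bsub>H\<^esub> x) = c * \<phi> x)"

text \<open>This is a Parseval frame. The index type is free, so that tensor products can use pairs
  of indices and the scalars the one-point type.\<close>

definition frame :: "'u hilb \<Rightarrow> 'i set \<Rightarrow> ('i \<Rightarrow> 'u) \<Rightarrow> bool" where
  "frame H I e \<longleftrightarrow> finite I \<and> (\<forall>i\<in>I. e i \<in> carrier H) \<and>
     (\<forall>x\<in>carrier H. \<forall>y\<in>carrier H. iprod H x y = (\<Sum>i\<in>I. iprod H x (e i) * iprod H (e i) y))"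

lemma frame_finite: "frame H I e \<Longrightarrow> finite I"
  and frame_closed: "frame H I e \<Longrightarrow> i \<in> I \<Longrightarrow> e i \<in> carrier H"
  and frame_iprod: "frame H I e \<Longrightarrow> x \<in> carrier H \<Longrightarrow> y \<in> carrier H \<Longrightarrow>
    (\<Sum>i\<in>I. iprod H x (e i) * iprod H (e i) y) = iprod H x y"
  unfolding frame_def by (blast, blast, metis)

context fd_hilbert_space
begin

lemma neg_eq_smult: "y \<in> carrier H \<Longrightarrow> \<ominus> y = (-1) \<odot> y"
  using smult_l_minus[of 1 y] smult_one[of y] by (simp add: complex_field_minus)

text \<open>The difference of \<open>x\<close> and \<open>y\<close> has inner product zero with
  itself and vanishes by positivity. Equations of vectors thus become equations of numbers.\<close>

lemma iprod_eqI:
  assumes x: "x \<in> carrier H" and y: "y \<in> carrier H"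
    and eq: "\<And>z. z \<in> carrier H \<Longrightarrow> iprod H z x = iprod H z y"
  shows "x = y"
proof -
  define z where "z = x \<oplus> (-1) \<odot> y"
  have z: "z \<in> carrier H" using x y by (simp add: z_def smult_in)
  have "iprod H z z = iprod H z x - iprod H z y"
    using x y z by (subst (2) z_def) (simp add: iprod_add iprod_smult smult_in)
  hence "z = \<zero>" using eq[OF z] iprod_pos[OF z] by fastforce
  hence "\<ominus> y = \<ominus> x" using x y minus_equality[of "\<ominus> y" x] by (simp add: z_def neg_eq_smult a_comm smult_in)
  thus ?thesis using x y by (metis minus_minus)
qed

lemma linear_functional_iprod: "z \<in> carrier H \<Longrightarrow> linear_functional H (iprod H z)"
  by (simp add: linear_functional_def iprod_add iprod_smult)

text \<open>The points of agreement form a submodule containing \<open>S\<close>, and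
  \<open>vspan\<close> is the intersection of all submodules containing \<open>S\<close>.\<close>

lemma linear_functional_eq:
  assumes "linear_functional H \<phi>" "linear_functional H \<psi>"
    and S: "vspan H S = carrier H" "\<And>x. x \<in> S \<Longrightarrow> \<phi> x = \<psi> x" and x: "x \<in> carrier H"
  shows "\<phi> x = \<psi> x"
proof -
  have SC: "S \<subseteq> carrier H" using S(1) by (auto simp: vspan_def)
  have z: "\<chi> \<zero> = 0" if "linear_functional H \<chi>" for \<chi>
    using that smult_l_null[of \<zero>] unfolding linear_functional_def
    by (metis complex_field_simps(4) mult_zero_left zero_closed)
  have "submodule {x \<in> carrier H. \<phi> x = \<psi> x} complex_field H"
    using assms(1,2) z[OF assms(1)] z[OF assms(2)]
    by (intro submoduleI) (auto simp: neg_eq_smult linear_functional_def smult_in)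
  hence "vspan H S \<subseteq> {x \<in> carrier H. \<phi> x = \<psi> x}"
    unfolding vspan_def using S(2) SC by blast
  thus ?thesis using x S(1) by auto
qed

text \<open>The vector is the combination of the \<open>w i\<close> with coefficients
  \<open>c i\<close>. Describing it by its values under functionals avoids finite sums in the
  carrier.\<close>

lemma linear_combination_exists:
  assumes "finite I" "\<And>i. i \<in> I \<Longrightarrow> w i \<in> carrier H"
  shows "\<exists>v\<in>carrier H. \<forall>\<phi>. linear_functional H \<phi> \<longrightarrow> \<phi> v = (\<Sum>i\<in>I. c i * \<phi> (w i))"
  using assms
proof (induction I rule: finite_induct)
  case empty
  have "\<phi> \<zero> = 0" if "linear_functional H \<phi>" for \<phi>
    using that smult_l_null[of \<zero>] unfolding linear_functional_def
    by (metis complex_field_simps(4) mult_zero_left zero_closed)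
  thus ?case by auto
next
  case (insert j I)
  then obtain v where v: "v \<in> carrier H"
    "\<And>\<phi>. linear_functional H \<phi> \<Longrightarrow> \<phi> v = (\<Sum>i\<in>I. c i * \<phi> (w i))" by auto
  thus ?case using insert
    by (intro bexI[of _ "c j \<odot> w j \<oplus> v"]) (auto simp: linear_functional_def smult_in)
qed

text \<open>The combination of the \<open>e i\<close> with coefficients
  \<open>iprod H (e i) x\<close> has the same inner products as \<open>x\<close>, hence equals
  \<open>x\<close>. This extends the frame identity from inner products to arbitrary
  functionals.\<close>

lemma frame_expand:
  assumes e: "frame H I e" and \<phi>: "linear_functional H \<phi>" and x: "x \<in> carrier H"
  shows "(\<Sum>i\<in>I. iprod H (e i) x * \<phi> (e i)) = \<phi> x"
proof -
  obtain v where v: "v \<in> carrier H"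
    "\<And>\<phi>. linear_functional H \<phi> \<Longrightarrow> \<phi> v = (\<Sum>i\<in>I. iprod H (e i) x * \<phi> (e i))"
    using linear_combination_exists[of I e "\<lambda>i. iprod H (e i) x"] e by (auto simp: frame_def)
  have "iprod H z v = iprod H z x" if "z \<in> carrier H" for z
    using v(2)[OF linear_functional_iprod[OF that]] frame_iprod[OF e that x] by (simp add: mult.commute)
  hence "v = x" using v x by (intro iprod_eqI) auto
  thus ?thesis using v(2)[OF \<phi>] by simp
qed

lemma frame_exists: "\<exists>n e. frame H {..<n::nat} e"
proof -
  obtain n e where b: "onbasis n e" using onbasis_exists by blast
  hence ei: "e i \<in> carrier H" if "i < n" for i using that by (auto simp: onbasis_def onsys_def)
  have "iprod H x y = (\<Sum>i<n. iprod H x (e i) * iprod H (e i) y)"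
    if "x \<in> carrier H" "y \<in> carrier H" for x y
    by (subst parseval[OF b that]) (use ei that in \<open>simp flip: iprod_cnj\<close>)
  hence "frame H {..<n} e" using ei by (auto simp only: frame_def finite_lessThan lessThan_iff)
  thus ?thesis by blast
qed

end

section \<open>Linear maps, operators of finite rank and adjoints\<close>

lemma linear_maps_app_closed: "f \<in> linear_maps H K \<Longrightarrow> x \<in> carrier H \<Longrightarrow> app f x \<in> carrier K"
  by (auto simp: linear_maps_def)

lemma linear_maps_add: "\<lbrakk>f \<in> linear_maps H K; x \<in> carrier H; y \<in> carrier H\<rbrakk>
    \<Longrightarrow> app f (x \<oplus>\<^bsub>H\<^esub> y) = app f x \<oplus>\<^bsub>K\<^esub> app f y"
  and linear_maps_smult: "\<lbrakk>f \<in> linear_maps H K; x \<in> carrier H\<rbrakk>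
    \<Longrightarrow> app f (c \<odot>\<^bsub>H\<^esub> x) = c \<odot>\<^bsub>K\<^esub> app f x"
  by (simp_all add: linear_maps_def)

lemma linear_maps_ext:
  assumes "f \<in> linear_maps H K" "g \<in> linear_maps H K" "\<And>x. x \<in> carrier H \<Longrightarrow> app f x = app g x"
  shows "f = g"
proof -
  have "app f = app g"
    using assms by (intro extensionalityI[of _ "carrier H"]) (auto simp: linear_maps_def PiE_def)
  thus ?thesis using assms by (simp add: linear_maps_def)
qed

lemma linear_functional_app:
  assumes "fd_hilbert_space K" "f \<in> linear_maps H K" "z \<in> carrier K"
  shows "linear_functional H (\<lambda>x. iprod K z (app f x))"
proof -
  interpret K: fd_hilbert_space K by fact
  show ?thesis using assms(2,3)
    by (auto simp: linear_functional_def linear_maps_add linear_maps_smult linear_maps_app_closed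
        K.iprod_add K.iprod_smult)
qed

lemma linear_maps_comp:
  assumes "fd_hilbert_space H" "f \<in> linear_maps H K" "g \<in> linear_maps K L"
  shows "g \<cdot> f \<in> linear_maps H L"
proof -
  interpret H: fd_hilbert_space H by fact
  have "source f = H" "target g = L" using assms(2,3) by (simp_all add: linear_maps_def)
  thus ?thesis using assms(2,3)
    by (subst linear_maps_def) (auto simp: lcomp_def linear_maps_add[of f] linear_maps_add[of g]
        linear_maps_smult[of f] linear_maps_smult[of g] linear_maps_app_closed H.smult_in)
qed

lemma linear_maps_id:
  assumes "fd_hilbert_space H"
  shows "lid H \<in> linear_maps H H"
proof -
  interpret H: fd_hilbert_space H by fact
  show ?thesis by (auto simp: linear_maps_def lid_def H.smult_in)
qed

text \<open>In bra-ket notation this is the sum of the |w i><a i|. It is the common source of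
  adjoints and of maps out of tensor products. Its values are chosen through their functionals, so
  linearity follows from \<open>iprod_eqI\<close>.\<close>

lemma finite_rank_operator_exists:
  assumes "fd_hilbert_space H" "fd_hilbert_space K" "finite I"
    and a: "\<And>i. i \<in> I \<Longrightarrow> a i \<in> carrier H" and w: "\<And>i. i \<in> I \<Longrightarrow> w i \<in> carrier K"
  shows "\<exists>T\<in>linear_maps H K. \<forall>t\<in>carrier H. \<forall>z\<in>carrier K.
           iprod K z (app T t) = (\<Sum>i\<in>I. iprod H (a i) t * iprod K z (w i))"
proof -
  interpret H: fd_hilbert_space H by fact
  interpret K: fd_hilbert_space K by fact
  have "\<forall>t. \<exists>v. v \<in> carrier K \<and> (\<forall>\<phi>. linear_functional K \<phi> \<longrightarrow> \<phi> v = (\<Sum>i\<in>I. iprod H (a i) t * \<phi> (w i)))"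
    (is "\<forall>t. \<exists>v. ?P t v")
    using K.linear_combination_exists[of I w, OF assms(3) w] unfolding Bex_def by (rule allI)
  then obtain T where "\<forall>t. ?P t (T t)" by (rule choice[THEN exE])
  hence T: "T t \<in> carrier K"
    "linear_functional K \<phi> \<Longrightarrow> \<phi> (T t) = (\<Sum>i\<in>I. iprod H (a i) t * \<phi> (w i))" for t \<phi>
    by blast+
  note T' = T(2)[OF K.linear_functional_iprod]
  define f where "f = \<lparr>source = H, target = K, app = (\<lambda>x\<in>carrier H. T x)\<rparr>"
  have "T (x \<oplus>\<^bsub>H\<^esub> y) = T x \<oplus>\<^bsub>K\<^esub> T y" if "x \<in> carrier H" "y \<in> carrier H" for x y
    using that T(1) a by (intro K.iprod_eqI)
      (simp_all add: T' K.iprod_add H.iprod_add sum.distrib distrib_right)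
  moreover have "T (c \<odot>\<^bsub>H\<^esub> x) = c \<odot>\<^bsub>K\<^esub> T x" if "x \<in> carrier H" for c x
    using that T(1) a by (intro K.iprod_eqI)
      (simp_all add: T' K.iprod_smult H.iprod_smult K.smult_in sum_distrib_left mult.assoc)
  ultimately have "f \<in> linear_maps H K"
    by (simp add: linear_maps_def f_def T(1) H.smult_in)
  thus ?thesis using T' by (intro bexI[of _ f]) (auto simp: f_def)
qed

text \<open>The witness sends \<open>y\<close> to the combination of the frame vectors
  \<open>e i\<close> with coefficients \<open>iprod K (app f (e i)) y\<close>. Expanding the
  functional that maps \<open>x\<close> to \<open>iprod K y (app f x)\<close> in the frame shows
  that it is an adjoint; inner products determine it.\<close>

lemma adjoint_properties:
  assumes "fd_hilbert_space H" "fd_hilbert_space K" "f \<in> linear_maps H K"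
  shows adjoint_linear: "f\<^sup>\<dagger> \<in> linear_maps K H"
    and adjoint_iprod: "\<lbrakk>x \<in> carrier H; y \<in> carrier K\<rbrakk> \<Longrightarrow> iprod H (app (f\<^sup>\<dagger>) y) x = iprod K y (app f x)"
proof -
  interpret H: fd_hilbert_space H by fact
  interpret K: fd_hilbert_space K by fact
  obtain n e where e: "frame H {..<n::nat} e" using H.frame_exists by auto
  note fc = linear_maps_app_closed[OF assms(3)]
  obtain g where g: "g \<in> linear_maps K H"
    "\<And>y x. \<lbrakk>y \<in> carrier K; x \<in> carrier H\<rbrakk> \<Longrightarrow>
       iprod H x (app g y) = (\<Sum>i<n. iprod K (app f (e i)) y * iprod H x (e i))"
    using finite_rank_operator_exists[OF assms(2,1), of "{..<n}" "\<lambda>i. app f (e i)" e] frame_closed[OF e] fc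
    by auto
  have adj: "iprod H (app g y) x = iprod K y (app f x)" if x: "x \<in> carrier H" and y: "y \<in> carrier K" for x y
  proof -
    note gy = linear_maps_app_closed[OF g(1) y]
    have "iprod H (app g y) x = cnj (\<Sum>i<n. iprod K (app f (e i)) y * iprod H x (e i))"
      using H.iprod_cnj[OF x gy] g(2)[OF y x] by simp
    also have "\<dots> = (\<Sum>i<n. iprod H (e i) x * iprod K y (app f (e i)))"
      using frame_closed[OF e] fc x y
      by (simp add: mult.commute flip: H.iprod_cnj K.iprod_cnj)
    also have "\<dots> = iprod K y (app f x)"
      by (rule H.frame_expand[OF e linear_functional_app[OF assms(2,3) y] x])
    finally show ?thesis .
  qed
  have un: "g' = g" if g': "g' \<in> linear_maps K H"
    "\<forall>x\<in>carrier H. \<forall>y\<in>carrier K. iprod H (app g' y) x = iprod K y (app f x)" for g'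
  proof (rule linear_maps_ext[OF g'(1) g(1)], rule H.iprod_eqI)
    fix y z assume y: "y \<in> carrier K" and z: "z \<in> carrier H"
    note c = linear_maps_app_closed[OF g'(1) y] linear_maps_app_closed[OF g(1) y]
    show "iprod H z (app g' y) = iprod H z (app g y)"
      using H.iprod_cnj[OF c(1) z] H.iprod_cnj[OF c(2) z] adj[OF z y] g'(2) y z by simp
  qed (use g(1) g'(1) in \<open>simp_all add: linear_maps_app_closed\<close>)
  have st: "source f = H" "target f = K" using assms(3) by (auto simp: linear_maps_def)
  have "f\<^sup>\<dagger> = g"
    unfolding adjoint_def st
  proof (rule the_equality)
    show "g \<in> linear_maps K H \<and> (\<forall>x\<in>carrier H. \<forall>y\<in>carrier K. iprod H (app g y) x = iprod K y (app f x))"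
      using g(1) adj by blast
  qed (use un in blast)
  thus "f\<^sup>\<dagger> \<in> linear_maps K H" "\<lbrakk>x \<in> carrier H; y \<in> carrier K\<rbrakk> \<Longrightarrow> iprod H (app (f\<^sup>\<dagger>) y) x = iprod K y (app f x)"
    using g(1) adj by blast+
qed

section \<open>Reordering of the sums that occur for composites\<close>

lemma sum_rotate: "(\<Sum>a\<in>A. \<Sum>b\<in>B. \<Sum>c\<in>C. f a b c) = (\<Sum>b\<in>B. \<Sum>c\<in>C. \<Sum>a\<in>A. f a b c)"
  by (subst sum.swap, intro sum.cong refl, rule sum.swap)

text \<open>Here \<open>q1\<close>, \<open>q2\<close> are matrix elements of the outer map,
  \<open>p1\<close>, \<open>p2\<close> those of the inner one, and \<open>d\<close> the coefficients
  of a comultiplication. The right-hand side isolates the sums over the middle frame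
  \<open>J\<close>, which are the matrix elements of the composite.\<close>

lemma sum_reorder_mult:
  fixes q1 q2 :: "'u \<Rightarrow> 'l \<Rightarrow> complex" and p1 p2 :: "'l \<Rightarrow> 's \<Rightarrow> 'i \<Rightarrow> complex"
  shows "(\<Sum>l\<in>J. \<Sum>m\<in>J. (\<Sum>u\<in>U. q2 u m * q1 u l) * (\<Sum>i\<in>I. \<Sum>j\<in>I. d i j * (\<Sum>s\<in>S. p2 m s j * p1 l s i)))
    = (\<Sum>i\<in>I. \<Sum>j\<in>I. d i j * (\<Sum>u\<in>U. \<Sum>s\<in>S. (\<Sum>m\<in>J. q2 u m * p2 m s j) * (\<Sum>l\<in>J. q1 u l * p1 l s i)))"
  unfolding sum_distrib_left sum_distrib_right sum.cartesian_product case_prod_unfold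
  by (rule sum.reindex_bij_witness[of _ "\<lambda>(i, j, u, s, l, m). (l, m, (i, j, s), u)" "\<lambda>(l, m, (i, j, s), u). (i, j, u, s, l, m)"])
     (auto simp: mult_ac)

text \<open>Here \<open>\<alpha>\<close> and \<open>d\<close> are the cup and cap of the middle
  algebra, and \<open>c\<close> and \<open>b\<close> the outer cap and cup. The right-hand side
  makes the contraction of \<open>\<alpha>\<close> with \<open>d\<close> the innermost sum, where
  the snake equation applies.\<close>

lemma sum_reorder_adjoint:
  fixes \<alpha> :: "'l \<Rightarrow> 'l \<Rightarrow> complex" and p :: "'l \<Rightarrow> 'i \<Rightarrow> complex"
  shows "(\<Sum>j\<in>J. (\<Sum>s\<in>J. \<Sum>r\<in>L. \<alpha> s j * c r * q r s) * (\<Sum>i\<in>I. \<Sum>t\<in>J. b i * d j t * p t i))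
    = (\<Sum>i\<in>I. \<Sum>r\<in>L. b i * c r * (\<Sum>t\<in>J. (\<Sum>s\<in>J. q r s * (\<Sum>j\<in>J. \<alpha> s j * d j t)) * p t i))"
  unfolding sum_distrib_left sum_distrib_right sum.cartesian_product case_prod_unfold
  by (rule sum.reindex_bij_witness[of _ "\<lambda>(i, r, t, s, j). (j, (i, t), s, r)" "\<lambda>(j, (i, t), s, r). (i, r, t, s, j)"])
     (auto simp: mult_ac)

section \<open>Typed linear maps between the spaces of a tensor model\<close>

context hilbert_tensor_model
begin

notation tmap (infixl \<open>\<otimes>\<index>\<close> 70)

text \<open>Source and target are fields of a map, so being well typed is a predicate on the map
  alone. Side conditions of composition then become goals for the simplifier.\<close>

definition arr :: "'u lmap \<Rightarrow> bool" where
  "arr f \<longleftrightarrow> source f \<in> spaces M \<and> target f \<in> spaces M \<and> f \<in> linear_maps (source f) (target f)"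

lemma arrI: "\<lbrakk>f \<in> linear_maps H K; H \<in> spaces M; K \<in> spaces M\<rbrakk> \<Longrightarrow> arr f \<and> source f = H \<and> target f = K"
  by (simp add: arr_def linear_maps_def)

lemma arr_linear_maps: "\<lbrakk>arr f; source f = H; target f = K\<rbrakk> \<Longrightarrow> f \<in> linear_maps H K"
  by (auto simp: arr_def)

lemma arr_source [simp]: "arr f \<Longrightarrow> source f \<in> spaces M"
  and arr_target [simp]: "arr f \<Longrightarrow> target f \<in> spaces M"
  by (simp_all add: arr_def)

lemma app_closed [simp]: "\<lbrakk>arr f; target f = K; x \<in> carrier (source f)\<rbrakk> \<Longrightarrow> app f x \<in> carrier K"
  by (rule linear_maps_app_closed[OF arr_linear_maps[OF _ refl]])

declare tprod_space [simp] pure_closed [simp] scalars_space [simp] unit_vec_closed [simp]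
  unit_vec_norm [simp]

lemma source_lid [simp]: "source (lid H) = H" and target_lid [simp]: "target (lid H) = H"
  and app_lid [simp]: "x \<in> carrier H \<Longrightarrow> app (lid H) x = x"
  by (simp_all add: lid_def)

lemma arr_lid [simp]: "H \<in> spaces M \<Longrightarrow> arr (lid H)"
  unfolding arr_def by (simp add: linear_maps_id spaces_hilbert)

lemma source_comp [simp]: "source (g \<cdot> f) = source f"
  and target_comp [simp]: "target (g \<cdot> f) = target g"
  and app_comp [simp]: "x \<in> carrier (source f) \<Longrightarrow> app (g \<cdot> f) x = app g (app f x)"
  by (simp_all add: lcomp_def)

lemma arr_comp [simp]: "\<lbrakk>arr f; arr g; source g = target f\<rbrakk> \<Longrightarrow> arr (g \<cdot> f)"
  using linear_maps_comp[OF spaces_hilbert, of "source f" f "target f" g "target g"]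
  unfolding arr_def by simp

lemma arr_adj:
  assumes "arr f"
  shows arr_adjoint [simp]: "arr (f\<^sup>\<dagger>)" and source_adjoint [simp]: "source (f\<^sup>\<dagger>) = target f"
    and target_adjoint [simp]: "target (f\<^sup>\<dagger>) = source f"
proof -
  have "f\<^sup>\<dagger> \<in> linear_maps (target f) (source f)"
    using assms by (intro adjoint_linear spaces_hilbert arr_source arr_target arr_linear_maps refl)
  from arrI[OF this] assms show "arr (f\<^sup>\<dagger>)" "source (f\<^sup>\<dagger>) = target f" "target (f\<^sup>\<dagger>) = source f"
    by auto
qed

lemma iprod_adjoint:
  "\<lbrakk>arr f; source f = H; target f = K; x \<in> carrier H; y \<in> carrier K\<rbrakk> 
    \<Longrightarrow> iprod H (app (f\<^sup>\<dagger>) y) x = iprod K y (app f x)"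
  using adjoint_iprod[OF spaces_hilbert spaces_hilbert arr_linear_maps] arr_source arr_target by blast

lemma iprod_cnj': "\<lbrakk>H \<in> spaces M; x \<in> carrier H; y \<in> carrier H\<rbrakk> \<Longrightarrow> cnj (iprod H x y) = iprod H y x"
  by (rule fd_hilbert_space.iprod_cnj[OF spaces_hilbert, symmetric])

lemma iprod_adjoint':
  "\<lbrakk>arr f; source f = H; target f = K; x \<in> carrier H; y \<in> carrier K\<rbrakk> 
    \<Longrightarrow> iprod H x (app (f\<^sup>\<dagger>) y) = iprod K (app f x) y"
  using iprod_adjoint[of f H K x y] iprod_cnj'[of H "app (f\<^sup>\<dagger>) y" x] iprod_cnj'[of K y "app f x"] by auto

lemma arr_ext:
  "\<lbrakk>arr f; arr g; source f = source g; target f = target g;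
    \<And>x. x \<in> carrier (source g) \<Longrightarrow> app f x = app g x\<rbrakk> \<Longrightarrow> f = g"
  by (rule linear_maps_ext[of f "source g" "target g"]) (auto simp: arr_linear_maps)

lemma iprod_eqI:
  "\<lbrakk>H \<in> spaces M; x \<in> carrier H; y \<in> carrier H; \<And>z. z \<in> carrier H \<Longrightarrow> iprod H z x = iprod H z y\<rbrakk> \<Longrightarrow> x = y"
  by (rule fd_hilbert_space.iprod_eqI[OF spaces_hilbert])

lemma adjoint_eqI:
  assumes "arr f" "arr g" "source g = target f" "target g = source f"
    "\<And>x y. \<lbrakk>x \<in> carrier (source f); y \<in> carrier (target f)\<rbrakk> \<Longrightarrow>
        iprod (source f) x (app g y) = iprod (target f) (app f x) y"
  shows "f\<^sup>\<dagger> = g"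
proof (rule arr_ext)
  fix y assume y: "y \<in> carrier (source g)"
  show "app (f\<^sup>\<dagger>) y = app g y"
  proof (rule iprod_eqI)
    fix x assume "x \<in> carrier (source f)"
    thus "iprod (source f) x (app (f\<^sup>\<dagger>) y) = iprod (source f) x (app g y)"
      using assms y by (simp add: iprod_adjoint')
  qed (use assms y in auto)
qed (use assms in auto)

lemma adjoint_adjoint [simp]: "arr f \<Longrightarrow> (f\<^sup>\<dagger>)\<^sup>\<dagger> = f"
  by (rule adjoint_eqI) (simp_all add: iprod_adjoint)

lemma adjoint_lid [simp]: "H \<in> spaces M \<Longrightarrow> (lid H)\<^sup>\<dagger> = lid H"
  by (rule adjoint_eqI) simp_all

lemma adjoint_comp: "\<lbrakk>arr f; arr g; source g = target f\<rbrakk> \<Longrightarrow> (g \<cdot> f)\<^sup>\<dagger> = f\<^sup>\<dagger> \<cdot> g\<^sup>\<dagger>"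
  by (rule adjoint_eqI) (simp_all add: iprod_adjoint')

lemma comp_assoc [simp]: "\<lbrakk>arr f; arr g; target f = source g\<rbrakk> \<Longrightarrow> (h \<cdot> g) \<cdot> f = h \<cdot> g \<cdot> f"
  by (simp add: lcomp_def fun_eq_iff restrict_def)

lemma comp_lid [simp]: "\<lbrakk>arr f; source f = H\<rbrakk> \<Longrightarrow> f \<cdot> lid H = f"
  and lid_comp [simp]: "\<lbrakk>arr f; target f = H\<rbrakk> \<Longrightarrow> lid H \<cdot> f = f"
  by (rule arr_ext; auto)+

subsection \<open>Extension from pure tensors\<close>

lemma functional_iprod [intro]: "\<lbrakk>H \<in> spaces M; z \<in> carrier H\<rbrakk> \<Longrightarrow> linear_functional H (iprod H z)"
  by (rule fd_hilbert_space.linear_functional_iprod[OF spaces_hilbert])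

lemma functional_app:
  "\<lbrakk>linear_functional K \<phi>; arr f; source f = H; target f = K\<rbrakk> \<Longrightarrow> linear_functional H (\<lambda>x. \<phi> (app f x))"
  using linear_maps_add[of f H K] linear_maps_smult[of f H K] linear_maps_app_closed[of f H K]
  by (simp add: linear_functional_def arr_linear_maps)

lemma functional_pure_left:
  "\<lbrakk>linear_functional (H \<boxtimes> K) \<phi>; H \<in> spaces M; K \<in> spaces M; y \<in> carrier K\<rbrakk>
    \<Longrightarrow> linear_functional H (\<lambda>x. \<phi> (pure M H K x y))"
  by (auto simp: linear_functional_def pure_add_left pure_smult_left)

lemma functional_pure_right:
  "\<lbrakk>linear_functional (H \<boxtimes> K) \<phi>; H \<in> spaces M; K \<in> spaces M; x \<in> carrier H\<rbrakk>
    \<Longrightarrow> linear_functional K (\<lambda>y. \<phi> (pure M H K x y))"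
  by (auto simp: linear_functional_def pure_add_right pure_smult_right)

lemma functional_tensor_eq:
  assumes "linear_functional (H \<boxtimes> K) \<phi>" "linear_functional (H \<boxtimes> K) \<psi>" "H \<in> spaces M" "K \<in> spaces M"
    "\<And>x y. \<lbrakk>x \<in> carrier H; y \<in> carrier K\<rbrakk> \<Longrightarrow> \<phi> (pure M H K x y) = \<psi> (pure M H K x y)" "t \<in> carrier (H \<boxtimes> K)"
  shows "\<phi> t = \<psi> t"
  by (rule fd_hilbert_space.linear_functional_eq[OF spaces_hilbert assms(1,2) pure_span])
     (use assms in auto)

text \<open>With \<open>z\<close> fixed, both sides are functionals on
  \<open>H \<boxtimes> K\<close>, where pure tensors decide. Tensors of such a vector with
  \<open>z\<close> decide in turn on the triple product.\<close>

lemma functional_tensor3_eq: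
  assumes "linear_functional (H \<boxtimes> K \<boxtimes> L) \<phi>" "linear_functional (H \<boxtimes> K \<boxtimes> L) \<psi>"
    "H \<in> spaces M" "K \<in> spaces M" "L \<in> spaces M"
    "\<And>x y z. \<lbrakk>x \<in> carrier H; y \<in> carrier K; z \<in> carrier L\<rbrakk> \<Longrightarrow>
       \<phi> (pure M (H \<boxtimes> K) L (pure M H K x y) z) = \<psi> (pure M (H \<boxtimes> K) L (pure M H K x y) z)"
    "t \<in> carrier (H \<boxtimes> K \<boxtimes> L)"
  shows "\<phi> t = \<psi> t"
proof (rule functional_tensor_eq[OF assms(1,2) _ _ _ assms(7)])
  fix s z assume s: "s \<in> carrier (H \<boxtimes> K)" and z: "z \<in> carrier L"
  show "\<phi> (pure M (H \<boxtimes> K) L s z) = \<psi> (pure M (H \<boxtimes> K) L s z)"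
    by (rule functional_tensor_eq[OF functional_pure_left[OF assms(1)] functional_pure_left[OF assms(2)]])
       (use assms s z in auto)
qed (use assms in auto)

text \<open>The pure tensors stand in the antilinear slot. Conjugation moves them to the right,
  where \<open>functional_tensor_eq\<close> applies.\<close>

lemma tensor_iprod_eqI:
  assumes "H \<in> spaces M" "K \<in> spaces M" "s \<in> carrier (H \<boxtimes> K)" "t \<in> carrier (H \<boxtimes> K)"
    "\<And>x y. \<lbrakk>x \<in> carrier H; y \<in> carrier K\<rbrakk> \<Longrightarrow>
       iprod (H \<boxtimes> K) (pure M H K x y) s = iprod (H \<boxtimes> K) (pure M H K x y) t"
  shows "s = t"
proof (rule iprod_eqI[OF _ assms(3,4)])
  fix z assume z: "z \<in> carrier (H \<boxtimes> K)"
  have "iprod (H \<boxtimes> K) s z = iprod (H \<boxtimes> K) t z"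
  proof (rule functional_tensor_eq[OF _ _ assms(1,2) _ z])
    fix x y assume "x \<in> carrier H" "y \<in> carrier K"
    thus "iprod (H \<boxtimes> K) s (pure M H K x y) = iprod (H \<boxtimes> K) t (pure M H K x y)"
      using assms by (simp flip: iprod_cnj'[of "H \<boxtimes> K" "pure M H K x y"])
  qed (use assms in auto)
  thus "iprod (H \<boxtimes> K) z s = iprod (H \<boxtimes> K) z t"
    using assms z by (simp flip: iprod_cnj'[of "H \<boxtimes> K" _ z])
qed (use assms in simp_all)

lemma tensor3_iprod_eqI:
  assumes "H \<in> spaces M" "K \<in> spaces M" "L \<in> spaces M"
    "s \<in> carrier (H \<boxtimes> K \<boxtimes> L)" "t \<in> carrier (H \<boxtimes> K \<boxtimes> L)"
    "\<And>x y z. \<lbrakk>x \<in> carrier H; y \<in> carrier K; z \<in> carrier L\<rbrakk> \<Longrightarrow>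
       iprod (H \<boxtimes> K \<boxtimes> L) (pure M (H \<boxtimes> K) L (pure M H K x y) z) s
         = iprod (H \<boxtimes> K \<boxtimes> L) (pure M (H \<boxtimes> K) L (pure M H K x y) z) t"
  shows "s = t"
proof (rule iprod_eqI[OF _ assms(4,5)])
  fix z assume z: "z \<in> carrier (H \<boxtimes> K \<boxtimes> L)"
  have "iprod (H \<boxtimes> K \<boxtimes> L) s z = iprod (H \<boxtimes> K \<boxtimes> L) t z"
  proof (rule functional_tensor3_eq[OF _ _ assms(1-3) _ z])
    fix x y z assume *: "x \<in> carrier H" "y \<in> carrier K" "z \<in> carrier L"
    let ?p = "pure M (H \<boxtimes> K) L (pure M H K x y) z"
    show "iprod (H \<boxtimes> K \<boxtimes> L) s ?p = iprod (H \<boxtimes> K \<boxtimes> L) t ?p"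
      using assms(1-5) assms(6)[OF *] * by (simp flip: iprod_cnj'[of "H \<boxtimes> K \<boxtimes> L" ?p])
  qed (use assms in auto)
  thus "iprod (H \<boxtimes> K \<boxtimes> L) z s = iprod (H \<boxtimes> K \<boxtimes> L) z t"
    using assms z by (simp flip: iprod_cnj'[of "H \<boxtimes> K \<boxtimes> L" _ z])
qed (use assms in simp_all)

lemma arr_tensor_ext:
  assumes "arr f" "arr g" "target f = target g" "source f = H \<boxtimes> K" "source g = H \<boxtimes> K"
    "H \<in> spaces M" "K \<in> spaces M"
    "\<And>x y. \<lbrakk>x \<in> carrier H; y \<in> carrier K\<rbrakk> \<Longrightarrow> app f (pure M H K x y) = app g (pure M H K x y)"
  shows "f = g"
proof (rule arr_ext, goal_cases)
  case (5 t)
  show ?case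
  proof (rule iprod_eqI[of "target g"])
    fix z assume z: "z \<in> carrier (target g)"
    show "iprod (target g) z (app f t) = iprod (target g) z (app g t)"
      by (rule functional_tensor_eq[of H K "\<lambda>t. iprod (target g) z (app f t)" "\<lambda>t. iprod (target g) z (app g t)"])
         (use assms z 5 in \<open>auto intro!: functional_app[OF functional_iprod]\<close>)
  qed (use assms 5 in auto)
qed (use assms in auto)

lemma arr_tensor3_ext:
  assumes "arr f" "arr g" "target f = target g" "source f = H \<boxtimes> K \<boxtimes> L" "source g = H \<boxtimes> K \<boxtimes> L"
    "H \<in> spaces M" "K \<in> spaces M" "L \<in> spaces M"
    "\<And>x y z. \<lbrakk>x \<in> carrier H; y \<in> carrier K; z \<in> carrier L\<rbrakk> \<Longrightarrow>
      app f (pure M (H \<boxtimes> K) L (pure M H K x y) z) = app g (pure M (H \<boxtimes> K) L (pure M H K x y) z)"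
  shows "f = g"
proof (rule arr_ext, goal_cases)
  case (5 t)
  show ?case
  proof (rule iprod_eqI[of "target g"])
    fix z assume z: "z \<in> carrier (target g)"
    show "iprod (target g) z (app f t) = iprod (target g) z (app g t)"
      by (rule functional_tensor3_eq[of H K L "\<lambda>t. iprod (target g) z (app f t)" "\<lambda>t. iprod (target g) z (app g t)"])
         (use assms z 5 in \<open>auto intro!: functional_app[OF functional_iprod]\<close>)
  qed (use assms 5 in auto)
qed (use assms in auto)

subsection \<open>Frames\<close>

lemma frame_exists: "H \<in> spaces M \<Longrightarrow> \<exists>n e. frame H {..<n::nat} e"
  by (rule fd_hilbert_space.frame_exists[OF spaces_hilbert])

lemma frame_expand:
  "\<lbrakk>frame H I e; H \<in> spaces M; linear_functional H \<phi>; x \<in> carrier H\<rbrakk>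
    \<Longrightarrow> (\<Sum>i\<in>I. iprod H (e i) x * \<phi> (e i)) = \<phi> x"
  by (rule fd_hilbert_space.frame_expand[OF spaces_hilbert])

text \<open>Since \<open>\<phi>\<close> is only separately linear, it is expanded in one frame at a
  time. It need not be known to factor through the tensor product, which is what allows its use in
  constructing maps out of that product.\<close>

lemma frame_expand_tensor:
  assumes e: "frame H I e" and f: "frame K J f" and sp: "H \<in> spaces M" "K \<in> spaces M"
    and 1: "\<And>y. y \<in> carrier K \<Longrightarrow> linear_functional H (\<lambda>x. \<phi> x y)"
    and 2: "\<And>x. x \<in> carrier H \<Longrightarrow> linear_functional K (\<lambda>y. \<phi> x y)"
    and x: "x \<in> carrier H" and y: "y \<in> carrier K"
  shows "(\<Sum>i\<in>I. \<Sum>j\<in>J. iprod (H \<boxtimes> K) (pure M H K (e i) (f j)) (pure M H K x y) * \<phi> (e i) (f j)) = \<phi> x y"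
proof -
  have "(\<Sum>i\<in>I. \<Sum>j\<in>J. iprod (H \<boxtimes> K) (pure M H K (e i) (f j)) (pure M H K x y) * \<phi> (e i) (f j))
      = (\<Sum>i\<in>I. iprod H (e i) x * (\<Sum>j\<in>J. iprod K (f j) y * \<phi> (e i) (f j)))"
    using sp x y frame_closed[OF e] frame_closed[OF f]
    by (auto simp: pure_iprod sum_distrib_left mult.assoc intro!: sum.cong)
  also have "\<dots> = (\<Sum>i\<in>I. iprod H (e i) x * \<phi> (e i) y)"
    using frame_expand[OF f sp(2) 2 y] frame_closed[OF e] by simp
  also have "\<dots> = \<phi> x y"
    by (rule frame_expand[OF e sp(1) 1[OF y] x])
  finally show ?thesis .
qed

text \<open>For fixed \<open>s\<close> both sides are functionals of \<open>t\<close>, so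
  \<open>t\<close> may be taken pure. The claim is then the expansion of a form linear in each
  factor.\<close>

lemma frame_tensor:
  assumes e: "frame H I e" and f: "frame K J f" and sp: "H \<in> spaces M" "K \<in> spaces M"
  shows "frame (H \<boxtimes> K) (I \<times> J) (\<lambda>(i, j). pure M H K (e i) (f j))"
proof -
  have c: "e i \<in> carrier H" if "i \<in> I" for i using frame_closed[OF e that] .
  have d: "f j \<in> carrier K" if "j \<in> J" for j using frame_closed[OF f that] .
  have *: "iprod (H \<boxtimes> K) s t = (\<Sum>i\<in>I. \<Sum>j\<in>J. iprod (H \<boxtimes> K) (pure M H K (e i) (f j)) t *
      iprod (H \<boxtimes> K) s (pure M H K (e i) (f j)))"
    if s: "s \<in> carrier (H \<boxtimes> K)" and t: "t \<in> carrier (H \<boxtimes> K)" for s t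
  proof (rule functional_tensor_eq[OF _ _ sp _ t])
    show "linear_functional (H \<boxtimes> K) (iprod (H \<boxtimes> K) s)" using sp s by auto
    have "linear_functional (H \<boxtimes> K) (iprod (H \<boxtimes> K) (pure M H K (e i) (f j)))" if "i \<in> I" "j \<in> J" for i j
      using sp c[OF that(1)] d[OF that(2)] by auto
    thus "linear_functional (H \<boxtimes> K) (\<lambda>t. \<Sum>i\<in>I. \<Sum>j\<in>J. iprod (H \<boxtimes> K) (pure M H K (e i) (f j)) t *
      iprod (H \<boxtimes> K) s (pure M H K (e i) (f j)))"
      by (auto simp: linear_functional_def sum.distrib sum_distrib_left distrib_right mult.assoc)
    fix x y assume x: "x \<in> carrier H" and y: "y \<in> carrier K"
    show "iprod (H \<boxtimes> K) s (pure M H K x y) = (\<Sum>i\<in>I. \<Sum>j\<in>J. iprod (H \<boxtimes> K) (pure M H K (e i) (f j)) (pure M H K x y) *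
      iprod (H \<boxtimes> K) s (pure M H K (e i) (f j)))"
      by (rule frame_expand_tensor[OF e f sp _ _ x y, symmetric])
         (use sp s in \<open>auto intro!: functional_pure_left[of H K "iprod (H \<boxtimes> K) s"] functional_pure_right\<close>)
  qed
  show ?thesis
    unfolding frame_def
  proof (intro conjI ballI)
    fix s t assume "s \<in> carrier (H \<boxtimes> K)" "t \<in> carrier (H \<boxtimes> K)"
    from *[OF this] show "iprod (H \<boxtimes> K) s t = (\<Sum>p\<in>I \<times> J.
        iprod (H \<boxtimes> K) s (case p of (i, j) \<Rightarrow> pure M H K (e i) (f j)) *
        iprod (H \<boxtimes> K) (case p of (i, j) \<Rightarrow> pure M H K (e i) (f j)) t)"
      by (simp only: sum.cartesian_product case_prod_unfold mult.commute)
  qed (use frame_finite[OF e] frame_finite[OF f] c d sp in auto)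
qed

subsection \<open>The universal property of tensor products\<close>

text \<open>In bra-ket notation the witness is the sum of |B (e i) (f j)> times the bra of the pure
  tensor of \<open>e i\<close> and \<open>f j\<close>. Linearity of \<open>B\<close> in each
  argument is stated through inner products, the form in which it is used.\<close>

lemma tensor_map_exists:
  assumes sp: "H \<in> spaces M" "K \<in> spaces M" "L \<in> spaces M"
    and B: "\<And>x y. \<lbrakk>x \<in> carrier H; y \<in> carrier K\<rbrakk> \<Longrightarrow> B x y \<in> carrier L"
    and 1: "\<And>y z. \<lbrakk>y \<in> carrier K; z \<in> carrier L\<rbrakk> \<Longrightarrow> linear_functional H (\<lambda>x. iprod L z (B x y))"
    and 2: "\<And>x z. \<lbrakk>x \<in> carrier H; z \<in> carrier L\<rbrakk> \<Longrightarrow> linear_functional K (\<lambda>y. iprod L z (B x y))"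
  shows "\<exists>T. arr T \<and> source T = H \<boxtimes> K \<and> target T = L \<and>
    (\<forall>x\<in>carrier H. \<forall>y\<in>carrier K. app T (pure M H K x y) = B x y)"
proof -
  obtain n e where e: "frame H {..<n::nat} e" using frame_exists[OF sp(1)] by blast
  obtain m f where f: "frame K {..<m::nat} f" using frame_exists[OF sp(2)] by blast
  note c = frame_closed[OF e] and d = frame_closed[OF f]
  obtain T where T: "T \<in> linear_maps (H \<boxtimes> K) L"
    "\<forall>t\<in>carrier (H \<boxtimes> K). \<forall>z\<in>carrier L. iprod L z (app T t) =
      (\<Sum>p\<in>{..<n}\<times>{..<m}. iprod (H \<boxtimes> K) (pure M H K (e (fst p)) (f (snd p))) t * iprod L z (B (e (fst p)) (f (snd p))))"
    using finite_rank_operator_exists[OF spaces_hilbert spaces_hilbert, of "H \<boxtimes> K" L "{..<n}\<times>{..<m}"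
      "\<lambda>p. pure M H K (e (fst p)) (f (snd p))" "\<lambda>p. B (e (fst p)) (f (snd p))"] sp B c d by auto
  have T': "arr T \<and> source T = H \<boxtimes> K \<and> target T = L" using arrI[OF T(1)] sp by simp
  moreover have "app T (pure M H K x y) = B x y" if x: "x \<in> carrier H" and y: "y \<in> carrier K" for x y
  proof (rule iprod_eqI[OF sp(3)])
    fix z assume z: "z \<in> carrier L"
    have "iprod L z (app T (pure M H K x y)) = (\<Sum>i<n. \<Sum>j<m.
       iprod (H \<boxtimes> K) (pure M H K (e i) (f j)) (pure M H K x y) * iprod L z (B (e i) (f j)))"
      using T(2) sp x y z by (simp add: sum.cartesian_product case_prod_beta)
    also have "\<dots> = iprod L z (B x y)"
      by (rule frame_expand_tensor[OF e f sp(1,2) 1 2 x y]) (use z in auto)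
    finally show "iprod L z (app T (pure M H K x y)) = iprod L z (B x y)" .
  qed (use T' sp x y B in auto)
  ultimately show ?thesis by blast
qed

text \<open>The two-factor property is used twice: once for each fixed \<open>z\<close>, giving a
  map \<open>T z\<close> on \<open>H \<boxtimes> K\<close>, and once for the assignment of
  \<open>app (T z) t\<close> to \<open>t\<close> and \<open>z\<close>.\<close>

lemma tensor3_map_exists:
  assumes sp: "H \<in> spaces M" "K \<in> spaces M" "L \<in> spaces M" "N \<in> spaces M"
    and B: "\<And>x y z. \<lbrakk>x \<in> carrier H; y \<in> carrier K; z \<in> carrier L\<rbrakk> \<Longrightarrow> B x y z \<in> carrier N"
    and 1: "\<And>y z v. \<lbrakk>y \<in> carrier K; z \<in> carrier L; v \<in> carrier N\<rbrakk> \<Longrightarrow> linear_functional H (\<lambda>x. iprod N v (B x y z))"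
    and 2: "\<And>x z v. \<lbrakk>x \<in> carrier H; z \<in> carrier L; v \<in> carrier N\<rbrakk> \<Longrightarrow> linear_functional K (\<lambda>y. iprod N v (B x y z))"
    and 3: "\<And>x y v. \<lbrakk>x \<in> carrier H; y \<in> carrier K; v \<in> carrier N\<rbrakk> \<Longrightarrow> linear_functional L (\<lambda>z. iprod N v (B x y z))"
  shows "\<exists>T. arr T \<and> source T = H \<boxtimes> K \<boxtimes> L \<and> target T = N \<and>
    (\<forall>x\<in>carrier H. \<forall>y\<in>carrier K. \<forall>z\<in>carrier L. app T (pure M (H \<boxtimes> K) L (pure M H K x y) z) = B x y z)"
proof -
  have "\<exists>T. arr T \<and> source T = H \<boxtimes> K \<and> target T = N \<and>
      (\<forall>x\<in>carrier H. \<forall>y\<in>carrier K. app T (pure M H K x y) = B x y z)" if "z \<in> carrier L" for z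
    using tensor_map_exists[of H K N "\<lambda>x y. B x y z"] sp B 1 2 that by simp
  then obtain T where T: "\<And>z. z \<in> carrier L \<Longrightarrow> arr (T z) \<and> source (T z) = H \<boxtimes> K \<and> target (T z) = N"
    "\<And>x y z. \<lbrakk>x \<in> carrier H; y \<in> carrier K; z \<in> carrier L\<rbrakk> \<Longrightarrow> app (T z) (pure M H K x y) = B x y z"
    by metis
  have l1: "linear_functional (H \<boxtimes> K) (\<lambda>t. iprod N v (app (T z) t))" if "z \<in> carrier L" "v \<in> carrier N" for z v
    by (rule functional_app[of N]) (use T(1)[OF that(1)] that sp in auto)
  \<comment> \<open>The hypotheses give linearity in \<open>z\<close> for pure \<open>t\<close>
    only. Both sides of each linearity law are functionals in \<open>t\<close>, so
    \<open>functional_tensor_eq\<close> carries it to all \<open>t\<close>.\<close>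
  have l2: "linear_functional L (\<lambda>z. iprod N v (app (T z) t))" if t: "t \<in> carrier (H \<boxtimes> K)" and v: "v \<in> carrier N" for t v
  proof -
    have a: "iprod N v (app (T (z \<oplus>\<^bsub>L\<^esub> z')) t) = iprod N v (app (T z) t) + iprod N v (app (T z') t)"
      if z: "z \<in> carrier L" "z' \<in> carrier L" for z z'
    proof -
      interpret L: fd_hilbert_space L using sp spaces_hilbert by simp
      show ?thesis
      proof (rule functional_tensor_eq[OF l1 _ sp(1,2) _ t])
        show "linear_functional (H \<boxtimes> K) (\<lambda>t. iprod N v (app (T z) t) + iprod N v (app (T z') t))"
          using l1[OF z(1) v] l1[OF z(2) v] by (simp add: linear_functional_def distrib_left)
        fix x y assume "x \<in> carrier H" "y \<in> carrier K"
        thus "iprod N v (app (T (z \<oplus>\<^bsub>L\<^esub> z')) (pure M H K x y))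
          = iprod N v (app (T z) (pure M H K x y)) + iprod N v (app (T z') (pure M H K x y))"
          using 3[of x y v] z v by (simp add: T(2) linear_functional_def)
      qed (use z v in simp_all)
    qed
    have b: "iprod N v (app (T (c \<odot>\<^bsub>L\<^esub> z)) t) = c * iprod N v (app (T z) t)" if z: "z \<in> carrier L" for c z
    proof -
      interpret L: fd_hilbert_space L using sp spaces_hilbert by simp
      show ?thesis
      proof (rule functional_tensor_eq[OF l1 _ sp(1,2) _ t])
        show "linear_functional (H \<boxtimes> K) (\<lambda>t. c * iprod N v (app (T z) t))"
          using l1[OF z v] by (simp add: linear_functional_def distrib_left)
        fix x y assume "x \<in> carrier H" "y \<in> carrier K"
        thus "iprod N v (app (T (c \<odot>\<^bsub>L\<^esub> z)) (pure M H K x y)) = c * iprod N v (app (T z) (pure M H K x y))"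
          using 3[of x y v] z v by (simp add: T(2) linear_functional_def L.smult_in)
      qed (use z v in \<open>simp_all add: L.smult_in\<close>)
    qed
    show ?thesis using a b unfolding linear_functional_def by blast
  qed
  have "\<exists>S. arr S \<and> source S = H \<boxtimes> K \<boxtimes> L \<and> target S = N \<and>
      (\<forall>t\<in>carrier (H \<boxtimes> K). \<forall>z\<in>carrier L. app S (pure M (H \<boxtimes> K) L t z) = app (T z) t)"
    by (rule tensor_map_exists) (use sp T(1) l1 l2 in auto)
  thus ?thesis using T(2) sp by (metis pure_closed)
qed

text \<open>\<open>T\<close> is literally the description in \<open>tmap_def\<close>, so that
  folding this definition turns the conclusions into properties of \<open>tmap\<close>. Uniqueness
  is \<open>arr_tensor_ext\<close>.\<close>

lemma tensor_map_the:
  assumes "H \<in> spaces M" "K \<in> spaces M" "L \<in> spaces M"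
    and "\<exists>T. arr T \<and> source T = H \<boxtimes> K \<and> target T = L \<and>
      (\<forall>x\<in>carrier H. \<forall>y\<in>carrier K. app T (pure M H K x y) = B x y)"
  defines "T \<equiv> THE T. T \<in> linear_maps (H \<boxtimes> K) L \<and> (\<forall>x\<in>carrier H. \<forall>y\<in>carrier K. app T (pure M H K x y) = B x y)"
  shows "arr T" "source T = H \<boxtimes> K" "target T = L"
    "\<lbrakk>x \<in> carrier H; y \<in> carrier K\<rbrakk> \<Longrightarrow> app T (pure M H K x y) = B x y"
proof -
  obtain S where S: "arr S" "source S = H \<boxtimes> K" "target S = L"
    "\<forall>x\<in>carrier H. \<forall>y\<in>carrier K. app S (pure M H K x y) = B x y" using assms(4) by blast
  have "T = S"
    unfolding T_def
  proof (rule the_equality)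
    show "S \<in> linear_maps (H \<boxtimes> K) L \<and> (\<forall>x\<in>carrier H. \<forall>y\<in>carrier K. app S (pure M H K x y) = B x y)"
      using S arr_linear_maps by blast
    fix R assume R: "R \<in> linear_maps (H \<boxtimes> K) L \<and> (\<forall>x\<in>carrier H. \<forall>y\<in>carrier K. app R (pure M H K x y) = B x y)"
    show "R = S"
      by (rule arr_tensor_ext[where H = H and K = K])
         (use R S arrI[OF conjunct1[OF R]] assms(1-3) in auto)
  qed
  thus "arr T" "source T = H \<boxtimes> K" "target T = L"
    "\<lbrakk>x \<in> carrier H; y \<in> carrier K\<rbrakk> \<Longrightarrow> app T (pure M H K x y) = B x y"
    using S by auto
qed

lemma tensor3_map_the:
  assumes "H \<in> spaces M" "K \<in> spaces M" "L \<in> spaces M" "N \<in> spaces M"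
    and "\<exists>T. arr T \<and> source T = H \<boxtimes> K \<boxtimes> L \<and> target T = N \<and>
      (\<forall>x\<in>carrier H. \<forall>y\<in>carrier K. \<forall>z\<in>carrier L. app T (pure M (H \<boxtimes> K) L (pure M H K x y) z) = B x y z)"
  defines "T \<equiv> THE T. T \<in> linear_maps (H \<boxtimes> K \<boxtimes> L) N \<and>
    (\<forall>x\<in>carrier H. \<forall>y\<in>carrier K. \<forall>z\<in>carrier L. app T (pure M (H \<boxtimes> K) L (pure M H K x y) z) = B x y z)"
  shows "arr T" "source T = H \<boxtimes> K \<boxtimes> L" "target T = N"
    "\<lbrakk>x \<in> carrier H; y \<in> carrier K; z \<in> carrier L\<rbrakk> \<Longrightarrow> app T (pure M (H \<boxtimes> K) L (pure M H K x y) z) = B x y z"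
proof -
  let ?P = "\<lambda>S. \<forall>x\<in>carrier H. \<forall>y\<in>carrier K. \<forall>z\<in>carrier L. app S (pure M (H \<boxtimes> K) L (pure M H K x y) z) = B x y z"
  obtain S where S: "arr S" "source S = H \<boxtimes> K \<boxtimes> L" "target S = N" "?P S" using assms(5) by blast
  have "T = S"
    unfolding T_def
  proof (rule the_equality)
    show "S \<in> linear_maps (H \<boxtimes> K \<boxtimes> L) N \<and> ?P S"
      using S arr_linear_maps by blast
    fix R assume R: "R \<in> linear_maps (H \<boxtimes> K \<boxtimes> L) N \<and> ?P R"
    show "R = S"
      by (rule arr_tensor3_ext[where H = H and K = K and L = L])
         (use R S arrI[OF conjunct1[OF R]] assms(1-4) in auto)
  qed
  thus "arr T" "source T = H \<boxtimes> K \<boxtimes> L" "target T = N"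
    "\<lbrakk>x \<in> carrier H; y \<in> carrier K; z \<in> carrier L\<rbrakk> \<Longrightarrow> app T (pure M (H \<boxtimes> K) L (pure M H K x y) z) = B x y z"
    using S by auto
qed

subsection \<open>Structure maps\<close>

lemma tmap_props:
  assumes f: "arr f" and g: "arr g"
  shows arr_tmap [simp]: "arr (f \<otimes> g)" and source_tmap [simp]: "source (f \<otimes> g) = source f \<boxtimes> source g"
    and target_tmap [simp]: "target (f \<otimes> g) = target f \<boxtimes> target g"
    and app_tmap': "\<lbrakk>x \<in> carrier (source f); y \<in> carrier (source g)\<rbrakk> \<Longrightarrow>
      app (f \<otimes> g) (pure M (source f) (source g) x y) = pure M (target f) (target g) (app f x) (app g y)"
proof -
  have "\<exists>T. arr T \<and> source T = source f \<boxtimes> source g \<and> target T = target f \<boxtimes> target g \<and>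
      (\<forall>x\<in>carrier (source f). \<forall>y\<in>carrier (source g).
        app T (pure M (source f) (source g) x y) = pure M (target f) (target g) (app f x) (app g y))"
  proof (rule tensor_map_exists)
    show "linear_functional (source f) (\<lambda>x. iprod (target f \<boxtimes> target g) z (pure M (target f) (target g) (app f x) (app g y)))"
      if "y \<in> carrier (source g)" "z \<in> carrier (target f \<boxtimes> target g)" for y z
      by (rule functional_app[OF functional_pure_left[OF functional_iprod] f refl refl])
         (use f g that in auto)
    show "linear_functional (source g) (\<lambda>y. iprod (target f \<boxtimes> target g) z (pure M (target f) (target g) (app f x) (app g y)))"
      if "x \<in> carrier (source f)" "z \<in> carrier (target f \<boxtimes> target g)" for x z
      by (rule functional_app[OF functional_pure_right[OF functional_iprod] g refl refl])
         (use f g that in auto)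
  qed (use f g in auto)
  note * = tensor_map_the[OF _ _ _ this, folded tmap_def]
  show "arr (f \<otimes> g)" "source (f \<otimes> g) = source f \<boxtimes> source g" "target (f \<otimes> g) = target f \<boxtimes> target g"
    "\<lbrakk>x \<in> carrier (source f); y \<in> carrier (source g)\<rbrakk> \<Longrightarrow>
      app (f \<otimes> g) (pure M (source f) (source g) x y) = pure M (target f) (target g) (app f x) (app g y)"
    using * f g by simp_all
qed

lemma app_tmap [simp]:
  "\<lbrakk>arr f; arr g; source f = H; source g = K; x \<in> carrier H; y \<in> carrier K\<rbrakk> \<Longrightarrow>
    app (f \<otimes> g) (pure M H K x y) = pure M (target f) (target g) (app f x) (app g y)"
  using app_tmap' by blast

lemma adjoint_tmap: "\<lbrakk>arr f; arr g\<rbrakk> \<Longrightarrow> (f \<otimes> g)\<^sup>\<dagger> = f\<^sup>\<dagger> \<otimes> g\<^sup>\<dagger>"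
proof (rule arr_tensor_ext[of _ _ "target f" "target g"], simp_all)
  fix x y assume f: "arr f" and g: "arr g" and x: "x \<in> carrier (target f)" and y: "y \<in> carrier (target g)"
  show "app ((f \<otimes> g)\<^sup>\<dagger>) (pure M (target f) (target g) x y) =
    pure M (source f) (source g) (app (f\<^sup>\<dagger>) x) (app (g\<^sup>\<dagger>) y)"
    by (rule tensor_iprod_eqI[of "source f" "source g"]) (use f g x y in \<open>auto simp: iprod_adjoint' pure_iprod\<close>)
qed

lemma tmap_comp: "\<lbrakk>arr f; arr g; arr f'; arr g'; source f' = target f; source g' = target g\<rbrakk> \<Longrightarrow>
    (f' \<otimes> g') \<cdot> (f \<otimes> g) = (f' \<cdot> f) \<otimes> (g' \<cdot> g)"
  by (rule arr_tensor_ext[of _ _ "source f" "source g"]) simp_all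

lemma tmap_lid: "\<lbrakk>H \<in> spaces M; K \<in> spaces M\<rbrakk> \<Longrightarrow> lid H \<otimes> lid K = lid (H \<boxtimes> K)"
  by (rule arr_tensor_ext[of _ _ H K]) simp_all

lemma assoc_props:
  assumes sp: "H \<in> spaces M" "K \<in> spaces M" "L \<in> spaces M"
  shows arr_assoc [simp]: "arr (assoc M H K L)" and source_assoc [simp]: "source (assoc M H K L) = H \<boxtimes> K \<boxtimes> L"
    and target_assoc [simp]: "target (assoc M H K L) = H \<boxtimes> (K \<boxtimes> L)"
    and app_assoc [simp]: "\<lbrakk>x \<in> carrier H; y \<in> carrier K; z \<in> carrier L\<rbrakk> \<Longrightarrow>
      app (assoc M H K L) (pure M (H \<boxtimes> K) L (pure M H K x y) z) = pure M H (K \<boxtimes> L) x (pure M K L y z)"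
proof -
  have "\<exists>T. arr T \<and> source T = H \<boxtimes> K \<boxtimes> L \<and> target T = H \<boxtimes> (K \<boxtimes> L) \<and>
      (\<forall>x\<in>carrier H. \<forall>y\<in>carrier K. \<forall>z\<in>carrier L.
        app T (pure M (H \<boxtimes> K) L (pure M H K x y) z) = pure M H (K \<boxtimes> L) x (pure M K L y z))"
  proof (rule tensor3_map_exists)
    show "linear_functional H (\<lambda>x. iprod (H \<boxtimes> (K \<boxtimes> L)) v (pure M H (K \<boxtimes> L) x (pure M K L y z)))"
      if "y \<in> carrier K" "z \<in> carrier L" "v \<in> carrier (H \<boxtimes> (K \<boxtimes> L))" for y z v
      by (rule functional_pure_left[OF functional_iprod]) (use sp that in auto)
    show "linear_functional K (\<lambda>y. iprod (H \<boxtimes> (K \<boxtimes> L)) v (pure M H (K \<boxtimes> L) x (pure M K L y z)))"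
      if "x \<in> carrier H" "z \<in> carrier L" "v \<in> carrier (H \<boxtimes> (K \<boxtimes> L))" for x z v
      by (rule functional_pure_left[OF functional_pure_right[OF functional_iprod]]) (use sp that in auto)
    show "linear_functional L (\<lambda>z. iprod (H \<boxtimes> (K \<boxtimes> L)) v (pure M H (K \<boxtimes> L) x (pure M K L y z)))"
      if "x \<in> carrier H" "y \<in> carrier K" "v \<in> carrier (H \<boxtimes> (K \<boxtimes> L))" for x y v
      by (rule functional_pure_right[OF functional_pure_right[OF functional_iprod]]) (use sp that in auto)
  qed (use sp in auto)
  note * = tensor3_map_the[OF _ _ _ _ this, folded assoc_def]
  show "arr (assoc M H K L)" "source (assoc M H K L) = H \<boxtimes> K \<boxtimes> L" "target (assoc M H K L) = H \<boxtimes> (K \<boxtimes> L)"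
    "\<lbrakk>x \<in> carrier H; y \<in> carrier K; z \<in> carrier L\<rbrakk> \<Longrightarrow>
      app (assoc M H K L) (pure M (H \<boxtimes> K) L (pure M H K x y) z) = pure M H (K \<boxtimes> L) x (pure M K L y z)"
    using * sp by simp_all
qed

text \<open>Inner products of pure triples are products of three numbers in either bracketing. The
  adjoint therefore has the same matrix elements as rebracketing backwards.\<close>

lemma app_adjoint_assoc:
  assumes sp: "H \<in> spaces M" "K \<in> spaces M" "L \<in> spaces M" and v: "x \<in> carrier H" "y \<in> carrier K" "z \<in> carrier L"
  shows "app ((assoc M H K L)\<^sup>\<dagger>) (pure M H (K \<boxtimes> L) x (pure M K L y z)) = pure M (H \<boxtimes> K) L (pure M H K x y) z"
  by (rule tensor3_iprod_eqI[of H K L]) (use assms in \<open>simp_all add: iprod_adjoint' pure_iprod\<close>)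

lemma arr_tensor3_ext':
  assumes fg: "arr f" "arr g" "target f = target g" "source f = H \<boxtimes> (K \<boxtimes> L)" "source g = H \<boxtimes> (K \<boxtimes> L)"
    and sp: "H \<in> spaces M" "K \<in> spaces M" "L \<in> spaces M"
    and eq: "\<And>x y z. \<lbrakk>x \<in> carrier H; y \<in> carrier K; z \<in> carrier L\<rbrakk> \<Longrightarrow>
      app f (pure M H (K \<boxtimes> L) x (pure M K L y z)) = app g (pure M H (K \<boxtimes> L) x (pure M K L y z))"
  shows "f = g"
proof (rule arr_tensor_ext[OF fg sp(1)])
  fix x t assume x: "x \<in> carrier H" and t: "t \<in> carrier (K \<boxtimes> L)"
  show "app f (pure M H (K \<boxtimes> L) x t) = app g (pure M H (K \<boxtimes> L) x t)"
  proof (rule iprod_eqI[of "target g"])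
    fix w assume w: "w \<in> carrier (target g)"
    show "iprod (target g) w (app f (pure M H (K \<boxtimes> L) x t)) = iprod (target g) w (app g (pure M H (K \<boxtimes> L) x t))"
      by (rule functional_tensor_eq[of K L "\<lambda>t. iprod (target g) w (app f (pure M H (K \<boxtimes> L) x t))"
           "\<lambda>t. iprod (target g) w (app g (pure M H (K \<boxtimes> L) x t))", OF _ _ sp(2,3) _ t])
         (use assms w x in \<open>auto intro!: functional_pure_right[OF functional_app[OF functional_iprod]]\<close>)
  qed (use assms x t in auto)
qed (use sp in auto)

text \<open>As a rewrite rule this removes \<open>assoc_inv\<close> from the axioms, leaving
  associators and adjoints only.\<close>

lemma assoc_inv_eq [simp]:
  assumes sp: "H \<in> spaces M" "K \<in> spaces M" "L \<in> spaces M"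
  shows "assoc_inv M H K L = (assoc M H K L)\<^sup>\<dagger>"
  unfolding assoc_inv_def
proof (rule the_equality)
  show "(assoc M H K L)\<^sup>\<dagger> \<in> linear_maps (H \<boxtimes> (K \<boxtimes> L)) (H \<boxtimes> K \<boxtimes> L) \<and> (\<forall>x\<in>carrier H. \<forall>y\<in>carrier K. \<forall>z\<in>carrier L.
     app ((assoc M H K L)\<^sup>\<dagger>) (pure M H (K \<boxtimes> L) x (pure M K L y z)) = pure M (H \<boxtimes> K) L (pure M H K x y) z)"
    using sp app_adjoint_assoc by (auto intro!: arr_linear_maps)
  fix R assume R: "R \<in> linear_maps (H \<boxtimes> (K \<boxtimes> L)) (H \<boxtimes> K \<boxtimes> L) \<and> (\<forall>x\<in>carrier H. \<forall>y\<in>carrier K. \<forall>z\<in>carrier L.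
     app R (pure M H (K \<boxtimes> L) x (pure M K L y z)) = pure M (H \<boxtimes> K) L (pure M H K x y) z)"
  show "R = (assoc M H K L)\<^sup>\<dagger>"
    by (rule arr_tensor3_ext'[of _ _ H K L])
       (use R arrI[OF conjunct1[OF R]] sp in \<open>simp_all add: app_adjoint_assoc\<close>)
qed

lemma assoc_unitary:
  assumes sp: "H \<in> spaces M" "K \<in> spaces M" "L \<in> spaces M"
  shows "(assoc M H K L)\<^sup>\<dagger> \<cdot> assoc M H K L = lid (H \<boxtimes> K \<boxtimes> L)"
    and "assoc M H K L \<cdot> (assoc M H K L)\<^sup>\<dagger> = lid (H \<boxtimes> (K \<boxtimes> L))"
proof -
  show "(assoc M H K L)\<^sup>\<dagger> \<cdot> assoc M H K L = lid (H \<boxtimes> K \<boxtimes> L)"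
    by (rule arr_tensor3_ext[of _ _ H K L]) (use sp in \<open>simp_all add: app_adjoint_assoc\<close>)
  show "assoc M H K L \<cdot> (assoc M H K L)\<^sup>\<dagger> = lid (H \<boxtimes> (K \<boxtimes> L))"
    by (rule arr_tensor3_ext'[of _ _ H K L]) (use sp in \<open>simp_all add: app_adjoint_assoc\<close>)
qed

section \<open>The scalars and the unitors\<close>

text \<open>Both sides are linear in \<open>t\<close>. They agree at \<open>t = unit_vec M\<close>
  because its norm is one, and this vector spans the space.\<close>

lemma frame_scalars: "frame \<I> {()} (\<lambda>_. unit_vec M)"
proof -
  have "iprod \<I> s t = iprod \<I> (unit_vec M) t * iprod \<I> s (unit_vec M)"
    if s: "s \<in> carrier \<I>" and t: "t \<in> carrier \<I>" for s t
    by (rule fd_hilbert_space.linear_functional_eq[OF spaces_hilbert _ _ unit_vec_span _ t])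
       (use functional_iprod[of \<I> "unit_vec M"] functional_iprod[of \<I> s] s in
         \<open>auto simp: linear_functional_def distrib_right\<close>)
  hence "iprod \<I> s t = (\<Sum>i\<in>{()}. iprod \<I> s (unit_vec M) * iprod \<I> (unit_vec M) t)"
    if "s \<in> carrier \<I>" "t \<in> carrier \<I>" for s t
    by (simp only: that mult.commute sum.insert finite.emptyI sum.empty empty_iff add_0_right if_False not_False_eq_True)
  thus ?thesis unfolding frame_def using unit_vec_closed by (intro conjI ballI) (blast | rule finite.intros)+
qed

lemma smult_in [simp]: "\<lbrakk>H \<in> spaces M; x \<in> carrier H\<rbrakk> \<Longrightarrow> c \<odot>\<^bsub>H\<^esub> x \<in> carrier H"
  by (rule fd_hilbert_space.smult_in[OF spaces_hilbert])

lemma smult_one' [simp]: "\<lbrakk>H \<in> spaces M; x \<in> carrier H\<rbrakk> \<Longrightarrow> 1 \<odot>\<^bsub>H\<^esub> x = x"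
  using module.smult_one[of complex_field H x] spaces_hilbert[of H] by (simp add: fd_hilbert_space_def)

lemma iprod_smult_right [simp]:
  "\<lbrakk>H \<in> spaces M; x \<in> carrier H; y \<in> carrier H\<rbrakk> \<Longrightarrow> iprod H x (c \<odot>\<^bsub>H\<^esub> y) = c * iprod H x y"
  by (rule fd_hilbert_space.iprod_smult[OF spaces_hilbert])

lemma iprod_smult_left [simp]:
  "\<lbrakk>H \<in> spaces M; x \<in> carrier H; y \<in> carrier H\<rbrakk> \<Longrightarrow> iprod H (c \<odot>\<^bsub>H\<^esub> x) y = cnj c * iprod H x y"
  by (rule fd_hilbert_space.iprod_smult_left[OF spaces_hilbert])

lemma app_smult:
  "\<lbrakk>arr f; source f = H; x \<in> carrier H\<rbrakk> \<Longrightarrow> app f (c \<odot>\<^bsub>H\<^esub> x) = c \<odot>\<^bsub>target f\<^esub> app f x"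
  by (rule linear_maps_smult[OF arr_linear_maps]) auto

lemma scalar_expand:
  assumes "s \<in> carrier \<I>"
  shows "iprod \<I> (unit_vec M) s \<odot>\<^bsub>\<I>\<^esub> unit_vec M = s"
proof (rule iprod_eqI[of \<I>])
  fix z assume "z \<in> carrier \<I>"
  thus "iprod \<I> z (iprod \<I> (unit_vec M) s \<odot>\<^bsub>\<I>\<^esub> unit_vec M) = iprod \<I> z s"
    using frame_iprod[OF frame_scalars, of z s] assms by (simp add: mult.commute)
qed (use assms in auto)

lemma functional_smult_left:
  "\<lbrakk>L \<in> spaces M; H \<in> spaces M; linear_functional L \<phi>; x \<in> carrier H; z \<in> carrier H\<rbrakk> \<Longrightarrow>
    linear_functional L (\<lambda>s. iprod H z (\<phi> s \<odot>\<^bsub>H\<^esub> x))"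
  by (auto simp: linear_functional_def distrib_right mult.assoc)

lemma functional_smult_right:
  "\<lbrakk>H \<in> spaces M; z \<in> carrier H\<rbrakk> \<Longrightarrow> linear_functional H (\<lambda>x. iprod H z (c \<odot>\<^bsub>H\<^esub> x))"
proof -
  assume H: "H \<in> spaces M" and z: "z \<in> carrier H"
  then interpret H: fd_hilbert_space H by (simp add: spaces_hilbert)
  show ?thesis
    unfolding linear_functional_def
  proof (intro conjI ballI allI)
    show "iprod H z (c \<odot>\<^bsub>H\<^esub> (x \<oplus>\<^bsub>H\<^esub> y)) = iprod H z (c \<odot>\<^bsub>H\<^esub> x) + iprod H z (c \<odot>\<^bsub>H\<^esub> y)"
      if "x \<in> carrier H" "y \<in> carrier H" for x y
      using that z by (simp add: H.iprod_smult H.iprod_add distrib_left)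
    show "iprod H z (c \<odot>\<^bsub>H\<^esub> (d \<odot>\<^bsub>H\<^esub> x)) = d * iprod H z (c \<odot>\<^bsub>H\<^esub> x)"
      if "x \<in> carrier H" for x d
      using that z by (simp add: H.iprod_smult H.smult_in)
  qed
qed

text \<open>Every pure tensor with first factor in \<open>\<I>\<close> is a multiple of one whose
  first factor is the unit vector. This is why the description in \<open>lunit_def\<close>
  determines a unique map.\<close>

lemma lunit_ext:
  assumes "arr f" "arr g" "source f = \<I> \<boxtimes> H" "source g = \<I> \<boxtimes> H" "target f = target g" "H \<in> spaces M"
    and eq: "\<And>x. x \<in> carrier H \<Longrightarrow> app f (pure M \<I> H (unit_vec M) x) = app g (pure M \<I> H (unit_vec M) x)"
  shows "f = g"
proof (rule arr_tensor_ext[of _ _ \<I> H])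
  fix s x assume s: "s \<in> carrier \<I>" and x: "x \<in> carrier H"
  have p: "pure M \<I> H s x = iprod \<I> (unit_vec M) s \<odot>\<^bsub>\<I> \<boxtimes> H\<^esub> pure M \<I> H (unit_vec M) x"
    using pure_smult_left[of \<I> H "unit_vec M" x "iprod \<I> (unit_vec M) s"] assms(6) s x
    by (simp add: scalar_expand)
  show "app f (pure M \<I> H s x) = app g (pure M \<I> H s x)"
    using assms x by (simp add: p app_smult eq)
qed (use assms in auto)

lemma runit_ext:
  assumes "arr f" "arr g" "source f = H \<boxtimes> \<I>" "source g = H \<boxtimes> \<I>" "target f = target g" "H \<in> spaces M"
    and eq: "\<And>x. x \<in> carrier H \<Longrightarrow> app f (pure M H \<I> x (unit_vec M)) = app g (pure M H \<I> x (unit_vec M))"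
  shows "f = g"
proof (rule arr_tensor_ext[of _ _ H \<I>])
  fix x s assume s: "s \<in> carrier \<I>" and x: "x \<in> carrier H"
  have p: "pure M H \<I> x s = iprod \<I> (unit_vec M) s \<odot>\<^bsub>H \<boxtimes> \<I>\<^esub> pure M H \<I> x (unit_vec M)"
    using pure_smult_right[of H \<I> x "unit_vec M" "iprod \<I> (unit_vec M) s"] assms(6) s x
    by (simp add: scalar_expand)
  show "app f (pure M H \<I> x s) = app g (pure M H \<I> x s)"
    using assms x by (simp add: p app_smult eq)
qed (use assms in auto)

lemma lunit_props:
  assumes sp: "H \<in> spaces M"
  shows arr_lunit [simp]: "arr (lunit M H)" and source_lunit [simp]: "source (lunit M H) = \<I> \<boxtimes> H"
    and target_lunit [simp]: "target (lunit M H) = H"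
    and app_lunit [simp]: "\<lbrakk>s \<in> carrier \<I>; x \<in> carrier H\<rbrakk> \<Longrightarrow>
      app (lunit M H) (pure M \<I> H s x) = iprod \<I> (unit_vec M) s \<odot>\<^bsub>H\<^esub> x"
proof -
  \<comment> \<open>A vector \<open>s\<close> of \<open>\<I>\<close> is read as the number
    \<open>iprod \<I> (unit_vec M) s\<close>; this extends the prescription at the unit vector to a
    bilinear one.\<close>
  have "\<exists>T. arr T \<and> source T = \<I> \<boxtimes> H \<and> target T = H \<and>
      (\<forall>s\<in>carrier \<I>. \<forall>x\<in>carrier H. app T (pure M \<I> H s x) = iprod \<I> (unit_vec M) s \<odot>\<^bsub>H\<^esub> x)"
    by (rule tensor_map_exists) (use sp in \<open>auto intro!: functional_smult_left functional_smult_right simp del: iprod_smult_right\<close>)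
  then obtain T where T: "arr T" "source T = \<I> \<boxtimes> H" "target T = H"
    "\<And>s x. \<lbrakk>s \<in> carrier \<I>; x \<in> carrier H\<rbrakk> \<Longrightarrow> app T (pure M \<I> H s x) = iprod \<I> (unit_vec M) s \<odot>\<^bsub>H\<^esub> x"
    by blast
  have "lunit M H = T"
    unfolding lunit_def
  proof (rule the_equality)
    show "T \<in> linear_maps (\<I> \<boxtimes> H) H \<and> (\<forall>x\<in>carrier H. app T (pure M \<I> H (unit_vec M) x) = x)"
      using T sp by (simp add: arr_linear_maps)
    fix R assume R: "R \<in> linear_maps (\<I> \<boxtimes> H) H \<and> (\<forall>x\<in>carrier H. app R (pure M \<I> H (unit_vec M) x) = x)"
    show "R = T"
      by (rule lunit_ext[of _ _ H]) (use R arrI[OF conjunct1[OF R]] T sp in simp_all)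
  qed
  thus "arr (lunit M H)" "source (lunit M H) = \<I> \<boxtimes> H" "target (lunit M H) = H"
    "\<lbrakk>s \<in> carrier \<I>; x \<in> carrier H\<rbrakk> \<Longrightarrow>
      app (lunit M H) (pure M \<I> H s x) = iprod \<I> (unit_vec M) s \<odot>\<^bsub>H\<^esub> x"
    using T by simp_all
qed

lemma runit_props:
  assumes sp: "H \<in> spaces M"
  shows arr_runit [simp]: "arr (runit M H)" and source_runit [simp]: "source (runit M H) = H \<boxtimes> \<I>"
    and target_runit [simp]: "target (runit M H) = H"
    and app_runit [simp]: "\<lbrakk>x \<in> carrier H; s \<in> carrier \<I>\<rbrakk> \<Longrightarrow>
      app (runit M H) (pure M H \<I> x s) = iprod \<I> (unit_vec M) s \<odot>\<^bsub>H\<^esub> x"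
proof -
  have "\<exists>T. arr T \<and> source T = H \<boxtimes> \<I> \<and> target T = H \<and>
      (\<forall>x\<in>carrier H. \<forall>s\<in>carrier \<I>. app T (pure M H \<I> x s) = iprod \<I> (unit_vec M) s \<odot>\<^bsub>H\<^esub> x)"
    by (rule tensor_map_exists) (use sp in \<open>auto intro!: functional_smult_left functional_smult_right simp del: iprod_smult_right\<close>)
  then obtain T where T: "arr T" "source T = H \<boxtimes> \<I>" "target T = H"
    "\<And>s x. \<lbrakk>s \<in> carrier \<I>; x \<in> carrier H\<rbrakk> \<Longrightarrow> app T (pure M H \<I> x s) = iprod \<I> (unit_vec M) s \<odot>\<^bsub>H\<^esub> x"
    by blast
  have "runit M H = T"
    unfolding runit_def
  proof (rule the_equality)
    show "T \<in> linear_maps (H \<boxtimes> \<I>) H \<and> (\<forall>x\<in>carrier H. app T (pure M H \<I> x (unit_vec M)) = x)"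
      using T sp by (simp add: arr_linear_maps)
    fix R assume R: "R \<in> linear_maps (H \<boxtimes> \<I>) H \<and> (\<forall>x\<in>carrier H. app R (pure M H \<I> x (unit_vec M)) = x)"
    show "R = T"
      by (rule runit_ext[of _ _ H]) (use R arrI[OF conjunct1[OF R]] T sp in simp_all)
  qed
  thus "arr (runit M H)" "source (runit M H) = H \<boxtimes> \<I>" "target (runit M H) = H"
    "\<lbrakk>x \<in> carrier H; s \<in> carrier \<I>\<rbrakk> \<Longrightarrow>
      app (runit M H) (pure M H \<I> x s) = iprod \<I> (unit_vec M) s \<odot>\<^bsub>H\<^esub> x"
    using T by simp_all
qed

lemma app_adjoint_lunit:
  "\<lbrakk>H \<in> spaces M; x \<in> carrier H\<rbrakk> \<Longrightarrow> app ((lunit M H)\<^sup>\<dagger>) x = pure M \<I> H (unit_vec M) x"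
  by (rule tensor_iprod_eqI[of \<I> H]) (simp_all add: iprod_adjoint' pure_iprod iprod_cnj')

lemma app_adjoint_runit:
  "\<lbrakk>H \<in> spaces M; x \<in> carrier H\<rbrakk> \<Longrightarrow> app ((runit M H)\<^sup>\<dagger>) x = pure M H \<I> x (unit_vec M)"
  by (rule tensor_iprod_eqI[of H \<I>]) (simp_all add: iprod_adjoint' pure_iprod iprod_cnj')

text \<open>\<open>runit_inv\<close> is an explicit restricted function while the adjoint is a
  description. Both are extensional, so agreement on the carrier gives equality of the
  records.\<close>

lemma runit_inv_eq [simp]:
  assumes "H \<in> spaces M"
  shows "runit_inv M H = (runit M H)\<^sup>\<dagger>"
proof -
  have "app ((runit M H)\<^sup>\<dagger>) \<in> extensional (carrier H)"
    using arr_linear_maps[of "(runit M H)\<^sup>\<dagger>" H] assms by (simp add: linear_maps_def PiE_def)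
  hence "app ((runit M H)\<^sup>\<dagger>) = app (runit_inv M H)"
    by (intro extensionalityI[of _ "carrier H"]) (use assms in \<open>simp_all add: runit_inv_def app_adjoint_runit\<close>)
  thus ?thesis using assms by (simp add: runit_inv_def)
qed

lemma lunit_unitary:
  assumes "H \<in> spaces M"
  shows "(lunit M H)\<^sup>\<dagger> \<cdot> lunit M H = lid (\<I> \<boxtimes> H)" and "lunit M H \<cdot> (lunit M H)\<^sup>\<dagger> = lid H"
proof -
  show "(lunit M H)\<^sup>\<dagger> \<cdot> lunit M H = lid (\<I> \<boxtimes> H)"
    by (rule lunit_ext[of _ _ H]) (use assms in \<open>simp_all add: app_adjoint_lunit\<close>)
  show "lunit M H \<cdot> (lunit M H)\<^sup>\<dagger> = lid H"
    by (rule arr_ext) (use assms in \<open>simp_all add: app_adjoint_lunit\<close>)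
qed

lemma runit_unitary:
  assumes "H \<in> spaces M"
  shows "(runit M H)\<^sup>\<dagger> \<cdot> runit M H = lid (H \<boxtimes> \<I>)" and "runit M H \<cdot> (runit M H)\<^sup>\<dagger> = lid H"
proof -
  show "(runit M H)\<^sup>\<dagger> \<cdot> runit M H = lid (H \<boxtimes> \<I>)"
    by (rule runit_ext[of _ _ H]) (use assms in \<open>simp_all add: app_adjoint_runit\<close>)
  show "runit M H \<cdot> (runit M H)\<^sup>\<dagger> = lid H"
    by (rule arr_ext) (use assms in \<open>simp_all add: app_adjoint_runit\<close>)
qed

subsection \<open>Coherence\<close>

lemma assoc_natural:
  assumes "arr f" "arr g" "arr h"
  shows "assoc M (target h) (target g) (target f) \<cdot> (h \<otimes> g \<otimes> f) = (h \<otimes> (g \<otimes> f)) \<cdot> assoc M (source h) (source g) (source f)"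
  by (rule arr_tensor3_ext[of _ _ "source h" "source g" "source f"]) (use assms in simp_all)

lemma lunit_natural:
  assumes "arr f"
  shows "lunit M (target f) \<cdot> (lid \<I> \<otimes> f) = f \<cdot> lunit M (source f)"
  by (rule lunit_ext[of _ _ "source f"]) (use assms in simp_all)

lemma runit_natural:
  assumes "arr f"
  shows "runit M (target f) \<cdot> (f \<otimes> lid \<I>) = f \<cdot> runit M (source f)"
  by (rule runit_ext[of _ _ "source f"]) (use assms in simp_all)

lemma tensor_triangle:
  assumes "H \<in> spaces M" "K \<in> spaces M"
  shows "(lid H \<otimes> lunit M K) \<cdot> assoc M H \<I> K = runit M H \<otimes> lid K"
  by (rule arr_tensor3_ext[of _ _ H \<I> K]) (use assms in \<open>simp_all add: pure_smult_left pure_smult_right\<close>)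

lemma tensor_pentagon:
  assumes sp: "H \<in> spaces M" "K \<in> spaces M" "L \<in> spaces M" "N \<in> spaces M"
  shows "assoc M H K (L \<boxtimes> N) \<cdot> assoc M (H \<boxtimes> K) L N =
    (lid H \<otimes> assoc M K L N) \<cdot> assoc M H (K \<boxtimes> L) N \<cdot> (assoc M H K L \<otimes> lid N)" (is "?f = ?g")
proof (rule arr_tensor_ext[of _ _ "H \<boxtimes> K \<boxtimes> L" N])
  fix t w assume t: "t \<in> carrier (H \<boxtimes> K \<boxtimes> L)" and w: "w \<in> carrier N"
  let ?T = "H \<boxtimes> (K \<boxtimes> (L \<boxtimes> N))"
  show "app ?f (pure M (H \<boxtimes> K \<boxtimes> L) N t w) = app ?g (pure M (H \<boxtimes> K \<boxtimes> L) N t w)"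
  proof (rule iprod_eqI[of ?T])
    fix v assume v: "v \<in> carrier ?T"
    \<comment> \<open>With the fourth factor fixed at \<open>w\<close>, the first three form a
      left-bracketed triple, and \<open>functional_tensor3_eq\<close> reduces the equation to pure
      quadruples.\<close>
    have l: "linear_functional (H \<boxtimes> K \<boxtimes> L) (\<lambda>t. iprod ?T v (app f (pure M (H \<boxtimes> K \<boxtimes> L) N t w)))"
      if "arr f" "source f = H \<boxtimes> K \<boxtimes> L \<boxtimes> N" "target f = ?T" for f
      by (rule functional_pure_left[OF functional_app[OF functional_iprod]]) (use that sp v w in simp_all)
    show "iprod ?T v (app ?f (pure M (H \<boxtimes> K \<boxtimes> L) N t w)) = iprod ?T v (app ?g (pure M (H \<boxtimes> K \<boxtimes> L) N t w))"
    proof (rule functional_tensor3_eq[of H K L, OF l l _ _ _ _ t])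
      fix x y z assume "x \<in> carrier H" "y \<in> carrier K" "z \<in> carrier L"
      thus "iprod ?T v (app ?f (pure M (H \<boxtimes> K \<boxtimes> L) N (pure M (H \<boxtimes> K) L (pure M H K x y) z) w)) =
        iprod ?T v (app ?g (pure M (H \<boxtimes> K \<boxtimes> L) N (pure M (H \<boxtimes> K) L (pure M H K x y) z) w))"
        using sp w by simp
    qed (use sp in simp_all)
  qed (use sp t w in simp_all)
qed (use sp in simp_all)

section \<open>Frame expansions inside matrix elements\<close>

lemma frame_expand2:
  assumes "frame H I e" "frame K J f" "H \<in> spaces M" "K \<in> spaces M" "linear_functional (H \<boxtimes> K) \<phi>"
    "t \<in> carrier (H \<boxtimes> K)"
  shows "\<phi> t = (\<Sum>i\<in>I. \<Sum>j\<in>J. iprod (H \<boxtimes> K) (pure M H K (e i) (f j)) t * \<phi> (pure M H K (e i) (f j)))"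
  using frame_expand[OF frame_tensor[OF assms(1-4)] _ assms(5,6)] assms(3,4)
  by (simp add: sum.cartesian_product case_prod_unfold)

text \<open>This is an expansion in the antilinear slot: \<open>frame_expand\<close> is applied with
  \<open>t\<close> on the left, and the result is conjugated.\<close>

lemma frame_contract_left:
  assumes e: "frame H I e" and sp: "H \<in> spaces M" "K \<in> spaces M"
    and v: "x \<in> carrier H" "y \<in> carrier K" "t \<in> carrier (H \<boxtimes> K)"
  shows "(\<Sum>i\<in>I. iprod H x (e i) * iprod (H \<boxtimes> K) (pure M H K (e i) y) t) = iprod (H \<boxtimes> K) (pure M H K x y) t"
proof -
  have "(\<Sum>i\<in>I. iprod H (e i) x * iprod (H \<boxtimes> K) t (pure M H K (e i) y)) = iprod (H \<boxtimes> K) t (pure M H K x y)"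
    by (rule frame_expand[OF e sp(1) functional_pure_left[OF functional_iprod]]) (use sp v in auto)
  from arg_cong[OF this, of cnj] show ?thesis
    using frame_closed[OF e] sp v by (simp add: iprod_cnj')
qed

lemma frame_contract_right:
  assumes f: "frame K J f" and sp: "H \<in> spaces M" "K \<in> spaces M"
    and v: "x \<in> carrier H" "y \<in> carrier K" "t \<in> carrier (H \<boxtimes> K)"
  shows "(\<Sum>j\<in>J. iprod K y (f j) * iprod (H \<boxtimes> K) (pure M H K x (f j)) t) = iprod (H \<boxtimes> K) (pure M H K x y) t"
proof -
  have "(\<Sum>j\<in>J. iprod K (f j) y * iprod (H \<boxtimes> K) t (pure M H K x (f j))) = iprod (H \<boxtimes> K) t (pure M H K x y)"
    by (rule frame_expand[OF f sp(2) functional_pure_right[OF functional_iprod]]) (use sp v in auto)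
  from arg_cong[OF this, of cnj] show ?thesis
    using frame_closed[OF f] sp v by (simp add: iprod_cnj')
qed

text \<open>A map acting on a vector that is not a pure tensor, such as the image under a
  \<open>qmap\<close>, is moved to the bra, where the vector is pure and the map can be
  evaluated.\<close>

lemma iprod_move:
  "\<lbrakk>arr f; target f = K; v \<in> carrier K; w \<in> carrier (source f)\<rbrakk> \<Longrightarrow>
    iprod K v (app f w) = iprod (source f) (app (f\<^sup>\<dagger>) v) w"
  by (rule iprod_adjoint[symmetric]) auto

subsection \<open>Quantum sets\<close>

definition qmul :: "'u qset \<Rightarrow> 'u \<Rightarrow> 'u \<Rightarrow> 'u" where
  "qmul A x y = app (qmult A) (pure M (space A) (space A) x y)"

definition qone :: "'u qset \<Rightarrow> 'u" where
  "qone A = app (qunit A) (unit_vec M)"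

definition qcup :: "'u qset \<Rightarrow> 'u" where
  "qcup A = app (\<Delta> A) (qone A)"

definition qcap :: "'u qset \<Rightarrow> 'u \<Rightarrow> 'u \<Rightarrow> complex" where
  "qcap A x y = iprod (space A) (qone A) (qmul A x y)"

lemma quantum_set_arr:
  assumes "quantum_set M A"
  shows "space A \<in> spaces M"
    "arr (qmult A)" "source (qmult A) = space A \<boxtimes> space A" "target (qmult A) = space A"
    "arr (qunit A)" "source (qunit A) = \<I>" "target (qunit A) = space A"
proof -
  show s: "space A \<in> spaces M" using assms by (simp add: quantum_set_def Let_def)
  have "qmult A \<in> linear_maps (space A \<boxtimes> space A) (space A)" "qunit A \<in> linear_maps \<I> (space A)"
    using assms by (simp_all add: quantum_set_def Let_def)
  from this[THEN arrI] s show "arr (qmult A)" "source (qmult A) = space A \<boxtimes> space A" "target (qmult A) = space A"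
    "arr (qunit A)" "source (qunit A) = \<I>" "target (qunit A) = space A" by auto
qed

lemma quantum_set_closed:
  assumes "quantum_set M A"
  shows "qone A \<in> carrier (space A)" "qcup A \<in> carrier (space A \<boxtimes> space A)"
    "\<lbrakk>x \<in> carrier (space A); y \<in> carrier (space A)\<rbrakk> \<Longrightarrow> qmul A x y \<in> carrier (space A)"
  using quantum_set_arr[OF assms] by (simp_all add: qone_def qcup_def qmul_def)

lemma quantum_set_unit:
  assumes A: "quantum_set M A" and x: "x \<in> carrier (space A)"
  shows "qmul A (qone A) x = x" "qmul A x (qone A) = x"
proof -
  note a = quantum_set_arr[OF A]
  have "qmult A \<cdot> (qunit A \<otimes> lid (space A)) = lunit M (space A)"
    "qmult A \<cdot> (lid (space A) \<otimes> qunit A) = runit M (space A)"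
    using A by (simp_all add: quantum_set_def Let_def)
  from this(1)[THEN arg_cong, of "\<lambda>f. app f (pure M \<I> (space A) (unit_vec M) x)"]
    this(2)[THEN arg_cong, of "\<lambda>f. app f (pure M (space A) \<I> x (unit_vec M))"]
  show "qmul A (qone A) x = x" "qmul A x (qone A) = x"
    using a x by (simp_all add: qmul_def qone_def)
qed

lemma comult_unit_pairing:
  assumes A: "quantum_set M A" and v: "x \<in> carrier (space A)" "y \<in> carrier (space A)" "z \<in> carrier (space A)" "w \<in> carrier (space A)"
  shows "iprod (space A \<boxtimes> space A) (pure M (space A) (space A) x y) (app (\<Delta> A) (qmul A z w))
      = iprod (space A) (qmul A x y) (qmul A z w)"
  using quantum_set_arr[OF A] quantum_set_closed(3)[OF A] v by (simp add: iprod_adjoint' qmul_def)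

text \<open>Evaluate the Frobenius equation for
  \<open>(id \<otimes> m) (\<Delta> \<otimes> id)\<close> at \<open>qone A\<close> \<otimes>
  \<open>y\<close> and pair it with \<open>x\<close> \<otimes> \<open>qone A\<close>. The side
  \<open>\<Delta> m\<close> gives \<open>iprod\<close> of \<open>x\<close> and \<open>y\<close> by
  the unit laws. On the other side the cup appears, and resolving it in the frame gives the
  sum.\<close>

lemma snake1:
  assumes A: "quantum_set M A" and e: "frame (space A) I e" and x: "x \<in> carrier (space A)" and y: "y \<in> carrier (space A)"
  shows "(\<Sum>j\<in>I. iprod (space A \<boxtimes> space A) (pure M (space A) (space A) x (e j)) (qcup A) * qcap A (e j) y)
    = iprod (space A) x y"
proof -
  note a = quantum_set_arr[OF A] and b = quantum_set_closed[OF A]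
  let ?X = "space A" and ?i = "lid (space A)" and ?m = "qmult A"
  let ?R = "(?i \<otimes> ?m) \<cdot> assoc M ?X ?X ?X"
  let ?x1 = "pure M ?X ?X x (qone A)"
  define \<phi> where "\<phi> t = iprod (?X \<boxtimes> ?X) ?x1 (app ?R (pure M (?X \<boxtimes> ?X) ?X t y))" for t
  have l: "linear_functional (?X \<boxtimes> ?X) \<phi>"
    unfolding \<phi>_def
    by (rule functional_pure_left[OF functional_app[OF functional_iprod]]) (use a b x y in auto)
  have p: "\<phi> (pure M ?X ?X (e i) (e j)) = iprod ?X x (e i) * qcap A (e j) y" if "i \<in> I" "j \<in> I" for i j
    using frame_closed[OF e] that a b x y by (simp add: \<phi>_def qcap_def qmul_def pure_iprod)
  have "(?i \<otimes> ?m) \<cdot> assoc M ?X ?X ?X \<cdot> (\<Delta> A \<otimes> ?i) = \<Delta> A \<cdot> ?m"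
    using A by (simp add: quantum_set_def Let_def)
  from this[THEN arg_cong, of "\<lambda>f. iprod (?X \<boxtimes> ?X) ?x1 (app f (pure M ?X ?X (qone A) y))"]
  have "iprod ?X x y = \<phi> (qcup A)"
    using a b(1) x y comult_unit_pairing[OF A x b(1) b(1) y, unfolded qmul_def]
      quantum_set_unit[OF A, unfolded qmul_def] by (simp add: \<phi>_def qcup_def)
  also have "\<dots> = (\<Sum>i\<in>I. \<Sum>j\<in>I. iprod (?X \<boxtimes> ?X) (pure M ?X ?X (e i) (e j)) (qcup A) * \<phi> (pure M ?X ?X (e i) (e j)))"
    by (rule frame_expand2[OF e e a(1) a(1) l b(2)])
  also have "\<dots> = (\<Sum>i\<in>I. \<Sum>j\<in>I. iprod ?X x (e i) * iprod (?X \<boxtimes> ?X) (pure M ?X ?X (e i) (e j)) (qcup A) * qcap A (e j) y)"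
    by (intro sum.cong refl) (simp add: p)
  also have "\<dots> = (\<Sum>j\<in>I. iprod (?X \<boxtimes> ?X) (pure M ?X ?X x (e j)) (qcup A) * qcap A (e j) y)"
    by (subst sum.swap) (simp add: frame_contract_left[OF e a(1) a(1) x _ b(2)] frame_closed[OF e] flip: sum_distrib_right)
  finally show ?thesis ..
qed

text \<open>This mirrors \<open>snake1\<close>: the other Frobenius equation is evaluated at
  \<open>y\<close> \<otimes> \<open>qone A\<close> and paired with \<open>qone A\<close> \<otimes>
  \<open>x\<close>.\<close>

lemma snake2:
  assumes A: "quantum_set M A" and e: "frame (space A) I e" and x: "x \<in> carrier (space A)" and y: "y \<in> carrier (space A)"
  shows "(\<Sum>j\<in>I. iprod (space A \<boxtimes> space A) (pure M (space A) (space A) (e j) x) (qcup A) * qcap A y (e j))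
    = iprod (space A) x y"
proof -
  note a = quantum_set_arr[OF A] and b = quantum_set_closed[OF A]
  let ?X = "space A" and ?i = "lid (space A)" and ?m = "qmult A"
  let ?R = "(?m \<otimes> ?i) \<cdot> assoc_inv M ?X ?X ?X"
  let ?x1 = "pure M ?X ?X (qone A) x"
  define \<phi> where "\<phi> t = iprod (?X \<boxtimes> ?X) ?x1 (app ?R (pure M ?X (?X \<boxtimes> ?X) y t))" for t
  have l: "linear_functional (?X \<boxtimes> ?X) \<phi>"
    unfolding \<phi>_def
    by (rule functional_pure_right[OF functional_app[OF functional_iprod]]) (use a b x y in auto)
  have p: "\<phi> (pure M ?X ?X (e i) (e j)) = iprod ?X x (e j) * qcap A y (e i)" if "i \<in> I" "j \<in> I" for i j
    using frame_closed[OF e] that a b x y by (simp add: \<phi>_def qcap_def qmul_def pure_iprod app_adjoint_assoc)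
  have "(?m \<otimes> ?i) \<cdot> assoc_inv M ?X ?X ?X \<cdot> (?i \<otimes> \<Delta> A) = \<Delta> A \<cdot> ?m"
    using A unfolding quantum_set_def Let_def by blast
  from this[THEN arg_cong, of "\<lambda>f. iprod (?X \<boxtimes> ?X) ?x1 (app f (pure M ?X ?X y (qone A)))"]
  have "iprod ?X x y = \<phi> (qcup A)"
    using a b(1) x y comult_unit_pairing[OF A b(1) x y b(1), unfolded qmul_def]
      quantum_set_unit[OF A, unfolded qmul_def] by (simp add: \<phi>_def qcup_def)
  also have "\<dots> = (\<Sum>i\<in>I. \<Sum>j\<in>I. iprod (?X \<boxtimes> ?X) (pure M ?X ?X (e i) (e j)) (qcup A) * \<phi> (pure M ?X ?X (e i) (e j)))"
    by (rule frame_expand2[OF e e a(1) a(1) l b(2)])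
  also have "\<dots> = (\<Sum>i\<in>I. \<Sum>j\<in>I. iprod ?X x (e j) * iprod (?X \<boxtimes> ?X) (pure M ?X ?X (e i) (e j)) (qcup A) * qcap A y (e i))"
    by (intro sum.cong refl) (simp add: p)
  also have "\<dots> = (\<Sum>i\<in>I. iprod (?X \<boxtimes> ?X) (pure M ?X ?X (e i) x) (qcup A) * qcap A y (e i))"
    by (simp add: frame_contract_right[OF e a(1) a(1) _ x b(2)] frame_closed[OF e] flip: sum_distrib_right)
  finally show ?thesis ..
qed

subsection \<open>Matrix elements of quantum functions\<close>

text \<open>The data of a quantum function without its three equations. Matrix elements of a
  composite can thus be computed before it is known to be a quantum function.\<close>

definition typed :: "'u qfun \<Rightarrow> bool" where
  "typed F \<longleftrightarrow> quantum_set M (qdom F) \<and> quantum_set M (qcod F) \<and> qspace F \<in> spaces M \<and>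
     arr (qmap F) \<and> source (qmap F) = qspace F \<boxtimes> space (qdom F) \<and> target (qmap F) = space (qcod F) \<boxtimes> qspace F"

text \<open>Bra arguments come before ket arguments. The expression is antilinear in
  \<open>y\<close> and \<open>h'\<close> and linear in \<open>h\<close> and
  \<open>a\<close>.\<close>

definition mel :: "'u qfun \<Rightarrow> 'u \<Rightarrow> 'u \<Rightarrow> 'u \<Rightarrow> 'u \<Rightarrow> complex" where
  "mel F y h' h a = iprod (space (qcod F) \<boxtimes> qspace F) (pure M (space (qcod F)) (qspace F) y h')
     (app (qmap F) (pure M (qspace F) (space (qdom F)) h a))"

lemma frame_functional_eq:
  assumes g: "frame H S g" and sp: "H \<in> spaces M" and l: "linear_functional H \<phi>" "linear_functional H \<psi>"
    and eq: "\<And>s. s \<in> S \<Longrightarrow> \<phi> (g s) = \<psi> (g s)" and x: "x \<in> carrier H"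
  shows "\<phi> x = \<psi> x"
  using frame_expand[OF g sp l(1) x] frame_expand[OF g sp l(2) x] eq by simp

text \<open>The counterpart of \<open>frame_functional_eq\<close> for a slot in which the expression
  is antilinear.\<close>

lemma frame_ext_left:
  assumes e: "frame H I e" and sp: "H \<in> spaces M" "K \<in> spaces M"
    and v: "x \<in> carrier H" "y \<in> carrier K" "s \<in> carrier (H \<boxtimes> K)" "t \<in> carrier (H \<boxtimes> K)"
    and eq: "\<And>i. i \<in> I \<Longrightarrow> iprod (H \<boxtimes> K) (pure M H K (e i) y) s = iprod (H \<boxtimes> K) (pure M H K (e i) y) t"
  shows "iprod (H \<boxtimes> K) (pure M H K x y) s = iprod (H \<boxtimes> K) (pure M H K x y) t"
  using frame_contract_left[OF e sp v(1-3)] frame_contract_left[OF e sp v(1,2,4)] eq by simp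

lemma frame_ext_right:
  assumes f: "frame K J f" and sp: "H \<in> spaces M" "K \<in> spaces M"
    and v: "x \<in> carrier H" "y \<in> carrier K" "s \<in> carrier (H \<boxtimes> K)" "t \<in> carrier (H \<boxtimes> K)"
    and eq: "\<And>j. j \<in> J \<Longrightarrow> iprod (H \<boxtimes> K) (pure M H K x (f j)) s = iprod (H \<boxtimes> K) (pure M H K x (f j)) t"
  shows "iprod (H \<boxtimes> K) (pure M H K x y) s = iprod (H \<boxtimes> K) (pure M H K x y) t"
  using frame_contract_right[OF f sp v(1-3)] frame_contract_right[OF f sp v(1,2,4)] eq by simp

lemma typed_arr:
  assumes "typed F"
  shows "quantum_set M (qdom F)" "quantum_set M (qcod F)" "qspace F \<in> spaces M" "space (qdom F) \<in> spaces M"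
    "space (qcod F) \<in> spaces M" "arr (qmap F)" "source (qmap F) = qspace F \<boxtimes> space (qdom F)"
    "target (qmap F) = space (qcod F) \<boxtimes> qspace F"
  using assms quantum_set_arr(1) unfolding typed_def by simp_all

text \<open>
  The converse implications test frame vectors of \<open>qspace F\<close> only, because the matrix elements of a
  composite are accessible on pure tensors only.
\<close>

lemma qfun_cond1:
  assumes F: "typed F" and e: "frame (space (qdom F)) I e" and g: "frame (qspace F) S g"
  defines "A \<equiv> qdom F" and "B \<equiv> qcod F" and "H \<equiv> qspace F" and "P \<equiv> qmap F"
  defines "X \<equiv> space A" and "Y \<equiv> space B"
  shows "(\<Delta> B \<otimes> lid H) \<cdot> P
       = assoc_inv M Y Y H \<cdot> (lid Y \<otimes> P) \<cdot> assoc M Y H X \<cdot> (P \<otimes> lid X) \<cdot> assoc_inv M H X X \<cdot> (lid H \<otimes> \<Delta> A)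
    \<Longrightarrow> \<forall>y1\<in>carrier Y. \<forall>y2\<in>carrier Y. \<forall>h'\<in>carrier H. \<forall>h\<in>carrier H. \<forall>a\<in>carrier X.
      mel F (qmul B y1 y2) h' h a = (\<Sum>i\<in>I. \<Sum>j\<in>I. iprod (X \<boxtimes> X) (pure M X X (e i) (e j)) (app (\<Delta> A) a) *
        (\<Sum>s\<in>S. mel F y2 h' (g s) (e j) * mel F y1 (g s) h (e i)))" (is "?l = ?r \<Longrightarrow> ?W")
    and "\<forall>y1\<in>carrier Y. \<forall>y2\<in>carrier Y. \<forall>q\<in>S. \<forall>r\<in>S. \<forall>a\<in>carrier X.
      mel F (qmul B y1 y2) (g q) (g r) a = (\<Sum>i\<in>I. \<Sum>j\<in>I. iprod (X \<boxtimes> X) (pure M X X (e i) (e j)) (app (\<Delta> A) a) *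
        (\<Sum>s\<in>S. mel F y2 (g q) (g s) (e j) * mel F y1 (g s) (g r) (e i)))
    \<Longrightarrow> (\<Delta> B \<otimes> lid H) \<cdot> P
       = assoc_inv M Y Y H \<cdot> (lid Y \<otimes> P) \<cdot> assoc M Y H X \<cdot> (P \<otimes> lid X) \<cdot> assoc_inv M H X X \<cdot> (lid H \<otimes> \<Delta> A)" (is "?W' \<Longrightarrow> _")
proof -
  note d = A_def B_def H_def P_def X_def Y_def
  have qA: "quantum_set M A" and qB: "quantum_set M B" and sp: "H \<in> spaces M" "X \<in> spaces M" "Y \<in> spaces M"
    and P: "arr P" "source P = H \<boxtimes> X" "target P = Y \<boxtimes> H"
    using F quantum_set_arr(1) by (auto simp: typed_def d)
  note a = quantum_set_arr[OF qA, folded X_def] and b = quantum_set_arr[OF qB, folded Y_def]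
  note mel = mel_def[of F, folded A_def B_def H_def P_def, folded X_def Y_def]
  have e: "frame X I e" and g: "frame H S g" using e g by (simp_all add: d)
  obtain n f where f: "frame Y {..<n::nat} f" using frame_exists[OF sp(3)] by blast
  note fc = frame_closed[OF e] frame_closed[OF f] frame_closed[OF g]
  let ?T = "Y \<boxtimes> Y \<boxtimes> H"
  let ?t = "\<lambda>y1 y2 h'. pure M (Y \<boxtimes> Y) H (pure M Y Y y1 y2) h'"
  \<comment> \<open>Moved to the bra, the comultiplication multiplies \<open>y1\<close> and
    \<open>y2\<close>, so this side is a single matrix element.\<close>
  have L: "iprod ?T (?t y1 y2 h') (app ?l (pure M H X h x)) = mel F (qmul B y1 y2) h' h x"
    if "y1 \<in> carrier Y" "y2 \<in> carrier Y" "h' \<in> carrier H" "h \<in> carrier H" "x \<in> carrier X" for y1 y2 h' h x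
    using that sp P b iprod_move[of "\<Delta> B \<otimes> lid H" ?T "?t y1 y2 h'" "app P (pure M H X h x)"]
    by (simp add: mel qmul_def adjoint_tmap flip: Y_def)
  let ?R = "assoc_inv M Y Y H \<cdot> (lid Y \<otimes> P) \<cdot> assoc M Y H X \<cdot> (P \<otimes> lid X) \<cdot> assoc_inv M H X X"
  let ?R2 = "assoc_inv M Y Y H \<cdot> (lid Y \<otimes> P) \<cdot> assoc M Y H X"
  have R1: "iprod ?T (?t y1 y2 h') (app ?R (pure M H (X \<boxtimes> X) h (pure M X X x1 x2))) =
      (\<Sum>s\<in>S. mel F y2 h' (g s) x2 * mel F y1 (g s) h x1)"
    if v: "y1 \<in> carrier Y" "y2 \<in> carrier Y" "h' \<in> carrier H" "h \<in> carrier H" "x1 \<in> carrier X" "x2 \<in> carrier X"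
    for y1 y2 h' h x1 x2
  proof -
    \<comment> \<open>The diagram is cut after the first \<open>P\<close>. The second
      \<open>P\<close> does not touch the \<open>Y\<close> leg created there, so the frame
      \<open>f\<close> collapses against \<open>y1\<close>, and only the sum over \<open>S\<close>
      survives.\<close>
    define \<psi> where "\<psi> w = iprod ?T (?t y1 y2 h') (app ?R2 (pure M (Y \<boxtimes> H) X w x2))" for w
    have l: "linear_functional (Y \<boxtimes> H) \<psi>"
      unfolding \<psi>_def
      by (rule functional_pure_left[OF functional_app[OF functional_iprod]]) (use sp P v in auto)
    have p: "\<psi> (pure M Y H (f j) (g s)) = iprod Y y1 (f j) * mel F y2 h' (g s) x2" if "j < n" "s \<in> S" for j s
      using that sp P v fc by (simp add: \<psi>_def iprod_adjoint' pure_iprod mel)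
    let ?w = "app P (pure M H X h x1)"
    have w: "?w \<in> carrier (Y \<boxtimes> H)" using sp P v by simp
    have "iprod ?T (?t y1 y2 h') (app ?R (pure M H (X \<boxtimes> X) h (pure M X X x1 x2))) = \<psi> ?w"
      using sp P v by (simp add: \<psi>_def app_adjoint_assoc)
    also have "\<dots> = (\<Sum>j<n. \<Sum>s\<in>S. iprod (Y \<boxtimes> H) (pure M Y H (f j) (g s)) ?w * \<psi> (pure M Y H (f j) (g s)))"
      by (rule frame_expand2[OF f g sp(3,1) l w])
    also have "\<dots> = (\<Sum>j<n. \<Sum>s\<in>S. mel F y2 h' (g s) x2 * (iprod Y y1 (f j) * iprod (Y \<boxtimes> H) (pure M Y H (f j) (g s)) ?w))"
      by (intro sum.cong refl) (simp add: p)
    also have "\<dots> = (\<Sum>s\<in>S. mel F y2 h' (g s) x2 * mel F y1 (g s) h x1)"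
      by (subst sum.swap) (simp add: frame_contract_left[OF f sp(3,1) v(1) _ w] fc mel flip: sum_distrib_left)
    finally show ?thesis .
  qed
  have R: "iprod ?T (?t y1 y2 h') (app ?r (pure M H X h x)) =
      (\<Sum>i\<in>I. \<Sum>j\<in>I. iprod (X \<boxtimes> X) (pure M X X (e i) (e j)) (app (\<Delta> A) x) *
        (\<Sum>s\<in>S. mel F y2 h' (g s) (e j) * mel F y1 (g s) h (e i)))"
    if v: "y1 \<in> carrier Y" "y2 \<in> carrier Y" "h' \<in> carrier H" "h \<in> carrier H" "x \<in> carrier X" for y1 y2 h' h x
  proof -
    \<comment> \<open>A second cut, at the output of the comultiplication of \<open>A\<close>,
      produces the sums over \<open>I\<close>.\<close>
    define \<phi> where "\<phi> t = iprod ?T (?t y1 y2 h') (app ?R (pure M H (X \<boxtimes> X) h t))" for t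
    have l: "linear_functional (X \<boxtimes> X) \<phi>"
      unfolding \<phi>_def
      by (rule functional_pure_right[OF functional_app[OF functional_iprod]]) (use sp P v in auto)
    have w: "app (\<Delta> A) x \<in> carrier (X \<boxtimes> X)" using a v by simp
    have "iprod ?T (?t y1 y2 h') (app ?r (pure M H X h x)) = \<phi> (app (\<Delta> A) x)"
      using sp P v a by (simp add: \<phi>_def)
    also have "\<dots> = (\<Sum>i\<in>I. \<Sum>j\<in>I. iprod (X \<boxtimes> X) (pure M X X (e i) (e j)) (app (\<Delta> A) x) * \<phi> (pure M X X (e i) (e j)))"
      by (rule frame_expand2[OF e e sp(2,2) l w])
    also have "\<dots> = (\<Sum>i\<in>I. \<Sum>j\<in>I. iprod (X \<boxtimes> X) (pure M X X (e i) (e j)) (app (\<Delta> A) x) *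
        (\<Sum>s\<in>S. mel F y2 h' (g s) (e j) * mel F y1 (g s) h (e i)))"
      by (intro sum.cong refl) (simp only: \<phi>_def R1[OF v(1-4)] fc)
    finally show ?thesis .
  qed
  show ?W if "?l = ?r"
    by (intro ballI) (simp only: L[symmetric] R[symmetric] that)
  assume W: ?W'
  show "?l = ?r"
  proof (rule arr_tensor_ext[of _ _ H X])
    fix h x assume h: "h \<in> carrier H" and x: "x \<in> carrier X"
    show "app ?l (pure M H X h x) = app ?r (pure M H X h x)"
    proof (rule tensor3_iprod_eqI[of Y Y H])
      fix y1 y2 h' assume v: "y1 \<in> carrier Y" "y2 \<in> carrier Y" and h': "h' \<in> carrier H"
      show "iprod ?T (?t y1 y2 h') (app ?l (pure M H X h x)) = iprod ?T (?t y1 y2 h') (app ?r (pure M H X h x))"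
      \<comment> \<open>The bra \<open>h'\<close> is reduced to frame vectors here and the ket
        \<open>h\<close> just below, until \<open>?W'\<close> applies.\<close>
      proof (rule frame_ext_right[OF g _ sp(1) _ h'])
        fix q assume q: "q \<in> S"
        have l: "linear_functional H (\<lambda>h. iprod ?T (?t y1 y2 (g q)) (app f (pure M H X h x)))"
          if "arr f" "source f = H \<boxtimes> X" "target f = ?T" for f
          by (rule functional_pure_left[OF functional_app[OF functional_iprod]]) (use sp v x q fc that in auto)
        show "iprod ?T (?t y1 y2 (g q)) (app ?l (pure M H X h x)) = iprod ?T (?t y1 y2 (g q)) (app ?r (pure M H X h x))"
        proof (rule frame_functional_eq[OF g sp(1) l l _ h])
          fix r assume r: "r \<in> S"
          show "iprod ?T (?t y1 y2 (g q)) (app ?l (pure M H X (g r) x)) = iprod ?T (?t y1 y2 (g q)) (app ?r (pure M H X (g r) x))"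
            unfolding L[OF v fc(3)[OF q] fc(3)[OF r] x] R[OF v fc(3)[OF q] fc(3)[OF r] x] using W v x q r by blast
        qed (use sp P a b in simp_all)
      qed (use sp P a b h x v in simp_all)
    qed (use sp P a b h x in simp_all)
  qed (use sp P a b in simp_all)
qed

lemma qfun_cond2:
  assumes F: "typed F" and g: "frame (qspace F) S g"
  defines "A \<equiv> qdom F" and "B \<equiv> qcod F" and "H \<equiv> qspace F" and "P \<equiv> qmap F"
  defines "X \<equiv> space A" and "Y \<equiv> space B"
  shows "lunit M H \<cdot> (\<epsilon> B \<otimes> lid H) \<cdot> P
       = runit M H \<cdot> (lid H \<otimes> \<epsilon> A)
    \<Longrightarrow> \<forall>h'\<in>carrier H. \<forall>h\<in>carrier H. \<forall>a\<in>carrier X.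
      mel F (qone B) h' h a = iprod X (qone A) a * iprod H h' h" (is "?l = ?r \<Longrightarrow> ?W")
    and "\<forall>q\<in>S. \<forall>r\<in>S. \<forall>a\<in>carrier X.
      mel F (qone B) (g q) (g r) a = iprod X (qone A) a * iprod H (g q) (g r)
    \<Longrightarrow> lunit M H \<cdot> (\<epsilon> B \<otimes> lid H) \<cdot> P
       = runit M H \<cdot> (lid H \<otimes> \<epsilon> A)" (is "?W' \<Longrightarrow> _")
proof -
  note d = A_def B_def H_def P_def X_def Y_def
  have qA: "quantum_set M A" and qB: "quantum_set M B" and sp: "H \<in> spaces M" "X \<in> spaces M" "Y \<in> spaces M"
    and P: "arr P" "source P = H \<boxtimes> X" "target P = Y \<boxtimes> H"
    using F quantum_set_arr(1) by (auto simp: typed_def d)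
  note a = quantum_set_arr[OF qA, folded X_def] and b = quantum_set_arr[OF qB, folded Y_def]
  note mel = mel_def[of F, folded A_def B_def H_def P_def, folded X_def Y_def]
  have g: "frame H S g" using g by (simp add: d)
  note fc = frame_closed[OF g]
  \<comment> \<open>Moved to the bra, the unitor and the counit replace \<open>h'\<close> by
    \<open>qone B\<close> \<otimes> \<open>h'\<close>.\<close>
  have L: "iprod H h' (app ?l (pure M H X h x)) = mel F (qone B) h' h x"
    if "h' \<in> carrier H" "h \<in> carrier H" "x \<in> carrier X" for h' h x
    using that sp P b iprod_move[of "lunit M H \<cdot> (\<epsilon> B \<otimes> lid H)" H h' "app P (pure M H X h x)"]
    by (simp add: mel qone_def adjoint_comp adjoint_tmap app_adjoint_lunit)
  have R: "iprod H h' (app ?r (pure M H X h x)) = iprod X (qone A) x * iprod H h' h"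
    if "h' \<in> carrier H" "h \<in> carrier H" "x \<in> carrier X" for h' h x
    using that sp a by (simp add: iprod_adjoint' qone_def)
  show ?W if "?l = ?r"
    by (intro ballI) (simp only: L[symmetric] R[symmetric] that)
  assume W: ?W'
  show "?l = ?r"
  proof (rule arr_tensor_ext[of _ _ H X])
    fix h x assume h: "h \<in> carrier H" and x: "x \<in> carrier X"
    show "app ?l (pure M H X h x) = app ?r (pure M H X h x)"
    proof (rule iprod_eqI[of H])
      fix h' assume h': "h' \<in> carrier H"
      have "iprod H (g q) (app ?l (pure M H X h x)) = iprod H (g q) (app ?r (pure M H X h x))" if q: "q \<in> S" for q
      proof -
        have l: "linear_functional H (\<lambda>h. iprod H (g q) (app f (pure M H X h x)))"
          if "arr f" "source f = H \<boxtimes> X" "target f = H" for f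
          by (rule functional_pure_left[OF functional_app[OF functional_iprod]]) (use sp x q fc that in auto)
        show ?thesis
        proof (rule frame_functional_eq[OF g sp(1) l l _ h])
          fix r assume r: "r \<in> S"
          show "iprod H (g q) (app ?l (pure M H X (g r) x)) = iprod H (g q) (app ?r (pure M H X (g r) x))"
            unfolding L[OF fc[OF q] fc[OF r] x] R[OF fc[OF q] fc[OF r] x] using W x q r by blast
        qed (use sp P a b in simp_all)
      qed
      hence "(\<Sum>q\<in>S. iprod H h' (g q) * iprod H (g q) (app ?l (pure M H X h x)))
          = (\<Sum>q\<in>S. iprod H h' (g q) * iprod H (g q) (app ?r (pure M H X h x)))"
        by (intro sum.cong refl arg_cong2[of _ _ _ _ "(*)"])
      moreover have "app ?l (pure M H X h x) \<in> carrier H" "app ?r (pure M H X h x) \<in> carrier H"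
        using sp P a b h x by simp_all
      ultimately show "iprod H h' (app ?l (pure M H X h x)) = iprod H h' (app ?r (pure M H X h x))"
        by (simp only: frame_iprod[OF g h'])
    qed (use sp P a b h x in simp_all)
  qed (use sp P a b in simp_all)
qed

text \<open>The left-hand side is the conjugate of an element of \<open>P\<close> with bra and ket
  exchanged. On the right both algebra legs are bent, by the cup of \<open>A\<close> and the cap of
  \<open>B\<close>, whereas \<open>H\<close> passes straight through. Hence the coefficients involve
  only \<open>A\<close> and \<open>B\<close>, and \<open>h\<close> and \<open>h'\<close> change
  places between the two sides.\<close>

lemma qfun_cond3:
  assumes F: "typed F" and e: "frame (space (qdom F)) I e" and f: "frame (space (qcod F)) J f"
    and g: "frame (qspace F) S g"
  defines "A \<equiv> qdom F" and "B \<equiv> qcod F" and "H \<equiv> qspace F" and "P \<equiv> qmap F"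
  defines "X \<equiv> space A" and "Y \<equiv> space B"
  shows "P\<^sup>\<dagger>
       = (lunit M H \<otimes> lid X) \<cdot> ((\<epsilon> B \<cdot> qmult B) \<otimes> lid H \<otimes> lid X) \<cdot> (assoc_inv M Y Y H \<otimes> lid X)
           \<cdot> (lid Y \<otimes> P \<otimes> lid X)
           \<cdot> (assoc M Y H X \<otimes> lid X) \<cdot> assoc_inv M (Y \<boxtimes> H) X X
           \<cdot> (lid (Y \<boxtimes> H) \<otimes> (\<Delta> A \<cdot> qunit A)) \<cdot> runit_inv M (Y \<boxtimes> H)
    \<Longrightarrow> \<forall>y\<in>carrier Y. \<forall>h'\<in>carrier H. \<forall>h\<in>carrier H. \<forall>a\<in>carrier X.
      cnj (mel F y h h' a) = (\<Sum>k\<in>I. \<Sum>p\<in>J. iprod (X \<boxtimes> X) (pure M X X (e k) a) (qcup A) * qcap B y (f p) *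
         mel F (f p) h' h (e k))" (is "_ = ?r \<Longrightarrow> ?W")
    and "\<forall>y\<in>carrier Y. \<forall>q\<in>S. \<forall>r\<in>S. \<forall>a\<in>carrier X.
      cnj (mel F y (g r) (g q) a) = (\<Sum>k\<in>I. \<Sum>p\<in>J. iprod (X \<boxtimes> X) (pure M X X (e k) a) (qcup A) * qcap B y (f p) *
         mel F (f p) (g q) (g r) (e k))
    \<Longrightarrow> P\<^sup>\<dagger>
       = (lunit M H \<otimes> lid X) \<cdot> ((\<epsilon> B \<cdot> qmult B) \<otimes> lid H \<otimes> lid X) \<cdot> (assoc_inv M Y Y H \<otimes> lid X)
           \<cdot> (lid Y \<otimes> P \<otimes> lid X)
           \<cdot> (assoc M Y H X \<otimes> lid X) \<cdot> assoc_inv M (Y \<boxtimes> H) X X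
           \<cdot> (lid (Y \<boxtimes> H) \<otimes> (\<Delta> A \<cdot> qunit A)) \<cdot> runit_inv M (Y \<boxtimes> H)" (is "?W' \<Longrightarrow> _")
proof -
  note d = A_def B_def H_def P_def X_def Y_def
  have qA: "quantum_set M A" and qB: "quantum_set M B" and sp: "H \<in> spaces M" "X \<in> spaces M" "Y \<in> spaces M"
    and P: "arr P" "source P = H \<boxtimes> X" "target P = Y \<boxtimes> H"
    using F quantum_set_arr(1) by (auto simp: typed_def d)
  note a = quantum_set_arr[OF qA, folded X_def] and b = quantum_set_arr[OF qB, folded Y_def]
  note mel = mel_def[of F, folded A_def B_def H_def P_def, folded X_def Y_def]
  have e: "frame X I e" and f: "frame Y J f" and g: "frame H S g" using e f g by (simp_all add: d)
  note fc = frame_closed[OF e] frame_closed[OF f] frame_closed[OF g]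
  have cup: "qcup A \<in> carrier (X \<boxtimes> X)" using quantum_set_closed(2)[OF qA] by (simp add: X_def)
  have L: "iprod (H \<boxtimes> X) (pure M H X h' x) (app (P\<^sup>\<dagger>) (pure M Y H y h)) = cnj (mel F y h h' x)"
    if "y \<in> carrier Y" "h' \<in> carrier H" "h \<in> carrier H" "x \<in> carrier X" for y h' h x
    using that sp P by (simp add: iprod_adjoint' mel iprod_cnj')
  let ?R4 = "(lunit M H \<otimes> lid X) \<cdot> ((\<epsilon> B \<cdot> qmult B) \<otimes> lid H \<otimes> lid X) \<cdot> (assoc_inv M Y Y H \<otimes> lid X)"
  let ?R3 = "?R4 \<cdot> (lid Y \<otimes> P \<otimes> lid X) \<cdot> (assoc M Y H X \<otimes> lid X) \<cdot> assoc_inv M (Y \<boxtimes> H) X X"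
  have R3: "iprod (H \<boxtimes> X) (pure M H X h' x) (app ?R3 (pure M (Y \<boxtimes> H) (X \<boxtimes> X) (pure M Y H y h) (pure M X X x1 x2)))
      = (\<Sum>p\<in>J. qcap B y (f p) * mel F (f p) h' h x1) * iprod X x x2"
    if v: "y \<in> carrier Y" "h' \<in> carrier H" "h \<in> carrier H" "x \<in> carrier X" "x1 \<in> carrier X" "x2 \<in> carrier X"
    for y h' h x x1 x2
  proof -
    \<comment> \<open>The cut is at the output of \<open>P\<close>. The \<open>H\<close> leg
      contracts against \<open>h'\<close>, while the \<open>Y\<close> leg meets \<open>y\<close> in
      the cap and keeps the sum over \<open>J\<close>.\<close>
    define \<psi> where "\<psi> w = iprod (H \<boxtimes> X) (pure M H X h' x) (app ?R4 (pure M (Y \<boxtimes> (Y \<boxtimes> H)) X (pure M Y (Y \<boxtimes> H) y w) x2))" for w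
    have l: "linear_functional (Y \<boxtimes> H) \<psi>"
      unfolding \<psi>_def
      by (rule functional_pure_right[OF functional_pure_left[OF functional_app[OF functional_iprod]]])
         (use sp P b v in auto)
    have p: "\<psi> (pure M Y H (f j) (g s)) = qcap B y (f j) * iprod H h' (g s) * iprod X x x2" if "j \<in> J" "s \<in> S" for j s
      using that sp P b v fc
      by (simp add: \<psi>_def app_adjoint_assoc iprod_adjoint' pure_iprod qcap_def qmul_def qone_def flip: Y_def)
    let ?w = "app P (pure M H X h x1)"
    have w: "?w \<in> carrier (Y \<boxtimes> H)" using sp P v by simp
    have "iprod (H \<boxtimes> X) (pure M H X h' x) (app ?R3 (pure M (Y \<boxtimes> H) (X \<boxtimes> X) (pure M Y H y h) (pure M X X x1 x2))) = \<psi> ?w"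
      using sp P b v by (simp add: \<psi>_def app_adjoint_assoc)
    also have "\<dots> = (\<Sum>j\<in>J. \<Sum>s\<in>S. iprod (Y \<boxtimes> H) (pure M Y H (f j) (g s)) ?w * \<psi> (pure M Y H (f j) (g s)))"
      by (rule frame_expand2[OF f g sp(3,1) l w])
    also have "\<dots> = (\<Sum>j\<in>J. \<Sum>s\<in>S. qcap B y (f j) * iprod X x x2 * (iprod H h' (g s) * iprod (Y \<boxtimes> H) (pure M Y H (f j) (g s)) ?w))"
      by (intro sum.cong refl) (simp add: p)
    also have "\<dots> = (\<Sum>j\<in>J. qcap B y (f j) * iprod X x x2 * mel F (f j) h' h x1)"
      by (simp add: frame_contract_right[OF g sp(3,1) _ v(2) w] fc mel flip: sum_distrib_left)
    finally show ?thesis by (simp add: sum_distrib_left mult_ac)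
  qed
  have R: "iprod (H \<boxtimes> X) (pure M H X h' x) (app ?r (pure M Y H y h)) =
      (\<Sum>k\<in>I. \<Sum>p\<in>J. iprod (X \<boxtimes> X) (pure M X X (e k) x) (qcup A) * qcap B y (f p) * mel F (f p) h' h (e k))"
    if v: "y \<in> carrier Y" "h' \<in> carrier H" "h \<in> carrier H" "x \<in> carrier X" for y h' h x
  proof -
    \<comment> \<open>The cut is at the cup. Its second leg is an output and contracts against
      \<open>x\<close>; its first leg enters \<open>P\<close> and keeps the sum over
      \<open>I\<close>.\<close>
    define \<phi> where "\<phi> t = iprod (H \<boxtimes> X) (pure M H X h' x) (app ?R3 (pure M (Y \<boxtimes> H) (X \<boxtimes> X) (pure M Y H y h) t))" for t
    have l: "linear_functional (X \<boxtimes> X) \<phi>"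
      unfolding \<phi>_def
      by (rule functional_pure_right[OF functional_app[OF functional_iprod]]) (use sp P b v in auto)
    have "iprod (H \<boxtimes> X) (pure M H X h' x) (app ?r (pure M Y H y h)) = \<phi> (qcup A)"
      using sp P a b v by (simp add: \<phi>_def app_adjoint_runit qcup_def qone_def)
    also have "\<dots> = (\<Sum>k\<in>I. \<Sum>l\<in>I. iprod (X \<boxtimes> X) (pure M X X (e k) (e l)) (qcup A) * \<phi> (pure M X X (e k) (e l)))"
      by (rule frame_expand2[OF e e sp(2,2) l cup])
    also have "\<dots> = (\<Sum>k\<in>I. \<Sum>l\<in>I. (\<Sum>p\<in>J. qcap B y (f p) * mel F (f p) h' h (e k)) *
        (iprod X x (e l) * iprod (X \<boxtimes> X) (pure M X X (e k) (e l)) (qcup A)))"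
      by (intro sum.cong refl) (simp only: \<phi>_def R3[OF v] fc mult_ac)
    also have "\<dots> = (\<Sum>k\<in>I. (\<Sum>p\<in>J. qcap B y (f p) * mel F (f p) h' h (e k)) * iprod (X \<boxtimes> X) (pure M X X (e k) x) (qcup A))"
      by (simp add: frame_contract_right[OF e sp(2,2) _ v(4) cup] fc flip: sum_distrib_left)
    finally show ?thesis by (simp add: sum_distrib_left sum_distrib_right mult_ac)
  qed
  show ?W if "P\<^sup>\<dagger> = ?r"
    by (intro ballI) (simp only: L[symmetric] R[symmetric] that)
  assume W: ?W'
  show "P\<^sup>\<dagger> = ?r"
  proof (rule arr_tensor_ext[of _ _ Y H])
    fix y h assume y: "y \<in> carrier Y" and h: "h \<in> carrier H"
    show "app (P\<^sup>\<dagger>) (pure M Y H y h) = app ?r (pure M Y H y h)"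
    proof (rule tensor_iprod_eqI[of H X])
      fix h' x assume h': "h' \<in> carrier H" and x: "x \<in> carrier X"
      show "iprod (H \<boxtimes> X) (pure M H X h' x) (app (P\<^sup>\<dagger>) (pure M Y H y h))
        = iprod (H \<boxtimes> X) (pure M H X h' x) (app ?r (pure M Y H y h))"
      proof (rule frame_ext_left[OF g sp(1,2) h' x])
        fix q assume q: "q \<in> S"
        have l: "linear_functional H (\<lambda>h. iprod (H \<boxtimes> X) (pure M H X (g q) x) (app f (pure M Y H y h)))"
          if "arr f" "source f = Y \<boxtimes> H" "target f = H \<boxtimes> X" for f
          by (rule functional_pure_right[OF functional_app[OF functional_iprod]]) (use sp y x q fc that in auto)
        show "iprod (H \<boxtimes> X) (pure M H X (g q) x) (app (P\<^sup>\<dagger>) (pure M Y H y h))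
          = iprod (H \<boxtimes> X) (pure M H X (g q) x) (app ?r (pure M Y H y h))"
        proof (rule frame_functional_eq[OF g sp(1) l l _ h])
          fix r assume r: "r \<in> S"
          show "iprod (H \<boxtimes> X) (pure M H X (g q) x) (app (P\<^sup>\<dagger>) (pure M Y H y (g r)))
            = iprod (H \<boxtimes> X) (pure M H X (g q) x) (app ?r (pure M Y H y (g r)))"
            unfolding L[OF y fc(3)[OF q] fc(3)[OF r] x] R[OF y fc(3)[OF q] fc(3)[OF r] x] using W x y q r by blast
        qed (use sp P a b in simp_all)
      qed (use sp P a b h y in simp_all)
    qed (use sp P a b h y in simp_all)
  qed (use sp P a b in simp_all)
qed

lemma quantum_function_typed:
  assumes "quantum_function M F"
  shows "typed F"
proof -
  have t: "quantum_set M (qdom F)" "quantum_set M (qcod F)" "qspace F \<in> spaces M"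
    "qmap F \<in> linear_maps (qspace F \<boxtimes> space (qdom F)) (space (qcod F) \<boxtimes> qspace F)"
    using assms unfolding quantum_function_def Let_def by blast+
  show ?thesis
    unfolding typed_def using t arrI[OF t(4)] quantum_set_arr(1) by simp
qed

lemma quantum_function_mel:
  assumes q: "quantum_function M F"
    and e: "frame (space (qdom F)) I e" and f: "frame (space (qcod F)) J f" and g: "frame (qspace F) S g"
  defines "A \<equiv> qdom F" and "B \<equiv> qcod F" and "H \<equiv> qspace F"
  defines "X \<equiv> space A" and "Y \<equiv> space B"
  shows "\<forall>y1\<in>carrier Y. \<forall>y2\<in>carrier Y. \<forall>h'\<in>carrier H. \<forall>h\<in>carrier H. \<forall>a\<in>carrier X.
      mel F (qmul B y1 y2) h' h a = (\<Sum>i\<in>I. \<Sum>j\<in>I. iprod (X \<boxtimes> X) (pure M X X (e i) (e j)) (app (\<Delta> A) a) *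
        (\<Sum>s\<in>S. mel F y2 h' (g s) (e j) * mel F y1 (g s) h (e i)))"
    and "\<forall>h'\<in>carrier H. \<forall>h\<in>carrier H. \<forall>a\<in>carrier X.
      mel F (qone B) h' h a = iprod X (qone A) a * iprod H h' h"
    and "\<forall>y\<in>carrier Y. \<forall>h'\<in>carrier H. \<forall>h\<in>carrier H. \<forall>a\<in>carrier X.
      cnj (mel F y h h' a) = (\<Sum>k\<in>I. \<Sum>p\<in>J. iprod (X \<boxtimes> X) (pure M X X (e k) a) (qcup A) * qcap B y (f p) *
         mel F (f p) h' h (e k))"
proof -
  note t = quantum_function_typed[OF q]
  show "\<forall>y1\<in>carrier Y. \<forall>y2\<in>carrier Y. \<forall>h'\<in>carrier H. \<forall>h\<in>carrier H. \<forall>a\<in>carrier X.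
      mel F (qmul B y1 y2) h' h a = (\<Sum>i\<in>I. \<Sum>j\<in>I. iprod (X \<boxtimes> X) (pure M X X (e i) (e j)) (app (\<Delta> A) a) *
        (\<Sum>s\<in>S. mel F y2 h' (g s) (e j) * mel F y1 (g s) h (e i)))"
    unfolding assms(5-9)
    by (rule qfun_cond1(1)[OF t e g]) (use q in \<open>simp only: quantum_function_def Let_def\<close>)
  show "\<forall>h'\<in>carrier H. \<forall>h\<in>carrier H. \<forall>a\<in>carrier X.
      mel F (qone B) h' h a = iprod X (qone A) a * iprod H h' h"
    unfolding assms(5-9)
    by (rule qfun_cond2(1)[OF t g]) (use q in \<open>simp only: quantum_function_def Let_def\<close>)
  show "\<forall>y\<in>carrier Y. \<forall>h'\<in>carrier H. \<forall>h\<in>carrier H. \<forall>a\<in>carrier X.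
      cnj (mel F y h h' a) = (\<Sum>k\<in>I. \<Sum>p\<in>J. iprod (X \<boxtimes> X) (pure M X X (e k) a) (qcup A) * qcap B y (f p) *
         mel F (f p) h' h (e k))"
    unfolding assms(5-9)
    by (rule qfun_cond3(1)[OF t e f g]) (use q in \<open>simp only: quantum_function_def Let_def\<close>)
qed

lemma quantum_functionI:
  assumes t: "typed F"
    and e: "frame (space (qdom F)) I e" and f: "frame (space (qcod F)) J f" and g: "frame (qspace F) S g"
  defines "A \<equiv> qdom F" and "B \<equiv> qcod F" and "H \<equiv> qspace F"
  defines "X \<equiv> space A" and "Y \<equiv> space B"
  assumes W1: "\<forall>y1\<in>carrier Y. \<forall>y2\<in>carrier Y. \<forall>q\<in>S. \<forall>r\<in>S. \<forall>a\<in>carrier X.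
      mel F (qmul B y1 y2) (g q) (g r) a = (\<Sum>i\<in>I. \<Sum>j\<in>I. iprod (X \<boxtimes> X) (pure M X X (e i) (e j)) (app (\<Delta> A) a) *
        (\<Sum>s\<in>S. mel F y2 (g q) (g s) (e j) * mel F y1 (g s) (g r) (e i)))"
    and W2: "\<forall>q\<in>S. \<forall>r\<in>S. \<forall>a\<in>carrier X.
      mel F (qone B) (g q) (g r) a = iprod X (qone A) a * iprod H (g q) (g r)"
    and W3: "\<forall>y\<in>carrier Y. \<forall>q\<in>S. \<forall>r\<in>S. \<forall>a\<in>carrier X.
      cnj (mel F y (g r) (g q) a) = (\<Sum>k\<in>I. \<Sum>p\<in>J. iprod (X \<boxtimes> X) (pure M X X (e k) a) (qcup A) * qcap B y (f p) *
         mel F (f p) (g q) (g r) (e k))"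
  shows "quantum_function M F"
proof -
  have m: "qmap F \<in> linear_maps (qspace F \<boxtimes> space (qdom F)) (space (qcod F) \<boxtimes> qspace F)"
    by (rule arr_linear_maps[OF typed_arr(6-8)[OF t]])
  show ?thesis
    unfolding quantum_function_def Let_def
    by (intro conjI typed_arr(1-3)[OF t] m qfun_cond1(2)[OF t e g W1[unfolded assms(5-9)]]
        qfun_cond2(2)[OF t g W2[unfolded assms(5-9)]] qfun_cond3(2)[OF t e f g W3[unfolded assms(5-9)]])
qed

subsection \<open>Composition of quantum functions\<close>

lemma qcomp_simps [simp]:
  "qdom (qcomp M G F) = qdom F" "qcod (qcomp M G F) = qcod G" "qspace (qcomp M G F) = qspace G \<boxtimes> qspace F"
  by (simp_all add: qcomp_def Let_def)

lemma typed_qcomp: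
  assumes "typed F" "typed G" "qcod F = qdom G"
  shows "typed (qcomp M G F)"
proof -
  note F = typed_arr[OF assms(1)] and G = typed_arr[OF assms(2)]
  show ?thesis
    unfolding typed_def
  proof (intro conjI)
    show "quantum_set M (qdom (qcomp M G F))" "quantum_set M (qcod (qcomp M G F))" "qspace (qcomp M G F) \<in> spaces M"
      using F G by simp_all
    show "arr (qmap (qcomp M G F))" using F G assms(3) by (simp add: qcomp_def Let_def)
    show "source (qmap (qcomp M G F)) = qspace (qcomp M G F) \<boxtimes> space (qdom (qcomp M G F))"
      using F G assms(3) by (simp add: qcomp_def Let_def)
    show "target (qmap (qcomp M G F)) = space (qcod (qcomp M G F)) \<boxtimes> qspace (qcomp M G F)"
      using F G assms(3) by (simp add: qcomp_def Let_def)
  qed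
qed

text \<open>Between the two maps the state lies in the tensor product of the middle algebra with
  \<open>qspace F\<close>. The second map leaves \<open>qspace F\<close> alone, so its frame
  contracts against \<open>h'\<close>, and the only sum left runs over the middle algebra.\<close>

lemma mel_qcomp:
  assumes F: "typed F" and G: "typed G" and FG: "qcod F = qdom G" and f: "frame (space (qcod F)) J f"
    and v: "z \<in> carrier (space (qcod G))" "k' \<in> carrier (qspace G)" "k \<in> carrier (qspace G)"
      "h' \<in> carrier (qspace F)" "h \<in> carrier (qspace F)" "a \<in> carrier (space (qdom F))"
  shows "mel (qcomp M G F) z (pure M (qspace G) (qspace F) k' h') (pure M (qspace G) (qspace F) k h) a
    = (\<Sum>j\<in>J. mel G z k' k (f j) * mel F (f j) h' h a)"
proof -
  define X Y Z H K P Q where d: "X = space (qdom F)" "Y = space (qdom G)" "Z = space (qcod G)"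
    "H = qspace F" "K = qspace G" "P = qmap F" "Q = qmap G"
  note tF = typed_arr[OF F, unfolded FG, folded d] and tG = typed_arr[OF G, folded d] 
  note f = f[unfolded FG, folded d] and v = v[folded d]
  obtain n g where g: "frame H {..<n::nat} g" using frame_exists[OF tF(3)] by blast
  note fc = frame_closed[OF f] frame_closed[OF g]
  let ?R = "assoc M Z K H \<cdot> (Q \<otimes> lid H) \<cdot> assoc_inv M K Y H"
  let ?t = "pure M Z (K \<boxtimes> H) z (pure M K H k' h')"
  define \<psi> where "\<psi> w = iprod (Z \<boxtimes> (K \<boxtimes> H)) ?t (app ?R (pure M K (Y \<boxtimes> H) k w))" for w
  have l: "linear_functional (Y \<boxtimes> H) \<psi>"
    unfolding \<psi>_def
    by (rule functional_pure_right[OF functional_app[OF functional_iprod]]) (use tF tG v in auto)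
  have p: "\<psi> (pure M Y H (f j) (g s)) = mel G z k' k (f j) * iprod H h' (g s)" if "j \<in> J" "s < n" for j s
  proof -
    have "\<psi> (pure M Y H (f j) (g s)) = iprod (Z \<boxtimes> K \<boxtimes> H) (pure M (Z \<boxtimes> K) H (pure M Z K z k') h')
        (pure M (Z \<boxtimes> K) H (app Q (pure M K Y k (f j))) (g s))"
      using that tF tG v fc iprod_move[of "assoc M Z K H" "Z \<boxtimes> (K \<boxtimes> H)" ?t]
      by (simp add: \<psi>_def app_adjoint_assoc)
    thus ?thesis using that tF tG v fc by (simp add: pure_iprod mel_def flip: d)
  qed
  let ?w = "app P (pure M H X h a)"
  have w: "?w \<in> carrier (Y \<boxtimes> H)" using tF v by simp
  have "mel (qcomp M G F) z (pure M K H k' h') (pure M K H k h) a = \<psi> ?w"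
    using tF tG v by (simp add: mel_def \<psi>_def qcomp_def Let_def FG flip: d)
  also have "\<dots> = (\<Sum>j\<in>J. \<Sum>s<n. iprod (Y \<boxtimes> H) (pure M Y H (f j) (g s)) ?w * \<psi> (pure M Y H (f j) (g s)))"
    by (rule frame_expand2[OF f g tG(4) tF(3) l w])
  also have "\<dots> = (\<Sum>j\<in>J. \<Sum>s<n. mel G z k' k (f j) * (iprod H h' (g s) * iprod (Y \<boxtimes> H) (pure M Y H (f j) (g s)) ?w))"
    by (intro sum.cong refl) (simp add: p)
  also have "\<dots> = (\<Sum>j\<in>J. mel G z k' k (f j) * mel F (f j) h' h a)"
    by (simp add: frame_contract_right[OF g tG(4) tF(3) _ v(4) w] fc mel_def FG flip: sum_distrib_left d)
  finally show ?thesis by (simp add: d)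
qed

lemma functional_qcap:
  assumes "quantum_set M A" "y \<in> carrier (space A)"
  shows "linear_functional (space A) (qcap A y)"
  unfolding qcap_def[abs_def] qmul_def
  by (rule functional_pure_right[OF functional_app[OF functional_iprod]])
     (use quantum_set_arr[OF assms(1)] quantum_set_closed[OF assms(1)] assms(2) in auto)

lemma functional_mel:
  assumes "typed F" "y \<in> carrier (space (qcod F))" "h' \<in> carrier (qspace F)" "h \<in> carrier (qspace F)"
  shows "linear_functional (space (qdom F)) (mel F y h' h)"
  unfolding mel_def[abs_def]
  by (rule functional_pure_right[OF functional_app[OF functional_iprod]])
     (use typed_arr[OF assms(1)] assms(2-4) in auto)

lemma mel_expand_left:
  assumes F: "typed F" and f: "frame (space (qcod F)) J f"
    and v: "y \<in> carrier (space (qcod F))" "h' \<in> carrier (qspace F)" "h \<in> carrier (qspace F)" "a \<in> carrier (space (qdom F))"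
  shows "(\<Sum>j\<in>J. iprod (space (qcod F)) y (f j) * mel F (f j) h' h a) = mel F y h' h a"
  unfolding mel_def
  by (rule frame_contract_left[OF f]) (use typed_arr[OF F] v in auto)

lemma qid_simps [simp]: "qdom (qid M A) = A" "qcod (qid M A) = A" "qspace (qid M A) = \<I>"
  by (simp_all add: qid_def)

lemma typed_qid: "quantum_set M A \<Longrightarrow> typed (qid M A)"
  unfolding typed_def using quantum_set_arr(1)[of A] by (simp add: qid_def)

lemma mel_qid:
  assumes "quantum_set M A" "y \<in> carrier (space A)" "s' \<in> carrier \<I>" "s \<in> carrier \<I>" "a \<in> carrier (space A)"
  shows "mel (qid M A) y s' s a = iprod \<I> (unit_vec M) s * iprod \<I> s' (unit_vec M) * iprod (space A) y a"
  using assms quantum_set_arr(1)[OF assms(1)] by (simp add: mel_def qid_def app_adjoint_runit pure_iprod)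

text \<open>At the unit vector the matrix elements of \<open>qid\<close> are inner products in
  \<open>A\<close>. The first axiom then says that \<open>\<Delta> A\<close> is adjoint to the
  multiplication, the second is immediate, and the third is \<open>snake2\<close>.\<close>

lemma quantum_function_qid:
  assumes A: "quantum_set M A"
  shows "quantum_function M (qid M A)"
proof -
  let ?X = "space A" and ?u = "unit_vec M"
  note sp = quantum_set_arr(1)[OF A]
  obtain n e where e: "frame ?X {..<n::nat} e" using frame_exists[OF sp] by blast
  note ec = frame_closed[OF e]
  show ?thesis
  proof (rule quantum_functionI[OF typed_qid[OF A], of "{..<n}" e "{..<n}" e "{()}" "\<lambda>_. ?u"]; (unfold qid_simps)?)
    show "\<forall>y1\<in>carrier ?X. \<forall>y2\<in>carrier ?X. \<forall>q\<in>{()}. \<forall>r\<in>{()}. \<forall>a\<in>carrier ?X.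
      mel (qid M A) (qmul A y1 y2) ?u ?u a = (\<Sum>i<n. \<Sum>j<n. iprod (?X \<boxtimes> ?X) (pure M ?X ?X (e i) (e j)) (app (\<Delta> A) a) *
        (\<Sum>s\<in>{()}. mel (qid M A) y2 ?u ?u (e j) * mel (qid M A) y1 ?u ?u (e i)))"
    proof (intro ballI)
      fix y1 y2 a assume v: "y1 \<in> carrier ?X" "y2 \<in> carrier ?X" "a \<in> carrier ?X"
      have t: "app (\<Delta> A) a \<in> carrier (?X \<boxtimes> ?X)" using quantum_set_arr[OF A] v by simp
      have "(\<Sum>i<n. \<Sum>j<n. iprod (?X \<boxtimes> ?X) (pure M ?X ?X (e i) (e j)) (app (\<Delta> A) a) *
          (\<Sum>s\<in>{()}. mel (qid M A) y2 ?u ?u (e j) * mel (qid M A) y1 ?u ?u (e i)))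
        = (\<Sum>i<n. iprod ?X y1 (e i) * (\<Sum>j<n. iprod ?X y2 (e j) * iprod (?X \<boxtimes> ?X) (pure M ?X ?X (e i) (e j)) (app (\<Delta> A) a)))"
        using ec v by (simp add: mel_qid[OF A] sum_distrib_left mult_ac)
      also have "\<dots> = iprod (?X \<boxtimes> ?X) (pure M ?X ?X y1 y2) (app (\<Delta> A) a)"
        using ec v by (simp add: frame_contract_right[OF e sp sp _ v(2) t] frame_contract_left[OF e sp sp v(1,2) t])
      also have "\<dots> = mel (qid M A) (qmul A y1 y2) ?u ?u a"
        using v quantum_set_closed(3)[OF A v(1,2)] quantum_set_arr[OF A]
        by (simp add: mel_qid[OF A]) (simp add: qmul_def iprod_adjoint')
      finally show "mel (qid M A) (qmul A y1 y2) ?u ?u a = (\<Sum>i<n. \<Sum>j<n.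
          iprod (?X \<boxtimes> ?X) (pure M ?X ?X (e i) (e j)) (app (\<Delta> A) a) *
          (\<Sum>s\<in>{()}. mel (qid M A) y2 ?u ?u (e j) * mel (qid M A) y1 ?u ?u (e i)))" ..
    qed
    show "\<forall>q\<in>{()}. \<forall>r\<in>{()}. \<forall>a\<in>carrier ?X. mel (qid M A) (qone A) ?u ?u a = iprod ?X (qone A) a * iprod \<I> ?u ?u"
      using quantum_set_closed(1)[OF A] by (simp add: mel_qid[OF A])
    show "\<forall>y\<in>carrier ?X. \<forall>q\<in>{()}. \<forall>r\<in>{()}. \<forall>a\<in>carrier ?X. cnj (mel (qid M A) y ?u ?u a) =
        (\<Sum>k<n. \<Sum>p<n. iprod (?X \<boxtimes> ?X) (pure M ?X ?X (e k) a) (qcup A) * qcap A y (e p) * mel (qid M A) (e p) ?u ?u (e k))"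
    proof (intro ballI)
      fix y a assume y: "y \<in> carrier ?X" and a: "a \<in> carrier ?X"
      have "(\<Sum>k<n. \<Sum>p<n. iprod (?X \<boxtimes> ?X) (pure M ?X ?X (e k) a) (qcup A) * qcap A y (e p) * mel (qid M A) (e p) ?u ?u (e k))
          = (\<Sum>k<n. iprod (?X \<boxtimes> ?X) (pure M ?X ?X (e k) a) (qcup A) * (\<Sum>p<n. iprod ?X (e p) (e k) * qcap A y (e p)))"
        using ec by (simp add: mel_qid[OF A] sum_distrib_left sum_distrib_right mult_ac)
      \<comment> \<open>The inner sum is the frame expansion of the functional
        \<open>qcap A y\<close> at \<open>e k\<close>; the outer one is then
        \<open>snake2\<close>.\<close>
      also have "\<dots> = iprod ?X a y"
        using ec snake2[OF A e a y] by (simp add: frame_expand[OF e sp functional_qcap[OF A y]])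
      also have "\<dots> = cnj (mel (qid M A) y ?u ?u a)"
        using y a sp by (simp add: mel_qid[OF A] iprod_cnj')
      finally show "cnj (mel (qid M A) y ?u ?u a) =
        (\<Sum>k<n. \<Sum>p<n. iprod (?X \<boxtimes> ?X) (pure M ?X ?X (e k) a) (qcup A) * qcap A y (e p) * mel (qid M A) (e p) ?u ?u (e k))" ..
    qed
  qed (use e frame_scalars in simp_all)
qed

text \<open>The auxiliary space carries the product frame. All its test vectors are pure tensors, so
  \<open>mGF\<close> evaluates every matrix element of the composite.\<close>

lemma quantum_function_qcomp:
  assumes qF: "quantum_function M F" and qG: "quantum_function M G" and FG: "qcod F = qdom G"
  shows "quantum_function M (qcomp M G F)"
proof -
  define X Y Z H K where d: "X = space (qdom F)" "Y = space (qdom G)" "Z = space (qcod G)" "H = qspace F" "K = qspace G"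
  have tF: "typed F" and tG: "typed G" using qF qG quantum_function_typed by auto
  note aF = typed_arr[OF tF, unfolded FG, folded d] and aG = typed_arr[OF tG, folded d]
  note sp = aF(3-5) aG(3,5)
  obtain nx e where e: "frame X {..<nx::nat} e" using frame_exists[OF sp(2)] by blast
  obtain ny f where f: "frame Y {..<ny::nat} f" using frame_exists[OF sp(3)] by blast
  obtain nz r where r: "frame Z {..<nz::nat} r" using frame_exists[OF sp(5)] by blast
  obtain nh g where g: "frame H {..<nh::nat} g" using frame_exists[OF sp(1)] by blast
  obtain nk \<kappa> where \<kappa>: "frame K {..<nk::nat} \<kappa>" using frame_exists[OF sp(4)] by blast
  note c = frame_closed[OF e] frame_closed[OF f] frame_closed[OF r] frame_closed[OF g] frame_closed[OF \<kappa>]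
  note mF = quantum_function_mel[OF qF, unfolded FG, folded d, OF e f g]
    and mG = quantum_function_mel[OF qG, folded d, OF f r \<kappa>]
  note mGF = mel_qcomp[OF tF tG FG, unfolded FG, folded d, OF f]
  let ?GF = "qcomp M G F" and ?p = "pure M K H"
  show ?thesis
  proof (rule quantum_functionI[OF typed_qcomp[OF tF tG FG], of "{..<nx}" e "{..<nz}" r "{..<nk}\<times>{..<nh}" "\<lambda>(i, j). ?p (\<kappa> i) (g j)"];
      (unfold qcomp_simps)?, (fold d)?)
    show "frame (K \<boxtimes> H) ({..<nk}\<times>{..<nh}) (\<lambda>(i, j). ?p (\<kappa> i) (g j))"
      by (rule frame_tensor[OF \<kappa> g sp(4,1)])
    have W1: "mel ?GF (qmul (qcod G) z1 z2) (?p k' h') (?p k h) a =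
       (\<Sum>i<nx. \<Sum>j<nx. iprod (X \<boxtimes> X) (pure M X X (e i) (e j)) (app (\<Delta> (qdom F)) a) *
         (\<Sum>u<nk. \<Sum>s<nh. mel ?GF z2 (?p k' h') (?p (\<kappa> u) (g s)) (e j) * mel ?GF z1 (?p (\<kappa> u) (g s)) (?p k h) (e i)))"
      if v: "z1 \<in> carrier Z" "z2 \<in> carrier Z" "k' \<in> carrier K" "h' \<in> carrier H" "k \<in> carrier K" "h \<in> carrier H" "a \<in> carrier X"
      for z1 z2 k' h' k h a
    proof -
      have m: "qmul (qcod G) z1 z2 \<in> carrier Z" using quantum_set_closed(3)[OF aG(2)] v by (simp add: d)
      \<comment> \<open>The first axiom of \<open>G\<close> brings in the comultiplication of the
        middle algebra. Written as a product in the bra, its coefficients can be absorbed into the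
        first slot of \<open>F\<close>.\<close>
      have D: "iprod (Y \<boxtimes> Y) (pure M Y Y (f l) (f m)) (app (\<Delta> (qdom G)) (f j)) = iprod Y (qmul (qdom G) (f l) (f m)) (f j)"
        if "l < ny" "m < ny" "j < ny" for l m j
        using quantum_set_arr[OF aG(1)] c(2) that by (simp add: d qmul_def iprod_adjoint')
      have "mel ?GF (qmul (qcod G) z1 z2) (?p k' h') (?p k h) a
          = (\<Sum>x<ny. mel G (qmul (qcod G) z1 z2) k' k (f x) * mel F (f x) h' h a)"
        by (rule mGF[OF m v(3,5,4,6,7)])
      also have "\<dots> = (\<Sum>x<ny. \<Sum>l<ny. \<Sum>m<ny. (\<Sum>u<nk. mel G z2 k' (\<kappa> u) (f m) * mel G z1 (\<kappa> u) k (f l)) *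
          (iprod Y (qmul (qdom G) (f l) (f m)) (f x) * mel F (f x) h' h a))"
        using mG(1) v c(2) by (simp add: D sum_distrib_right sum_distrib_left mult_ac)
      \<comment> \<open>The sum over \<open>x\<close> contracts the frame in the bra slot of
        \<open>F\<close>, leaving the product of two middle frame vectors there. This is the shape
        to which the first axiom of \<open>F\<close> applies.\<close>
      also have "\<dots> = (\<Sum>l<ny. \<Sum>m<ny. (\<Sum>u<nk. mel G z2 k' (\<kappa> u) (f m) * mel G z1 (\<kappa> u) k (f l)) *
          mel F (qmul (qdom G) (f l) (f m)) h' h a)"
      proof -
        have "(\<Sum>x<ny. iprod Y (qmul (qdom G) (f l) (f m)) (f x) * mel F (f x) h' h a) = mel F (qmul (qdom G) (f l) (f m)) h' h a"
          if "l < ny" "m < ny" for l m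
          using mel_expand_left[OF tF, unfolded FG, folded d, OF f _ v(4,6,7)] quantum_set_closed(3)[OF aG(1)] c(2) that
          by (simp add: d)
        thus ?thesis
          by (subst sum_rotate) (simp flip: sum_distrib_left)
      qed
      also have "\<dots> = (\<Sum>l<ny. \<Sum>m<ny. (\<Sum>u<nk. mel G z2 k' (\<kappa> u) (f m) * mel G z1 (\<kappa> u) k (f l)) *
          (\<Sum>i<nx. \<Sum>j<nx. iprod (X \<boxtimes> X) (pure M X X (e i) (e j)) (app (\<Delta> (qdom F)) a) *
            (\<Sum>s<nh. mel F (f m) h' (g s) (e j) * mel F (f l) (g s) h (e i))))"
        using mF(1) v c(2) by simp
      also have "\<dots> = (\<Sum>i<nx. \<Sum>j<nx. iprod (X \<boxtimes> X) (pure M X X (e i) (e j)) (app (\<Delta> (qdom F)) a) *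
          (\<Sum>u<nk. \<Sum>s<nh. (\<Sum>m<ny. mel G z2 k' (\<kappa> u) (f m) * mel F (f m) h' (g s) (e j)) *
            (\<Sum>l<ny. mel G z1 (\<kappa> u) k (f l) * mel F (f l) (g s) h (e i))))"
        by (rule sum_reorder_mult)
      also have "\<dots> = (\<Sum>i<nx. \<Sum>j<nx. iprod (X \<boxtimes> X) (pure M X X (e i) (e j)) (app (\<Delta> (qdom F)) a) *
         (\<Sum>u<nk. \<Sum>s<nh. mel ?GF z2 (?p k' h') (?p (\<kappa> u) (g s)) (e j) * mel ?GF z1 (?p (\<kappa> u) (g s)) (?p k h) (e i)))"
        using v c by (simp add: mGF)
      finally show ?thesis .
    qed
    show "\<forall>z1\<in>carrier Z. \<forall>z2\<in>carrier Z. \<forall>q\<in>{..<nk}\<times>{..<nh}. \<forall>t\<in>{..<nk}\<times>{..<nh}. \<forall>a\<in>carrier X.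
      mel ?GF (qmul (qcod G) z1 z2) (case q of (i, j) \<Rightarrow> ?p (\<kappa> i) (g j)) (case t of (i, j) \<Rightarrow> ?p (\<kappa> i) (g j)) a =
       (\<Sum>i<nx. \<Sum>j<nx. iprod (X \<boxtimes> X) (pure M X X (e i) (e j)) (app (\<Delta> (qdom F)) a) *
         (\<Sum>s\<in>{..<nk}\<times>{..<nh}. mel ?GF z2 (case q of (i, j) \<Rightarrow> ?p (\<kappa> i) (g j)) (case s of (i, j) \<Rightarrow> ?p (\<kappa> i) (g j)) (e j) *
           mel ?GF z1 (case s of (i, j) \<Rightarrow> ?p (\<kappa> i) (g j)) (case t of (i, j) \<Rightarrow> ?p (\<kappa> i) (g j)) (e i)))"
      using c(4,5) by (auto simp: W1 sum.cartesian_product case_prod_unfold)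
    \<comment> \<open>The second axiom of \<open>G\<close> produces the unit of the middle algebra.
      The sum over the middle frame moves it into the bra of \<open>F\<close>, whose second axiom
      finishes.\<close>
    have "qone (qcod G) \<in> carrier Z" using quantum_set_closed(1)[OF aG(2)] by (simp add: d)
    hence W2: "mel ?GF (qone (qcod G)) (?p k' h') (?p k h) a = iprod X (qone (qdom F)) a * iprod (K \<boxtimes> H) (?p k' h') (?p k h)"
      if v: "k' \<in> carrier K" "h' \<in> carrier H" "k \<in> carrier K" "h \<in> carrier H" "a \<in> carrier X" for k' h' k h a
      using mG(2) mF(2) v c(2) sp quantum_set_closed(1)[OF aG(1), folded d]
        mel_expand_left[OF tF, unfolded FG, folded d, OF f, of "qone (qdom G)" h' h a]
      by (simp add: mGF pure_iprod mult.assoc mult.left_commute[of _ "iprod K k' k"] flip: sum_distrib_left)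
    show "\<forall>q\<in>{..<nk}\<times>{..<nh}. \<forall>t\<in>{..<nk}\<times>{..<nh}. \<forall>a\<in>carrier X.
      mel ?GF (qone (qcod G)) (case q of (i, j) \<Rightarrow> ?p (\<kappa> i) (g j)) (case t of (i, j) \<Rightarrow> ?p (\<kappa> i) (g j)) a =
       iprod X (qone (qdom F)) a * iprod (K \<boxtimes> H) (case q of (i, j) \<Rightarrow> ?p (\<kappa> i) (g j)) (case t of (i, j) \<Rightarrow> ?p (\<kappa> i) (g j))"
      using c(4,5) by (auto simp: W2)
    have W3: "cnj (mel ?GF z (?p k h) (?p k' h') a) = (\<Sum>i<nx. \<Sum>t<nz. iprod (X \<boxtimes> X) (pure M X X (e i) a) (qcup (qdom F)) *
        qcap (qcod G) z (r t) * mel ?GF (r t) (?p k' h') (?p k h) (e i))"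
      if v: "z \<in> carrier Z" "k' \<in> carrier K" "h' \<in> carrier H" "k \<in> carrier K" "h \<in> carrier H" "a \<in> carrier X"
      for z k' h' k h a
    proof -
      have "cnj (mel ?GF z (?p k h) (?p k' h') a) = (\<Sum>j<ny. cnj (mel G z k k' (f j)) * cnj (mel F (f j) h h' a))"
        using v by (simp add: mGF)
      \<comment> \<open>The third axiom is applied to both factors separately. The middle index
        \<open>j\<close> now joins the cup coming from \<open>G\<close> to the cap coming from
        \<open>F\<close>.\<close>
      also have "\<dots> = (\<Sum>j<ny. (\<Sum>s<ny. \<Sum>t<nz. iprod (Y \<boxtimes> Y) (pure M Y Y (f s) (f j)) (qcup (qdom G)) * qcap (qcod G) z (r t) * mel G (r t) k' k (f s)) *
          (\<Sum>i<nx. \<Sum>x<ny. iprod (X \<boxtimes> X) (pure M X X (e i) a) (qcup (qdom F)) * qcap (qdom G) (f j) (f x) * mel F (f x) h' h (e i)))"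
        using mG(3) mF(3) v c(2) by simp
      also have "\<dots> = (\<Sum>i<nx. \<Sum>t<nz. iprod (X \<boxtimes> X) (pure M X X (e i) a) (qcup (qdom F)) * qcap (qcod G) z (r t) *
          (\<Sum>x<ny. (\<Sum>s<ny. mel G (r t) k' k (f s) * (\<Sum>j<ny. iprod (Y \<boxtimes> Y) (pure M Y Y (f s) (f j)) (qcup (qdom G)) * qcap (qdom G) (f j) (f x))) *
            mel F (f x) h' h (e i)))"
        by (rule sum_reorder_adjoint)
      \<comment> \<open>By \<open>snake1\<close> the sum over \<open>j\<close> is the inner product
        of \<open>f s\<close> and \<open>f x\<close>. The sum over \<open>s\<close> is then a frame
        expansion in the last, linear slot of \<open>mel G\<close>.\<close>
      also have "\<dots> = (\<Sum>i<nx. \<Sum>t<nz. iprod (X \<boxtimes> X) (pure M X X (e i) a) (qcup (qdom F)) * qcap (qcod G) z (r t) *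
          (\<Sum>x<ny. mel G (r t) k' k (f x) * mel F (f x) h' h (e i)))"
      proof -
        have "(\<Sum>s<ny. mel G (r t) k' k (f s) * (\<Sum>j<ny. iprod (Y \<boxtimes> Y) (pure M Y Y (f s) (f j)) (qcup (qdom G)) * qcap (qdom G) (f j) (f x)))
            = mel G (r t) k' k (f x)" if "t < nz" "x < ny" for t x
          using snake1[OF aG(1), folded d, OF f] frame_expand[OF f sp(3) functional_mel[OF tG, folded d], of "r t" k' k "f x"]
            c(2,3) that v by (simp add: mult.commute)
        thus ?thesis by simp
      qed
      also have "\<dots> = (\<Sum>i<nx. \<Sum>t<nz. iprod (X \<boxtimes> X) (pure M X X (e i) a) (qcup (qdom F)) *
        qcap (qcod G) z (r t) * mel ?GF (r t) (?p k' h') (?p k h) (e i))"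
        using v c by (simp add: mGF)
      finally show ?thesis .
    qed
    show "\<forall>z\<in>carrier Z. \<forall>q\<in>{..<nk}\<times>{..<nh}. \<forall>t\<in>{..<nk}\<times>{..<nh}. \<forall>a\<in>carrier X.
      cnj (mel ?GF z (case t of (i, j) \<Rightarrow> ?p (\<kappa> i) (g j)) (case q of (i, j) \<Rightarrow> ?p (\<kappa> i) (g j)) a) =
       (\<Sum>k<nx. \<Sum>p<nz. iprod (X \<boxtimes> X) (pure M X X (e k) a) (qcup (qdom F)) * qcap (qcod G) z (r p) *
         mel ?GF (r p) (case q of (i, j) \<Rightarrow> ?p (\<kappa> i) (g j)) (case t of (i, j) \<Rightarrow> ?p (\<kappa> i) (g j)) (e k))"
      using c(4,5) by (auto simp: W3)
  qed (use e r in simp_all)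
qed

subsection \<open>Intertwiners\<close>

lemma intertwiner_arr:
  assumes "typed F" "typed G" "f \<in> intertwiners M F G"
  shows "arr f" "source f = qspace F" "target f = qspace G"
  using arrI[of f "qspace F" "qspace G"] assms typed_arr(3) by (auto simp: intertwiners_def)

text \<open>On one side \<open>f\<close> acts after \<open>qmap F\<close> and moves to the bra as
  its adjoint; on the other it acts directly on the pure ket. The map \<open>f\<close> is merely
  typed here, so the same formulas serve \<open>intertwiner_mel\<close> and its converse.\<close>

lemma intertwiner_test:
  assumes F: "typed F" and G: "typed G" and FG: "qdom F = qdom G" "qcod F = qcod G"
    and f: "arr f" "source f = qspace F" "target f = qspace G"
    and v: "y \<in> carrier (space (qcod F))" "h' \<in> carrier (qspace G)" "h \<in> carrier (qspace F)" "a \<in> carrier (space (qdom F))"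
  defines "T \<equiv> space (qcod F) \<boxtimes> qspace G" and "t \<equiv> pure M (space (qcod F)) (qspace G) y h'"
    and "w \<equiv> pure M (qspace F) (space (qdom F)) h a"
  shows "iprod T t (app ((lid (space (qcod F)) \<otimes> f) \<cdot> qmap F) w) = mel F y (app (f\<^sup>\<dagger>) h') h a"
    and "iprod T t (app (qmap G \<cdot> (f \<otimes> lid (space (qdom F)))) w) = mel G y h' (app f h) a"
proof -
  note aF = typed_arr[OF F] and aG = typed_arr[OF G]
  show "iprod T t (app ((lid (space (qcod F)) \<otimes> f) \<cdot> qmap F) w) = mel F y (app (f\<^sup>\<dagger>) h') h a"
    using aF aG f v iprod_move[of "lid (space (qcod F)) \<otimes> f" T t "app (qmap F) w"]
    by (simp add: T_def t_def w_def adjoint_tmap mel_def)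
  show "iprod T t (app (qmap G \<cdot> (f \<otimes> lid (space (qdom F)))) w) = mel G y h' (app f h) a"
    using aF aG f v FG by (simp add: T_def t_def w_def mel_def)
qed

lemma intertwiner_mel:
  assumes F: "typed F" and G: "typed G" and FG: "qdom F = qdom G" "qcod F = qcod G" and f: "f \<in> intertwiners M F G"
    and v: "y \<in> carrier (space (qcod F))" "h' \<in> carrier (qspace G)" "h \<in> carrier (qspace F)" "a \<in> carrier (space (qdom F))"
  shows "mel F y (app (f\<^sup>\<dagger>) h') h a = mel G y h' (app f h) a"
proof -
  have "(lid (space (qcod F)) \<otimes> f) \<cdot> qmap F = qmap G \<cdot> (f \<otimes> lid (space (qdom F)))"
    using f by (simp add: intertwiners_def)
  thus ?thesis
    using intertwiner_test[OF F G FG intertwiner_arr[OF F G f] v] by metis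
qed

text \<open>Restricting the test to frame vectors lets product frames be used for composites, whose
  matrix elements are computed on pure tensors.\<close>

lemma intertwinerI:
  assumes F: "typed F" and G: "typed G" and FG: "qdom F = qdom G" "qcod F = qcod G"
    and f: "arr f" "source f = qspace F" "target f = qspace G"
    and g: "frame (qspace F) S g" and k: "frame (qspace G) R k"
    and eq: "\<And>y q s a. \<lbrakk>y \<in> carrier (space (qcod F)); q \<in> R; s \<in> S; a \<in> carrier (space (qdom F))\<rbrakk> \<Longrightarrow>
      mel F y (app (f\<^sup>\<dagger>) (k q)) (g s) a = mel G y (k q) (app f (g s)) a"
  shows "f \<in> intertwiners M F G"
proof -
  note aF = typed_arr[OF F] and aG = typed_arr[OF G]
  define X Y H K where d: "X = space (qdom F)" "Y = space (qcod F)" "H = qspace F" "K = qspace G"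
  note test = intertwiner_test[OF F G FG f, folded d]
  have g: "frame H S g" and k: "frame K R k" using g k by (simp_all add: d)
  note c = frame_closed[OF g] frame_closed[OF k]
  have sp: "X \<in> spaces M" "Y \<in> spaces M" "H \<in> spaces M" "K \<in> spaces M" using aF aG by (simp_all add: d)
  let ?l = "(lid Y \<otimes> f) \<cdot> qmap F" and ?r = "qmap G \<cdot> (f \<otimes> lid X)"
  have la: "arr ?l" "source ?l = H \<boxtimes> X" "target ?l = Y \<boxtimes> K" using aF f by (simp_all add: d)
  have ra: "arr ?r" "source ?r = H \<boxtimes> X" "target ?r = Y \<boxtimes> K" using aF aG f FG by (simp_all add: d)
  have "?l = ?r"
  proof (rule arr_tensor_ext[of _ _ H X])
    fix h a assume h: "h \<in> carrier H" and a: "a \<in> carrier X"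
    show "app ?l (pure M H X h a) = app ?r (pure M H X h a)"
    proof (rule tensor_iprod_eqI[of Y K])
      fix y h' assume y: "y \<in> carrier Y" and h': "h' \<in> carrier K"
      show "iprod (Y \<boxtimes> K) (pure M Y K y h') (app ?l (pure M H X h a)) = iprod (Y \<boxtimes> K) (pure M Y K y h') (app ?r (pure M H X h a))"
      proof (rule frame_ext_right[OF k sp(2,4) y h'])
        fix q assume q: "q \<in> R"
        have l: "linear_functional H (\<lambda>h. iprod (Y \<boxtimes> K) (pure M Y K y (k q)) (app f (pure M H X h a)))"
          if "arr f" "source f = H \<boxtimes> X" "target f = Y \<boxtimes> K" for f
          by (rule functional_pure_left[OF functional_app[OF functional_iprod]]) (use sp y a q c that in auto)
        show "iprod (Y \<boxtimes> K) (pure M Y K y (k q)) (app ?l (pure M H X h a)) = iprod (Y \<boxtimes> K) (pure M Y K y (k q)) (app ?r (pure M H X h a))"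
        proof (rule frame_functional_eq[OF g sp(3) l[OF la] l[OF ra] _ h])
          fix s assume s: "s \<in> S"
          show "iprod (Y \<boxtimes> K) (pure M Y K y (k q)) (app ?l (pure M H X (g s) a)) = iprod (Y \<boxtimes> K) (pure M Y K y (k q)) (app ?r (pure M H X (g s) a))"
            unfolding test[OF y c(2)[OF q] c(1)[OF s] a] by (rule eq[folded d, OF y q s a])
        qed
      qed (use aF aG f FG h a in \<open>simp_all add: d\<close>)
    qed (use aF aG f FG h a in \<open>simp_all add: d\<close>)
  qed (use la ra sp in simp_all)
  thus ?thesis
    unfolding intertwiners_def using arr_linear_maps[OF f] FG by (simp add: d)
qed

lemma intertwiner_lid:
  assumes F: "typed F"
  shows "lid (qspace F) \<in> intertwiners M F F"
proof -
  obtain n g where g: "frame (qspace F) {..<n::nat} g" using frame_exists typed_arr(3)[OF F] by blast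
  show ?thesis
    by (rule intertwinerI[OF F F _ _ _ _ _ g g]) (use typed_arr(3)[OF F] frame_closed[OF g] in simp_all)
qed

lemma intertwiner_comp:
  assumes F: "typed F" "typed G" "typed K" and p: "qdom F = qdom G" "qcod F = qcod G" "qdom G = qdom K" "qcod G = qcod K"
    and f: "f \<in> intertwiners M F G" and g: "g \<in> intertwiners M G K"
  shows "g \<cdot> f \<in> intertwiners M F K"
proof -
  note af = intertwiner_arr[OF F(1,2) f] and ag = intertwiner_arr[OF F(2,3) g]
  obtain n e where e: "frame (qspace F) {..<n::nat} e" using frame_exists typed_arr(3)[OF F(1)] by blast
  obtain m k where k: "frame (qspace K) {..<m::nat} k" using frame_exists typed_arr(3)[OF F(3)] by blast
  show ?thesis
  proof (rule intertwinerI[OF F(1,3) _ _ _ _ _ e k])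
    fix y q s a assume v: "y \<in> carrier (space (qcod F))" "q \<in> {..<m}" "s \<in> {..<n}" "a \<in> carrier (space (qdom F))"
    show "mel F y (app ((g \<cdot> f)\<^sup>\<dagger>) (k q)) (e s) a = mel K y (k q) (app (g \<cdot> f) (e s)) a"
      using intertwiner_mel[OF F(1,2) p(1,2) f, of y "app (g\<^sup>\<dagger>) (k q)" "e s" a]
        intertwiner_mel[OF F(2,3) p(3,4) g, of y "k q" "app f (e s)" a]
        af ag v p frame_closed[OF e] frame_closed[OF k]
      by (simp add: adjoint_comp)
  qed (use af ag p in simp_all)
qed

lemma intertwiner_adjoint:
  assumes qF: "quantum_function M F" and qG: "quantum_function M G" and p: "qdom F = qdom G" "qcod F = qcod G"
    and f: "f \<in> intertwiners M F G"
  shows "f\<^sup>\<dagger> \<in> intertwiners M G F"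
proof -
  have F: "typed F" and G: "typed G" using qF qG quantum_function_typed by auto
  note af = intertwiner_arr[OF F G f]
  obtain nx e where e: "frame (space (qdom F)) {..<nx::nat} e" using frame_exists typed_arr(4)[OF F] by blast
  obtain ny r where r: "frame (space (qcod F)) {..<ny::nat} r" using frame_exists typed_arr(5)[OF F] by blast
  obtain n g where g: "frame (qspace F) {..<n::nat} g" using frame_exists typed_arr(3)[OF F] by blast
  obtain m k where k: "frame (qspace G) {..<m::nat} k" using frame_exists typed_arr(3)[OF G] by blast
  note mF = quantum_function_mel(3)[OF qF e r g] and mG = quantum_function_mel(3)[OF qG, folded p, OF e r k]
  show ?thesis
  proof (rule intertwinerI[OF G F _ _ _ _ _ k g])
    fix y q s a assume v: "y \<in> carrier (space (qcod G))" "q \<in> {..<n}" "s \<in> {..<m}" "a \<in> carrier (space (qdom G))"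
    note c = frame_closed[OF g v(2)] frame_closed[OF k v(3)]
    have fc: "app (f\<^sup>\<dagger>) (k s) \<in> carrier (qspace F)" "app f (g q) \<in> carrier (qspace G)"
      using af c by simp_all
    \<comment> \<open>Both conjugates are expanded with the same frames \<open>e\<close> and
      \<open>r\<close>, so the coefficients coincide, and the terms agree by
      \<open>intertwiner_mel\<close> for \<open>f\<close>. The third axiom exchanges the two
      auxiliary slots, which turns the relation for \<open>f\<close> into the one for
      \<open>f\<^sup>\<dagger>\<close>.\<close>
    have "cnj (mel G y (app f (g q)) (k s) a) = cnj (mel F y (g q) (app (f\<^sup>\<dagger>) (k s)) a)"
      using mF[rule_format, of y "app (f\<^sup>\<dagger>) (k s)" "g q" a] mG[rule_format, of y "k s" "app f (g q)" a]
        intertwiner_mel[OF F G p f _ c(2,1)] frame_closed[OF e] frame_closed[OF r] fc c v p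
      by simp
    thus "mel G y (app ((f\<^sup>\<dagger>)\<^sup>\<dagger>) (g q)) (k s) a = mel F y (g q) (app (f\<^sup>\<dagger>) (k s)) a"
      using af by simp
  qed (use af p in simp_all)
qed

text \<open>Both composites are sums over the same middle frame, and \<open>b \<otimes> a\<close>
  and its adjoint act factorwise on pure tensors. The relations for \<open>a\<close> and
  \<open>b\<close> therefore apply term by term.\<close>

lemma intertwiner_tmap:
  assumes F: "typed F" "typed F'" and G: "typed G" "typed G'"
    and p: "qdom F = qdom F'" "qcod F = qcod F'" "qdom G = qdom G'" "qcod G = qcod G'" "qcod F = qdom G"
    and a: "a \<in> intertwiners M F F'" and b: "b \<in> intertwiners M G G'"
  shows "b \<otimes> a \<in> intertwiners M (qcomp M G F) (qcomp M G' F')"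
proof -
  have p': "qcod F' = qdom G'" using p by simp
  note aa = intertwiner_arr[OF F a] and ab = intertwiner_arr[OF G b]
  note sp = typed_arr(3)[OF F(1)] typed_arr(3)[OF F(2)] typed_arr(3)[OF G(1)] typed_arr(3)[OF G(2)]
  obtain n e where e: "frame (qspace F) {..<n::nat} e" using frame_exists sp by blast
  obtain n' e' where e': "frame (qspace F') {..<n'::nat} e'" using frame_exists sp by blast
  obtain m k where k: "frame (qspace G) {..<m::nat} k" using frame_exists sp by blast
  obtain m' k' where k': "frame (qspace G') {..<m'::nat} k'" using frame_exists sp by blast
  obtain l f where f: "frame (space (qcod F)) {..<l::nat} f" using frame_exists typed_arr(5)[OF F(1)] by blast
  note c = frame_closed[OF e] frame_closed[OF e'] frame_closed[OF k] frame_closed[OF k'] frame_closed[OF f]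
  show ?thesis
  proof (rule intertwinerI[OF typed_qcomp[OF F(1) G(1) p(5)] typed_qcomp[OF F(2) G(2) p'] _ _ _ _ _
        frame_tensor[OF k e sp(3,1), folded qcomp_simps(3)] frame_tensor[OF k' e' sp(4,2), folded qcomp_simps(3)]])
    fix z q s x assume z: "z \<in> carrier (space (qcod (qcomp M G F)))" and q: "q \<in> {..<m'} \<times> {..<n'}"
      and s: "s \<in> {..<m} \<times> {..<n}" and x: "x \<in> carrier (space (qdom (qcomp M G F)))"
    obtain i j where ij: "q = (i, j)" "i < m'" "j < n'" using q by auto
    obtain i2 j2 where ij2: "s = (i2, j2)" "i2 < m" "j2 < n" using s by auto
    have z: "z \<in> carrier (space (qcod G))" and x: "x \<in> carrier (space (qdom F))" using z x by simp_all
    note c' = c(1)[of j2] c(2)[of j] c(3)[of i2] c(4)[of i]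
    have "mel (qcomp M G F) z (pure M (qspace G) (qspace F) (app (b\<^sup>\<dagger>) (k' i)) (app (a\<^sup>\<dagger>) (e' j))) (pure M (qspace G) (qspace F) (k i2) (e j2)) x
       = (\<Sum>r<l. mel G z (app (b\<^sup>\<dagger>) (k' i)) (k i2) (f r) * mel F (f r) (app (a\<^sup>\<dagger>) (e' j)) (e j2) x)"
      by (rule mel_qcomp[OF F(1) G(1) p(5) f z]) (use c' ij ij2 aa ab x in simp_all)
    also have "\<dots> = (\<Sum>r<l. mel G' z (k' i) (app b (k i2)) (f r) * mel F' (f r) (e' j) (app a (e j2)) x)"
      using intertwiner_mel[OF F p(1,2) a] intertwiner_mel[OF G p(3,4) b] c' ij ij2 x z c(5) p(5) by simp
    also have "\<dots> = mel (qcomp M G' F') z (pure M (qspace G') (qspace F') (k' i) (e' j)) (pure M (qspace G') (qspace F') (app b (k i2)) (app a (e j2))) x"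
      by (rule mel_qcomp[OF F(2) G(2) p' f[unfolded p(2)], symmetric]) (use c' ij ij2 aa ab x z p in simp_all)
    finally show "mel (qcomp M G F) z (app ((b \<otimes> a)\<^sup>\<dagger>) (case q of (i, j) \<Rightarrow> pure M (qspace G') (qspace F') (k' i) (e' j)))
        (case s of (i, j) \<Rightarrow> pure M (qspace G) (qspace F) (k i) (e j)) x =
      mel (qcomp M G' F') z (case q of (i, j) \<Rightarrow> pure M (qspace G') (qspace F') (k' i) (e' j))
        (app (b \<otimes> a) (case s of (i, j) \<Rightarrow> pure M (qspace G) (qspace F) (k i) (e j))) x"
      using ij ij2 c' aa ab by (simp add: adjoint_tmap)
  qed (use aa ab p in simp_all)
qed

text \<open>In terms of matrix elements this is associativity of matrix multiplication: both
  bracketings unfold to one double sum over frames of the two middle algebras.\<close>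

lemma intertwiner_assoc:
  assumes F: "typed F" and G: "typed G" and K: "typed K" and p: "qcod F = qdom G" "qcod G = qdom K"
  shows "assoc M (qspace K) (qspace G) (qspace F) \<in> intertwiners M (qcomp M (qcomp M K G) F) (qcomp M K (qcomp M G F))"
proof -
  define U V W where d: "U = qspace K" "V = qspace G" "W = qspace F"
  note sp = typed_arr(3)[OF K, folded d] typed_arr(3)[OF G, folded d] typed_arr(3)[OF F, folded d]
  obtain nu u where u: "frame U {..<nu::nat} u" using frame_exists sp by blast
  obtain nv v where v: "frame V {..<nv::nat} v" using frame_exists sp by blast
  obtain nw w where w: "frame W {..<nw::nat} w" using frame_exists sp by blast
  obtain l f where f: "frame (space (qcod F)) {..<l::nat} f" using frame_exists typed_arr(5)[OF F] by blast
  obtain m g where g: "frame (space (qcod G)) {..<m::nat} g" using frame_exists typed_arr(5)[OF G] by blast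
  note c = frame_closed[OF u] frame_closed[OF v] frame_closed[OF w] frame_closed[OF f] frame_closed[OF g]
  have KG: "typed (qcomp M K G)" and GF: "typed (qcomp M G F)" using typed_qcomp F G K p by auto
  have e: "qspace (qcomp M (qcomp M K G) F) = U \<boxtimes> V \<boxtimes> W" "qspace (qcomp M K (qcomp M G F)) = U \<boxtimes> (V \<boxtimes> W)"
    by (simp_all add: d)
  show ?thesis
    unfolding d[symmetric]
  proof (rule intertwinerI[where S = "({..<nu} \<times> {..<nv}) \<times> {..<nw}" and R = "{..<nu} \<times> ({..<nv} \<times> {..<nw})"])
    show "typed (qcomp M (qcomp M K G) F)" "typed (qcomp M K (qcomp M G F))"
      using typed_qcomp[OF F KG] typed_qcomp[OF GF K] p by simp_all
    show "frame (qspace (qcomp M (qcomp M K G) F)) (({..<nu} \<times> {..<nv}) \<times> {..<nw})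
        (\<lambda>(i, j). pure M (U \<boxtimes> V) W (case i of (i, j) \<Rightarrow> pure M U V (u i) (v j)) (w j))"
      unfolding e by (rule frame_tensor[OF frame_tensor[OF u v] w]) (use sp in simp_all)
    show "frame (qspace (qcomp M K (qcomp M G F))) ({..<nu} \<times> ({..<nv} \<times> {..<nw}))
        (\<lambda>(i, j). pure M U (V \<boxtimes> W) (u i) (case j of (i, j) \<Rightarrow> pure M V W (v i) (w j)))"
      unfolding e by (rule frame_tensor[OF u frame_tensor[OF v w]]) (use sp in simp_all)
    fix z q s x assume z: "z \<in> carrier (space (qcod (qcomp M (qcomp M K G) F)))"
      and q: "q \<in> {..<nu} \<times> ({..<nv} \<times> {..<nw})" and s: "s \<in> ({..<nu} \<times> {..<nv}) \<times> {..<nw}"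
      and x: "x \<in> carrier (space (qdom (qcomp M (qcomp M K G) F)))"
    have z: "z \<in> carrier (space (qcod K))" and x: "x \<in> carrier (space (qdom F))" using z x by simp_all
    obtain i j k where q: "q = (i, j, k)" "i < nu" "j < nv" "k < nw" using q by auto
    obtain i' j' k' where s: "s = ((i', j'), k')" "i' < nu" "j' < nv" "k' < nw" using s by auto
    let ?T = "\<lambda>y t. mel K z (u i) (u i') (g y) * mel G (g y) (v j) (v j') (f t) * mel F (f t) (w k) (w k') x"
    have "mel (qcomp M (qcomp M K G) F) z (pure M (U \<boxtimes> V) W (pure M U V (u i) (v j)) (w k))
          (pure M (U \<boxtimes> V) W (pure M U V (u i') (v j')) (w k')) x
        = (\<Sum>t<l. mel (qcomp M K G) z (pure M U V (u i) (v j)) (pure M U V (u i') (v j')) (f t) * mel F (f t) (w k) (w k') x)"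
      unfolding d using c q s z x sp p
      by (intro mel_qcomp[OF F KG _ f, unfolded qcomp_simps]) (simp_all add: d)
    also have "\<dots> = (\<Sum>t<l. (\<Sum>y<m. mel K z (u i) (u i') (g y) * mel G (g y) (v j) (v j') (f t)) * mel F (f t) (w k) (w k') x)"
      using c q s z p by (simp add: mel_qcomp[OF G K p(2) g, folded d])
    also have "\<dots> = (\<Sum>y<m. \<Sum>t<l. ?T y t)"
      by (subst sum.swap) (simp add: sum_distrib_right)
    also have "\<dots> = (\<Sum>y<m. mel K z (u i) (u i') (g y) * mel (qcomp M G F) (g y) (pure M V W (v j) (w k)) (pure M V W (v j') (w k')) x)"
      using c q s x p by (simp add: mel_qcomp[OF F G p(1) f, folded d] sum_distrib_left mult.assoc)
    also have "\<dots> = mel (qcomp M K (qcomp M G F)) z (pure M U (V \<boxtimes> W) (u i) (pure M V W (v j) (w k)))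
          (pure M U (V \<boxtimes> W) (u i') (pure M V W (v j') (w k'))) x"
      unfolding d using c q s z x sp p g
      by (intro mel_qcomp[OF GF K, unfolded qcomp_simps, symmetric]) (simp_all add: d)
    finally show "mel (qcomp M (qcomp M K G) F) z (app ((assoc M U V W)\<^sup>\<dagger>)
          (case q of (i, j) \<Rightarrow> pure M U (V \<boxtimes> W) (u i) (case j of (i, j) \<Rightarrow> pure M V W (v i) (w j))))
        (case s of (i, j) \<Rightarrow> pure M (U \<boxtimes> V) W (case i of (i, j) \<Rightarrow> pure M U V (u i) (v j)) (w j)) x
      = mel (qcomp M K (qcomp M G F)) z (case q of (i, j) \<Rightarrow> pure M U (V \<boxtimes> W) (u i) (case j of (i, j) \<Rightarrow> pure M V W (v i) (w j)))
        (app (assoc M U V W) (case s of (i, j) \<Rightarrow> pure M (U \<boxtimes> V) W (case i of (i, j) \<Rightarrow> pure M U V (u i) (v j)) (w j))) x"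
      using q s c sp by (simp add: app_adjoint_assoc)
  qed (use sp p in \<open>simp_all add: d\<close>)
qed

text \<open>The identity contributes the inner products of \<open>z\<close> with the middle frame,
  and the sum contracts in the bra slot of \<open>F\<close>.\<close>

lemma intertwiner_lunit:
  assumes F: "typed F"
  shows "lunit M (qspace F) \<in> intertwiners M (qcomp M (qid M (qcod F)) F) F"
proof -
  note sp = typed_arr(3)[OF F] and B = typed_arr(2)[OF F]
  obtain n g where g: "frame (qspace F) {..<n::nat} g" using frame_exists sp by blast
  obtain l f where f: "frame (space (qcod F)) {..<l::nat} f" using frame_exists typed_arr(5)[OF F] by blast
  note c = frame_closed[OF g] frame_closed[OF f]
  show ?thesis
  proof (rule intertwinerI[OF typed_qcomp[OF F typed_qid[OF B]] F _ _ _ _ _ _ g, where S = "{()} \<times> {..<n}"])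
    show "frame (qspace (qcomp M (qid M (qcod F)) F)) ({()} \<times> {..<n}) (\<lambda>(i, j). pure M \<I> (qspace F) (unit_vec M) (g j))"
      using frame_tensor[OF frame_scalars g] sp by simp
    fix z q s x assume z: "z \<in> carrier (space (qcod (qcomp M (qid M (qcod F)) F)))" and q: "q \<in> {..<n}" and s: "s \<in> {()} \<times> {..<n}"
      and x: "x \<in> carrier (space (qdom (qcomp M (qid M (qcod F)) F)))"
    have z: "z \<in> carrier (space (qcod F))" and x: "x \<in> carrier (space (qdom F))" using z x by simp_all
    obtain j where j: "s = ((), j)" "j < n" using s by auto
    have "mel (qcomp M (qid M (qcod F)) F) z (pure M \<I> (qspace F) (unit_vec M) (g q)) (pure M \<I> (qspace F) (unit_vec M) (g j)) x
        = (\<Sum>t<l. mel (qid M (qcod F)) z (unit_vec M) (unit_vec M) (f t) * mel F (f t) (g q) (g j) x)"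
      using mel_qcomp[OF F typed_qid[OF B] _ f, of z "unit_vec M" "unit_vec M" "g q" "g j" x] c q j z x by simp
    also have "\<dots> = mel F z (g q) (g j) x"
      using mel_expand_left[OF F f z] c q j z x by (simp add: mel_qid[OF B])
    finally show "mel (qcomp M (qid M (qcod F)) F) z (app ((lunit M (qspace F))\<^sup>\<dagger>) (g q))
        (case s of (i, j) \<Rightarrow> pure M \<I> (qspace F) (unit_vec M) (g j)) x =
      mel F z (g q) (app (lunit M (qspace F)) (case s of (i, j) \<Rightarrow> pure M \<I> (qspace F) (unit_vec M) (g j))) x"
      using c q j sp by (simp add: app_adjoint_lunit)
  qed (use sp in simp_all)
qed

text \<open>Here the identity contributes the coefficients of \<open>x\<close> in the frame, and the
  sum is an expansion in the last, linear slot of \<open>F\<close>.\<close>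

lemma intertwiner_runit:
  assumes F: "typed F"
  shows "runit M (qspace F) \<in> intertwiners M (qcomp M F (qid M (qdom F))) F"
proof -
  note sp = typed_arr(3)[OF F] and A = typed_arr(1)[OF F]
  obtain n g where g: "frame (qspace F) {..<n::nat} g" using frame_exists sp by blast
  obtain l e where e: "frame (space (qdom F)) {..<l::nat} e" using frame_exists typed_arr(4)[OF F] by blast
  note c = frame_closed[OF g] frame_closed[OF e]
  show ?thesis
  proof (rule intertwinerI[OF typed_qcomp[OF typed_qid[OF A] F] F _ _ _ _ _ _ g, where S = "{..<n} \<times> {()}"])
    show "frame (qspace (qcomp M F (qid M (qdom F)))) ({..<n} \<times> {()}) (\<lambda>(i, j). pure M (qspace F) \<I> (g i) (unit_vec M))"
      using frame_tensor[OF g frame_scalars] sp by simp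
    fix z q s x assume z: "z \<in> carrier (space (qcod (qcomp M F (qid M (qdom F)))))" and q: "q \<in> {..<n}" and s: "s \<in> {..<n} \<times> {()}"
      and x: "x \<in> carrier (space (qdom (qcomp M F (qid M (qdom F)))))"
    have z: "z \<in> carrier (space (qcod F))" and x: "x \<in> carrier (space (qdom F))" using z x by simp_all
    obtain j where j: "s = (j, ())" "j < n" using s by auto
    have "mel (qcomp M F (qid M (qdom F))) z (pure M (qspace F) \<I> (g q) (unit_vec M)) (pure M (qspace F) \<I> (g j) (unit_vec M)) x
        = (\<Sum>t<l. mel F z (g q) (g j) (e t) * mel (qid M (qdom F)) (e t) (unit_vec M) (unit_vec M) x)"
      using mel_qcomp[OF typed_qid[OF A] F, of "{..<l}" e z "g q" "g j" "unit_vec M" "unit_vec M" x] c e q j z x by simp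
    also have "\<dots> = mel F z (g q) (g j) x"
      using frame_expand[OF e typed_arr(4)[OF F] functional_mel[OF F z, of "g q" "g j"] x] c q j x
      by (simp add: mel_qid[OF A] mult.commute)
    finally show "mel (qcomp M F (qid M (qdom F))) z (app ((runit M (qspace F))\<^sup>\<dagger>) (g q))
        (case s of (i, j) \<Rightarrow> pure M (qspace F) \<I> (g i) (unit_vec M)) x =
      mel F z (g q) (app (runit M (qspace F)) (case s of (i, j) \<Rightarrow> pure M (qspace F) \<I> (g i) (unit_vec M))) x"
      using c q j sp by (simp add: app_adjoint_runit)
  qed (use sp in simp_all)
qed

end

section \<open>Assembly of the dagger 2-category\<close>

theorem theorem3p20:
  fixes M :: "'u tensor_model"
  assumes "hilbert_tensor_model M"
  shows "dagger_two_category (QSet M) adjoint"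
proof -
  interpret hilbert_tensor_model M by fact
  let ?C = "QSet M"
  have hom: "typed f \<and> quantum_function M f \<and> qdom f = A \<and> qcod f = B" if "f \<in> Hom1 ?C A B" for f A B
    using that quantum_function_typed by (auto simp: QSet_def)
  have ar: "arr a \<and> source a = qspace f \<and> target a = qspace g"
    if "f \<in> Hom1 ?C A B" "g \<in> Hom1 ?C A B" "a \<in> Hom2 ?C f g" for f g a A B
    using that hom[OF that(1)] hom[OF that(2)] intertwiner_arr[of f g a] by (simp add: QSet_def)
  have sp: "qspace f \<in> spaces M" if "f \<in> Hom1 ?C A B" for f A B
    using hom[OF that] typed_arr(3) by blast
  note Q = QSet_def
  \<comment> \<open>The inverse is the adjoint, which is itself an intertwiner by
    \<open>intertwiner_adjoint\<close>. Invertibility of the associators and unitors thus reduces to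
    unitarity of the underlying maps.\<close>
  have unitary: "iso2 ?C f g a"
    if fg: "quantum_function M f" "quantum_function M g" "qdom f = qdom g" "qcod f = qcod g"
      and a: "a \<in> intertwiners M f g" and u: "a\<^sup>\<dagger> \<cdot> a = lid (qspace f)" "a \<cdot> a\<^sup>\<dagger> = lid (qspace g)" for f g a
    unfolding iso2_def using intertwiner_adjoint[OF fg a] a u by (auto simp: Q)
  \<comment> \<open>The cases follow the order of the locale axioms: 1 to 18 belong to
    \<open>two_category\<close>, 19 to 26 to the dagger.\<close>
  show ?thesis
  proof (unfold_locales, goal_cases)
    case (1 A)
    thus ?case by (simp add: Q quantum_function_qid)
  next
    case (2 A B D f g)
    thus ?case by (simp add: Q quantum_function_qcomp)
  next
    case (3 A B f)
    thus ?case using hom[OF 3(3)] by (simp add: Q intertwiner_lid)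
  next
    case (4 A B f g h a b)
    thus ?case using hom[OF 4(3)] hom[OF 4(4)] hom[OF 4(5)] intertwiner_comp[of f g h a b] by (simp add: Q)
  next
    case (5 A B f g h k a b c)
    thus ?case using ar[OF 5(3,4,7)] ar[OF 5(4,5,8)] by (simp add: Q)
  next
    case (6 A B f g a)
    thus ?case using ar[OF 6(3,4,5)] by (simp add: Q)
  next
    case (7 A B f g a)
    thus ?case using ar[OF 7(3,4,5)] by (simp add: Q)
  next
    case (8 A B D f f' g g' a b)
    thus ?case using hom[OF 8(4)] hom[OF 8(5)] hom[OF 8(6)] hom[OF 8(7)] intertwiner_tmap[of f f' g g' a b]
      by (simp add: Q)
  next
    case (9 A B D f g)
    thus ?case using sp[OF 9(4)] sp[OF 9(5)] by (simp add: Q tmap_lid)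
  next
    case (10 A B D f f' f'' g g' g'' a a' b b')
    show ?case using ar[OF 10(4,5,10)] ar[OF 10(5,6,11)] ar[OF 10(7,8,12)] ar[OF 10(8,9,13)] by (simp add: Q tmap_comp)
  next
    case (11 A B D E f g h)
    thus ?case using hom[OF 11(5)] hom[OF 11(6)] hom[OF 11(7)] sp[OF 11(5)] sp[OF 11(6)] sp[OF 11(7)]
        unitary[of "qcomp M (qcomp M h g) f" "qcomp M h (qcomp M g f)" "assoc M (qspace h) (qspace g) (qspace f)"]
      by (simp add: Q assoc_unitary quantum_function_qcomp intertwiner_assoc)
  next
    case (12 A B D E f f' g g' h h' a b c)
    show ?case using ar[OF 12(5,6,11)] ar[OF 12(7,8,12)] ar[OF 12(9,10,13)] assoc_natural[of a b c] by (simp add: Q)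
  next
    case (13 A B f)
    thus ?case using hom[OF 13(3)] sp[OF 13(3)] unitary[of "qcomp M (qid M B) f" f "lunit M (qspace f)"]
        intertwiner_lunit[of f]
      by (auto simp: Q lunit_unitary quantum_function_qcomp quantum_function_qid)
  next
    case (14 A B f f' a)
    show ?case using ar[OF 14(3,4,5)] lunit_natural[of a] by (simp add: Q)
  next
    case (15 A B f)
    thus ?case using hom[OF 15(3)] sp[OF 15(3)] unitary[of "qcomp M f (qid M A)" f "runit M (qspace f)"]
        intertwiner_runit[of f]
      by (auto simp: Q runit_unitary quantum_function_qcomp quantum_function_qid)
  next
    case (16 A B f f' a)
    show ?case using ar[OF 16(3,4,5)] runit_natural[of a] by (simp add: Q)
  next
    case (17 A B D E F f g h k)
    show ?case using sp[OF 17(6)] sp[OF 17(7)] sp[OF 17(8)] sp[OF 17(9)] tensor_pentagon by (simp add: Q)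
  next
    case (18 A B D f g)
    show ?case using sp[OF 18(4)] sp[OF 18(5)] tensor_triangle by (simp add: Q)
  next
    case (19 A B f g a)
    thus ?case using hom[OF 19(3)] hom[OF 19(4)] intertwiner_adjoint[of f g a] by (simp add: Q)
  next
    case (20 A B f g a)
    thus ?case using ar[OF 20(3,4,5)] by simp
  next
    case (21 A B f)
    thus ?case using sp[OF 21(3)] by (simp add: Q)
  next
    case (22 A B f g h a b)
    show ?case using ar[OF 22(3,4,6)] ar[OF 22(4,5,7)] by (simp add: Q adjoint_comp)
  next
    case (23 A B D f f' g g' a b)
    show ?case using ar[OF 23(4,5,8)] ar[OF 23(6,7,9)] by (simp add: Q adjoint_tmap)
  next
    case (24 A B D E f g h)
    show ?case using sp[OF 24(5)] sp[OF 24(6)] sp[OF 24(7)] by (simp add: Q assoc_unitary)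
  next
    case (25 A B f)
    show ?case using sp[OF 25(3)] by (simp add: Q lunit_unitary)
  next
    case (26 A B f)
    show ?case using sp[OF 26(3)] by (simp add: Q runit_unitary)
  qed
qed

end
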